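(* Let $f\in\mathbb{Z}[x_1,\ldots,x_n]$ be a degree $k$ polynomial whose lexicographically first term is (a $\mathbb{Z}$-multiple of) a product of $k$ distinct variables. Let $Y$ be one of the schemes constructed from the hypersurface $f=0$ by taking components, intersecting, taking unions, and repeating. (Or more generally, let $Y$ be compatibly split with respect to the splitting $\mathrm{Tr}(f^{p-1}\bullet)$.) Then $Y$ is reduced over all but finitely many primes $p$, and over $\mathbb{Q}$. Let $\lambda$ be the lexicographic weighting $(\varepsilon,\varepsilon^2,\ldots,\varepsilon^n)$ on the variables, and let $\mathrm{init}\,Y$ be the initial scheme of $Y$. Then (away from those finitely many $p$) $\mathrm{init}\,Y$ is a Stanley–Reisner scheme. There is a bijective constructible map from $\mathbb{A}^n$ to itself, taking each $Y$ into its $\mathrm{init}\,Y$.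
   Context: A near-splitting of a commutative $\mathbb{F}_p$-algebra $R$ is a map $\varphi:R\to R$ with $\varphi(a+b)=\varphi(a)+\varphi(b)$ and $\varphi(a^pb)=a\,\varphi(b)$. It is a (Frobenius) splitting if moreover $\varphi(1)=1$. A subscheme with ideal $I$ is compatibly split by the splitting $\varphi$ if $\varphi(I)\subseteq I$. $\mathrm{Tr}(\bullet)$ is the unique near-splitting of $\mathbb{F}_p[x_1,\ldots,x_n]$ whose value on each monomial $m$ is $\sqrt[p]{m\prod_i x_i}\,\big/\prod_i x_i$ if $m\prod_i x_i$ is a $p$th power, and $0$ otherwise; $\mathrm{Tr}(h\bullet)$ is the map $g\mapsto\mathrm{Tr}(hg)$. Weightings may take values in $\mathbb{N}[\varepsilon]$ with $\varepsilon$ infinitesimally positive, i.e. $1>N_1\varepsilon>N_2\varepsilon^2>\cdots>0$ for all positive integers $N_i$. For a weighting $\lambda$, $\mathrm{init}(g)$ is the sum of the terms $c\prod_i x_i^{e_i}$ of $g$ with maximum $\sum_i\lambda_ie_i$, and $\mathrm{init}(I)$ is the span (over the base ring) of $\{\mathrm{init}(g):g\in I\}$; $\mathrm{init}\,Y$ is the scheme defined by $\mathrm{init}(I)$ where $I$ is the ideal of $Y$. The lexicographically first term of $f$ is its initial term for $\lambda=(\varepsilon,\ldots,\varepsilon^n)$. A Stanley–Reisner scheme is one whose ideal is generated by squarefree monomials, i.e. a reduced union of coordinate subspaces. The schemes $Y$ are constructed over $\mathbb{Z}$ and considered over $\mathbb{Q}$ and over $\mathbb{F}_p$ by base change; the statements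 about $\mathrm{init}\,Y$ and the constructible map are over these fields, for $p$ outside the finite exceptional set. A constructible map is one that is regular on each piece of some finite decomposition of the source into locally closed pieces. *)

theory Defs
  imports
    "HOL-Number_Theory.Residues"
    "HOL-Algebra.Algebra"
    "HOL-Algebra.Algebraic_Closure_Type"
    "HOL-Computational_Algebra.Polynomial"
begin

section \<open>Polynomial rings in the variables indexed by \<open>1, \<dots>, n\<close>\<close>

text \<open>
  The representation is the one of \<^theory>\<open>HOL-Algebra.Indexed_Polynomials\<close>: a monomial is the
  multiset of its variables, a polynomial maps monomials to coefficients.  That theory has no
  product of polynomials, hence the ring structure below.
\<close>

definition mpoly_support :: "('a, 'b) ring_scheme \<Rightarrow> (nat multiset \<Rightarrow> 'a) \<Rightarrow> nat multiset set" where
  "mpoly_support R g = {m. g m \<noteq> \<zero>\<^bsub>R\<^esub>}"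

definition mpoly_ring :: "('a, 'b) ring_scheme \<Rightarrow> nat \<Rightarrow> (nat multiset \<Rightarrow> 'a) ring" where
  "mpoly_ring R n =
    \<lparr>carrier = {g. finite (mpoly_support R g) \<and> (\<forall>m. g m \<in> carrier R) \<and>
                   (\<forall>m\<in>mpoly_support R g. set_mset m \<subseteq> {1..n})},
     monoid.mult = (\<lambda>g h m. \<Oplus>\<^bsub>R\<^esub>a\<in>{a. a \<subseteq># m}. g a \<otimes>\<^bsub>R\<^esub> h (m - a)),
     one = ring.indexed_const R \<one>\<^bsub>R\<^esub>,
     ring.zero = ring.indexed_const R \<zero>\<^bsub>R\<^esub>,
     add = (\<lambda>g h m. g m \<oplus>\<^bsub>R\<^esub> h m)\<rparr>"

definition mono_poly :: "('a, 'b) ring_scheme \<Rightarrow> 'a \<Rightarrow> nat multiset \<Rightarrow> (nat multiset \<Rightarrow> 'a)" where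
  "mono_poly R c m = (\<lambda>m'. if m' = m then c else \<zero>\<^bsub>R\<^esub>)"

definition total_degree :: "('a, 'b) ring_scheme \<Rightarrow> (nat multiset \<Rightarrow> 'a) \<Rightarrow> nat" where
  "total_degree R g = Max (size ` mpoly_support R g)"


section \<open>Weightings with values in \<open>\<nat>[\<epsilon>]\<close>, initial forms, initial ideals\<close>

text \<open>
  Elements of \<open>\<nat>[\<epsilon>]\<close> are polynomials over \<^typ>\<open>nat\<close>.  As \<open>1 > N\<^sub>1\<epsilon> > N\<^sub>2\<epsilon>\<^sup>2 > \<dots> > 0\<close> for all
  positive \<open>N\<^sub>i\<close>, two of them are compared at the lowest power of \<open>\<epsilon>\<close> where they differ.
\<close>

definition eps_less :: "nat poly \<Rightarrow> nat poly \<Rightarrow> bool" where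
  "eps_less a b \<longleftrightarrow> (\<exists>k. Polynomial.coeff a k < Polynomial.coeff b k \<and>
                        (\<forall>j<k. Polynomial.coeff a j = Polynomial.coeff b j))"

definition weight :: "(nat \<Rightarrow> nat poly) \<Rightarrow> nat multiset \<Rightarrow> nat poly" where
  "weight w m = (\<Sum>i\<in>#m. w i)"

definition lex_weighting :: "nat \<Rightarrow> nat poly" where
  "lex_weighting i = Polynomial.monom 1 i"

definition init_form ::
    "('a, 'b) ring_scheme \<Rightarrow> (nat \<Rightarrow> nat poly) \<Rightarrow> (nat multiset \<Rightarrow> 'a) \<Rightarrow> (nat multiset \<Rightarrow> 'a)" where
  "init_form R w g =
    (\<lambda>m. if \<exists>m'\<in>mpoly_support R g. eps_less (weight w m) (weight w m') then \<zero>\<^bsub>R\<^esub> else g m)"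

definition init_ideal ::
    "('a, 'b) ring_scheme \<Rightarrow> nat \<Rightarrow> (nat \<Rightarrow> nat poly) \<Rightarrow> (nat multiset \<Rightarrow> 'a) set
      \<Rightarrow> (nat multiset \<Rightarrow> 'a) set" where
  "init_ideal R n w I =
    (\<Union>gs\<in>lists I. ring.Span (mpoly_ring R n) (ring.indexed_const R ` carrier R)
                     (map (init_form R w) gs))"

definition stanley_reisner ::
    "('a, 'b) ring_scheme \<Rightarrow> nat \<Rightarrow> (nat multiset \<Rightarrow> 'a) set \<Rightarrow> bool" where
  "stanley_reisner R n I \<longleftrightarrow>
    (\<exists>\<S>\<subseteq>Pow {1..n}. I = Idl\<^bsub>mpoly_ring R n\<^esub> ((\<lambda>s. mono_poly R \<one>\<^bsub>R\<^esub> (mset_set s)) ` \<S>))"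


section \<open>Schemes\<close>

text \<open>
  A closed subscheme of affine \<open>n\<close>-space is given by its ideal; it is reduced iff its coordinate
  ring is.
\<close>

definition reduced_ring :: "('a, 'b) ring_scheme \<Rightarrow> bool" where
  "reduced_ring A \<longleftrightarrow> (\<forall>a\<in>carrier A. \<forall>m::nat. a [^]\<^bsub>A\<^esub> m = \<zero>\<^bsub>A\<^esub> \<longrightarrow> a = \<zero>\<^bsub>A\<^esub>)"

definition minimal_prime_over ::
    "('a, 'b) ring_scheme \<Rightarrow> 'a set \<Rightarrow> 'a set \<Rightarrow> bool" where
  "minimal_prime_over A I P \<longleftrightarrow>
    primeideal P A \<and> I \<subseteq> P \<and> (\<forall>Q. primeideal Q A \<and> I \<subseteq> Q \<and> Q \<subseteq> P \<longrightarrow> Q = P)"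

text \<open>
  The ideals of the subschemes obtained from the one with ideal \<open>I\<^sub>0\<close> by repeatedly taking
  irreducible components, intersections (sums of ideals) and unions (intersections of ideals).
\<close>

inductive_set constructed :: "('a, 'b) ring_scheme \<Rightarrow> 'a set \<Rightarrow> 'a set set"
  for A :: "('a, 'b) ring_scheme" and I\<^sub>0 :: "'a set" where
  start: "I\<^sub>0 \<in> constructed A I\<^sub>0"
| component: "I \<in> constructed A I\<^sub>0 \<Longrightarrow> minimal_prime_over A I P \<Longrightarrow> P \<in> constructed A I\<^sub>0"
| intersection: "I \<in> constructed A I\<^sub>0 \<Longrightarrow> J \<in> constructed A I\<^sub>0 \<Longrightarrow> I <+>\<^bsub>A\<^esub> J \<in> constructed A I\<^sub>0"
| union: "I \<in> constructed A I\<^sub>0 \<Longrightarrow> J \<in> constructed A I\<^sub>0 \<Longrightarrow> I \<inter> J \<in> constructed A I\<^sub>0"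

abbreviation rat_ring :: "rat ring" where
  "rat_ring \<equiv> ring_of_type_algebra"

abbreviation Fp :: "nat \<Rightarrow> int ring" where
  "Fp p \<equiv> residue_ring (int p)"

definition mod_poly :: "nat \<Rightarrow> (nat multiset \<Rightarrow> int) \<Rightarrow> (nat multiset \<Rightarrow> int)" where
  "mod_poly p g = (\<lambda>m. g m mod int p)"

definition base_change_Fp ::
    "nat \<Rightarrow> nat \<Rightarrow> (nat multiset \<Rightarrow> int) set \<Rightarrow> (nat multiset \<Rightarrow> int) set" where
  "base_change_Fp p n I = Idl\<^bsub>mpoly_ring (Fp p) n\<^esub> (mod_poly p ` I)"

definition base_change_Q ::
    "nat \<Rightarrow> (nat multiset \<Rightarrow> int) set \<Rightarrow> (nat multiset \<Rightarrow> rat) set" where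
  "base_change_Q n I = Idl\<^bsub>mpoly_ring rat_ring n\<^esub> ((\<lambda>g m. rat_of_int (g m)) ` I)"


section \<open>Near-splittings and compatibly split ideals\<close>

definition near_splitting :: "nat \<Rightarrow> ('a, 'b) ring_scheme \<Rightarrow> ('a \<Rightarrow> 'a) \<Rightarrow> bool" where
  "near_splitting p A \<phi> \<longleftrightarrow>
    \<phi> \<in> carrier A \<rightarrow>\<^sub>E carrier A \<and>
    (\<forall>a\<in>carrier A. \<forall>b\<in>carrier A. \<phi> (a \<oplus>\<^bsub>A\<^esub> b) = \<phi> a \<oplus>\<^bsub>A\<^esub> \<phi> b) \<and>
    (\<forall>a\<in>carrier A. \<forall>b\<in>carrier A. \<phi> (a [^]\<^bsub>A\<^esub> p \<otimes>\<^bsub>A\<^esub> b) = a \<otimes>\<^bsub>A\<^esub> \<phi> b)"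

text \<open>
  In multiset notation the product of two monomials is \<open>+\<close>, the \<open>p\<close>-th power of \<open>q\<close> is
  \<open>repeat_mset p q\<close>, and \<open>mset_set {1..n}\<close> is the product of all variables.
\<close>

definition Tr :: "nat \<Rightarrow> nat \<Rightarrow> (nat multiset \<Rightarrow> int) \<Rightarrow> (nat multiset \<Rightarrow> int)" where
  "Tr p n =
    (THE \<phi>. near_splitting p (mpoly_ring (Fp p) n) \<phi> \<and>
       (\<forall>m. set_mset m \<subseteq> {1..n} \<longrightarrow>
          (\<forall>q. m + mset_set {1..n} = repeat_mset p q \<longrightarrow>
             \<phi> (mono_poly (Fp p) \<one>\<^bsub>Fp p\<^esub> m) = mono_poly (Fp p) \<one>\<^bsub>Fp p\<^esub> (q - mset_set {1..n})) \<and>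
          ((\<nexists>q. m + mset_set {1..n} = repeat_mset p q) \<longrightarrow>
             \<phi> (mono_poly (Fp p) \<one>\<^bsub>Fp p\<^esub> m) = \<zero>\<^bsub>mpoly_ring (Fp p) n\<^esub>)))"

definition compatible :: "('a, 'b) ring_scheme \<Rightarrow> ('a \<Rightarrow> 'a) \<Rightarrow> 'a set \<Rightarrow> bool" where
  "compatible A \<phi> I \<longleftrightarrow> ideal I A \<and> \<phi> ` I \<subseteq> I"

text \<open>
  Compatibility with \<open>g \<mapsto> Tr (f\<^sup>p\<^sup>-\<^sup>1 g)\<close>.  If the initial monomial of \<open>f\<close> does not involve all \<open>n\<close>
  variables, this map is only a near-splitting (it kills \<open>1\<close>), so \<open>\<phi> 1 = 1\<close> is not required.
\<close>

definition split_mod ::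
    "nat \<Rightarrow> nat \<Rightarrow> (nat multiset \<Rightarrow> int) \<Rightarrow> (nat multiset \<Rightarrow> int) set \<Rightarrow> bool" where
  "split_mod p n f I \<longleftrightarrow>
    (let A = mpoly_ring (Fp p) n
     in compatible A (\<lambda>g. Tr p n (mod_poly p f [^]\<^bsub>A\<^esub> (p - 1) \<otimes>\<^bsub>A\<^esub> g)) I)"


section \<open>Constructible maps\<close>

text \<open>
  Points of affine \<open>n\<close>-space are taken over the algebraic closure of the base field \<open>K\<close>; closed
  sets and regular functions are defined by polynomials over \<open>K\<close> itself.
\<close>

type_synonym 'a closure_elem = "('a list \<times> nat) multiset \<Rightarrow> 'a"

definition affine_space :: "'a ring \<Rightarrow> nat \<Rightarrow> (nat \<Rightarrow> 'a closure_elem) set" where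
  "affine_space K n = {1..n} \<rightarrow>\<^sub>E carrier (field.alg_closure K)"

definition eval_at ::
    "'a ring \<Rightarrow> nat \<Rightarrow> (nat multiset \<Rightarrow> 'a) \<Rightarrow> (nat \<Rightarrow> 'a closure_elem) \<Rightarrow> 'a closure_elem" where
  "eval_at K n g x =
    (let L = field.alg_closure K
     in \<Oplus>\<^bsub>L\<^esub>m\<in>mpoly_support K g.
          ring.indexed_const K (g m) \<otimes>\<^bsub>L\<^esub> (\<Otimes>\<^bsub>L\<^esub>i\<in>{1..n}. x i [^]\<^bsub>L\<^esub> count m i))"

definition zeros ::
    "'a ring \<Rightarrow> nat \<Rightarrow> (nat multiset \<Rightarrow> 'a) set \<Rightarrow> (nat \<Rightarrow> 'a closure_elem) set" where
  "zeros K n I = {x \<in> affine_space K n. \<forall>g\<in>I. eval_at K n g x = \<zero>\<^bsub>field.alg_closure K\<^esub>}"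

definition locally_closed :: "'a ring \<Rightarrow> nat \<Rightarrow> (nat \<Rightarrow> 'a closure_elem) set \<Rightarrow> bool" where
  "locally_closed K n Z \<longleftrightarrow>
    (\<exists>I J. ideal I (mpoly_ring K n) \<and> ideal J (mpoly_ring K n) \<and> Z = zeros K n I - zeros K n J)"

definition regular_on ::
    "'a ring \<Rightarrow> nat \<Rightarrow> (nat \<Rightarrow> 'a closure_elem) set
      \<Rightarrow> ((nat \<Rightarrow> 'a closure_elem) \<Rightarrow> (nat \<Rightarrow> 'a closure_elem)) \<Rightarrow> bool" where
  "regular_on K n Z \<Phi> \<longleftrightarrow>
    (\<forall>i\<in>{1..n}. \<forall>x\<in>Z. \<exists>J g h.
       ideal J (mpoly_ring K n) \<and> x \<notin> zeros K n J \<and>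
       g \<in> carrier (mpoly_ring K n) \<and> h \<in> carrier (mpoly_ring K n) \<and>
       (\<forall>y\<in>Z - zeros K n J.
          eval_at K n h y \<noteq> \<zero>\<^bsub>field.alg_closure K\<^esub> \<and>
          \<Phi> y i \<otimes>\<^bsub>field.alg_closure K\<^esub> eval_at K n h y = eval_at K n g y))"

definition constructible_map ::
    "'a ring \<Rightarrow> nat \<Rightarrow> ((nat \<Rightarrow> 'a closure_elem) \<Rightarrow> (nat \<Rightarrow> 'a closure_elem)) \<Rightarrow> bool" where
  "constructible_map K n \<Phi> \<longleftrightarrow>
    \<Phi> \<in> affine_space K n \<rightarrow> affine_space K n \<and>
    (\<exists>\<D>. finite \<D> \<and> disjoint \<D> \<and> \<Union>\<D> = affine_space K n \<and>
         (\<forall>Z\<in>\<D>. locally_closed K n Z \<and> regular_on K n Z \<Phi>))"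

end

theory Submission
  imports Defs
begin

text \<open>
  Everything rests on one property of an ideal \<open>I\<close> over a field: with a monomial, the set of
  lexicographically leading monomials of \<open>I\<close> contains the product of the variables that occur in
  it.  Call this \<open>squarefree\<close>.

  \<^emph>\<open>Where it comes from.\<close>  Replacing a monomial \<open>m\<close> by \<open>m\<^sup>p\<close> times the \<open>(p-1)\<close>-st power of all
  variables preserves the lexicographic order, and \<open>Tr\<close> is the inverse of this operation; hence
  \<open>Tr\<close> maps leading terms to leading terms whenever they have the right form.  Suppose that the
  leading monomial of \<open>f\<close> is the product of all variables.  If \<open>g \<in> I\<close> has leading monomial \<open>m\<^sup>p\<close>,
  then \<open>Tr (f\<^sup>p\<^sup>-\<^sup>1 g) \<in> I\<close> has leading monomial \<open>m\<close>.  Starting from a multiple of a given leading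
  monomial that is a \<open>p\<^sup>e\<close>-th power, \<open>e\<close> steps lead to its squarefree part
  (\<open>trace_stable_squarefree\<close>).  Variables missing from the leading monomial of \<open>f\<close> are supplied
  by multiplying \<open>g\<close> with their \<open>(p-1)\<close>-st powers.

  \<^emph>\<open>What it gives.\<close>  The initial ideal is generated by squarefree monomials, and \<open>I\<close> is radical
  because a leading monomial of \<open>g\<^sup>k\<close> can be replaced by that of \<open>g\<close>.  If \<open>I\<close>, \<open>J\<close> and \<open>I \<inter> J\<close> are
  squarefree, then \<open>in (I \<inter> J) = in I \<inter> in J\<close>: elements of \<open>I\<close> and \<open>J\<close> with leading monomial \<open>m\<close>
  have a product in \<open>I \<inter> J\<close> with leading monomial \<open>m\<^sup>2\<close>.  So an intersection-closed family of
  squarefree ideals is finite, its members being determined by their initial ideals.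

  \<^emph>\<open>The degeneration map.\<close>  For such a family it is built one variable at a time, over any field.
  Let \<open>\<Pi>\<close> consist of the elements of \<open>I\<close> without \<open>x\<^sub>1\<close>, and \<open>\<Lambda>\<close> of the slopes \<open>v\<close> of the elements
  \<open>x\<^sub>1 v + v\<^sub>0\<close> of \<open>I\<close> that are linear in \<open>x\<^sub>1\<close>.  The initial scheme for the weight of \<open>x\<^sub>1\<close> lies over
  \<open>V(\<Pi>)\<close>; its fibre is a line over \<open>V(\<Lambda>)\<close> and the point \<open>0\<close> elsewhere.  The fibre of \<open>V(I)\<close> over a
  point of \<open>V(\<Pi>) - V(\<Lambda>)\<close> is at most the point \<open>- v\<^sub>0 / v\<close>, which the translation of \<open>x\<^sub>1\<close> by
  \<open>v\<^sub>0 / v\<close> moves to \<open>0\<close>.  This translation is the same for all \<open>I\<close> in the family, since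
  \<open>\<Lambda>\<close> of \<open>I \<inter> J\<close> is \<open>\<Lambda>\<close> of \<open>I\<close> intersected with \<open>\<Lambda>\<close> of \<open>J\<close>.  The following variables are treated
  in the same way with the ideals of coefficients \<open>block_coeffs\<close> in place of \<open>I\<close>.  The resulting
  map is triangular, hence bijective.

  \<^emph>\<open>From primes to the rationals and back.\<close>  By Dickson's lemma finitely many elements of an ideal
  \<open>I\<close> of integer polynomials account for all its leading monomials.  For primes that do not divide
  their leading coefficients, \<open>I\<close> modulo \<open>p\<close> and \<open>I\<close> over the rationals have the same leading
  monomials (\<open>lead_monos_mod\<close>), and the quotient by \<open>I\<close> has no \<open>p\<close>-torsion.  So squarefreeness
  passes from one large \<open>p\<close> to the rationals.  Let \<open>\<phi>\<close> be the map \<open>g \<mapsto> Tr (f\<^sup>p\<^sup>-\<^sup>1 g)\<close>.  The ideals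
  stable under \<open>\<phi>\<close> for almost all \<open>p\<close> contain \<open>(f)\<close> and are closed under sums, intersections and
  minimal primes \<open>Q\<close> over them.  If \<open>Q\<close> contains a nonzero integer, it becomes the unit ideal at
  almost all \<open>p\<close>; otherwise there is \<open>a \<notin> Q\<close> with \<open>a Q \<subseteq> I\<close> up to denominators, and
  \<open>a \<phi>(g) = \<phi>(a\<^sup>p g)\<close> carries the stability of \<open>I\<close> over to \<open>Q\<close> (\<open>split_annihilator\<close>).

  \<^emph>\<open>One exceptional set for all constructed schemes.\<close>  Over the rationals the constructed ideals
  form an intersection-closed squarefree family, so there are only finitely many.  Those over the
  integers may differ from their saturations at finitely many primes each, and the choice of one
  modulus that works for all sums of two saturations is inherited along the construction
  (\<open>uniform_saturation\<close>).
\<close>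

section \<open>The polynomial ring\<close>

definition monomials :: "nat \<Rightarrow> nat multiset set" where
  "monomials n = {m. set_mset m \<subseteq> {1..n}}"

lemma monomials_add [simp]: "a + b \<in> monomials n \<longleftrightarrow> a \<in> monomials n \<and> b \<in> monomials n"
  by (auto simp: monomials_def)

lemma monomials_empty [simp]: "{#} \<in> monomials n"
  by (simp add: monomials_def)

lemma monomials_subset: "a \<subseteq># b \<Longrightarrow> b \<in> monomials n \<Longrightarrow> a \<in> monomials n"
  using set_mset_mono by (auto simp: monomials_def)

lemma finite_submultisets [simp]: "finite {a. a \<subseteq># m}" for m :: "'c multiset"
proof (induction m)
  case (add x m)
  have "{a. a \<subseteq># add_mset x m} \<subseteq> {a. a \<subseteq># m} \<union> add_mset x ` {a. a \<subseteq># m}"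
  proof
    fix a assume "a \<in> {a. a \<subseteq># add_mset x m}"
    then have a: "a \<subseteq># add_mset x m" by simp
    show "a \<in> {a. a \<subseteq># m} \<union> add_mset x ` {a. a \<subseteq># m}"
    proof (cases "x \<in># a")
      case True
      then obtain b where "a = add_mset x b" by (meson multi_member_split)
      then show ?thesis using a by auto
    next
      case False
      then have "a \<subseteq># m"
        using a mset_subset_eq_count[OF a] False unfolding subseteq_mset_def
        by (metis count_add_mset not_in_iff zero_le)
      then show ?thesis by simp
    qed
  qed
  then show ?case using add finite_subset by blast
qed auto

context cring
begin

lemma mpoly_zero: "\<zero>\<^bsub>mpoly_ring R n\<^esub> = (\<lambda>m. \<zero>)"
  by (auto simp: mpoly_ring_def indexed_const_def)

lemma mpoly_one: "\<one>\<^bsub>mpoly_ring R n\<^esub> = mono_poly R \<one> {#}"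
  by (auto simp: mpoly_ring_def indexed_const_def mono_poly_def)

lemma mpoly_add: "g \<oplus>\<^bsub>mpoly_ring R n\<^esub> h = (\<lambda>m. g m \<oplus> h m)"
  by (simp add: mpoly_ring_def)

lemma mpoly_mult: "g \<otimes>\<^bsub>mpoly_ring R n\<^esub> h = (\<lambda>m. \<Oplus>a\<in>{a. a \<subseteq># m}. g a \<otimes> h (m - a))"
  by (simp add: mpoly_ring_def)

lemma mpoly_carrier:
  "g \<in> carrier (mpoly_ring R n) \<longleftrightarrow>
    finite {m. g m \<noteq> \<zero>} \<and> (\<forall>m. g m \<in> carrier R) \<and> (\<forall>m. g m \<noteq> \<zero> \<longrightarrow> m \<in> monomials n)"
  by (auto simp: mpoly_ring_def mpoly_support_def monomials_def)

lemma mpoly_coeff_closed [simp]: "g \<in> carrier (mpoly_ring R n) \<Longrightarrow> g m \<in> carrier R"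
  by (simp add: mpoly_carrier)

lemma mpoly_coeff_outside: "g \<in> carrier (mpoly_ring R n) \<Longrightarrow> m \<notin> monomials n \<Longrightarrow> g m = \<zero>"
  by (auto simp: mpoly_carrier)

lemma mono_poly_closed: "c \<in> carrier R \<Longrightarrow> m \<in> monomials n \<Longrightarrow> mono_poly R c m \<in> carrier (mpoly_ring R n)"
  unfolding mpoly_carrier mono_poly_def
  by (auto intro: rev_finite_subset[of "{m}"])

lemma mpoly_zero_closed: "(\<lambda>m. \<zero>) \<in> carrier (mpoly_ring R n)"
  by (simp add: mpoly_carrier)

lemma mpoly_add_closed:
  assumes "g \<in> carrier (mpoly_ring R n)" "h \<in> carrier (mpoly_ring R n)"
  shows "(\<lambda>m. g m \<oplus> h m) \<in> carrier (mpoly_ring R n)"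
proof -
  have "{m. g m \<oplus> h m \<noteq> \<zero>} \<subseteq> {m. g m \<noteq> \<zero>} \<union> {m. h m \<noteq> \<zero>}" by auto
  then show ?thesis
    using assms unfolding mpoly_carrier by (auto intro: finite_subset)
qed

lemma mpoly_mult_closed:
  assumes "g \<in> carrier (mpoly_ring R n)" "h \<in> carrier (mpoly_ring R n)"
  shows "g \<otimes>\<^bsub>mpoly_ring R n\<^esub> h \<in> carrier (mpoly_ring R n)"
proof -
  have *: "\<exists>a\<in>{m. g m \<noteq> \<zero>}. \<exists>b\<in>{m. h m \<noteq> \<zero>}. m = a + b"
    if nz: "(\<Oplus>a\<in>{a. a \<subseteq># m}. g a \<otimes> h (m - a)) \<noteq> \<zero>" for m
  proof -
    obtain a where a: "a \<subseteq># m" "g a \<otimes> h (m - a) \<noteq> \<zero>"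
    proof (rule ccontr)
      assume "\<not> thesis"
      then have "\<And>a. a \<in> {a. a \<subseteq># m} \<Longrightarrow> g a \<otimes> h (m - a) = \<zero>"
        using that by blast
      then have "(\<Oplus>a\<in>{a. a \<subseteq># m}. g a \<otimes> h (m - a)) = \<zero>"
        by (rule add.finprod_one_eqI)
      then show False using nz by contradiction
    qed
    then have "g a \<noteq> \<zero>" "h (m - a) \<noteq> \<zero>"
      using assms by (auto simp: mpoly_carrier)
    then show ?thesis
      using a(1) by (intro bexI[of _ a] bexI[of _ "m - a"]) auto
  qed
  have "{m. (\<Oplus>a\<in>{a. a \<subseteq># m}. g a \<otimes> h (m - a)) \<noteq> \<zero>} \<subseteq>
        (\<lambda>(a,b). a + b) ` ({m. g m \<noteq> \<zero>} \<times> {m. h m \<noteq> \<zero>})"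
    using * by force
  moreover have "finite ({m. g m \<noteq> \<zero>} \<times> {m. h m \<noteq> \<zero>})"
    using assms by (simp add: mpoly_carrier)
  ultimately have "finite {m. (\<Oplus>a\<in>{a. a \<subseteq># m}. g a \<otimes> h (m - a)) \<noteq> \<zero>}"
    by (meson finite_imageI finite_subset)
  moreover have "m \<in> monomials n" if "(\<Oplus>a\<in>{a. a \<subseteq># m}. g a \<otimes> h (m - a)) \<noteq> \<zero>" for m
    using *[OF that] assms by (auto simp: mpoly_carrier)
  ultimately show ?thesis
    using assms unfolding mpoly_mult mpoly_carrier
    by (auto intro!: finsum_closed simp: mpoly_carrier)
qed

lemma mono_poly_mult:
  assumes "c \<in> carrier R" "h \<in> carrier (mpoly_ring R n)"
  shows "mono_poly R c m \<otimes>\<^bsub>mpoly_ring R n\<^esub> h = (\<lambda>m'. if m \<subseteq># m' then c \<otimes> h (m' - m) else \<zero>)"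
proof
  fix m' :: "nat multiset"
  have "(\<Oplus>a\<in>{a. a \<subseteq># m'}. mono_poly R c m a \<otimes> h (m' - a)) =
        (\<Oplus>a\<in>{a. a \<subseteq># m'}. if m = a then c \<otimes> h (m' - a) else \<zero>)"
    using assms by (intro finsum_cong') (auto simp: mono_poly_def)
  also have "\<dots> = (if m \<subseteq># m' then c \<otimes> h (m' - m) else \<zero>)"
  proof (cases "m \<subseteq># m'")
    case True
    then show ?thesis
      using assms finsum_singleton[of m "{a. a \<subseteq># m'}" "\<lambda>a. c \<otimes> h (m' - a)"] by simp
  next
    case False
    then show ?thesis
      by (simp only: if_False) (rule add.finprod_one_eqI, auto)
  qed
  finally show "(mono_poly R c m \<otimes>\<^bsub>mpoly_ring R n\<^esub> h) m' = (if m \<subseteq># m' then c \<otimes> h (m' - m) else \<zero>)"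
    by (simp add: mpoly_mult)
qed

text \<open>
  A polynomial arises from zero by adding one new term at a time; identities that are additive in
  a factor therefore have to be checked on single terms only.
\<close>

lemma mpoly_induct [consumes 1, case_names zero add]:
  assumes g: "g \<in> carrier (mpoly_ring R n)"
    and zero: "Q (\<lambda>m. \<zero>)"
    and add: "\<And>c m g. c \<in> carrier R \<Longrightarrow> c \<noteq> \<zero> \<Longrightarrow> m \<in> monomials n \<Longrightarrow> g \<in> carrier (mpoly_ring R n) \<Longrightarrow>
       g m = \<zero> \<Longrightarrow> Q g \<Longrightarrow> Q (\<lambda>m'. mono_poly R c m m' \<oplus> g m')"
  shows "Q g"
proof -
  have "finite {m. g m \<noteq> \<zero>}" using g by (simp add: mpoly_carrier)
  then have "\<forall>g. {m. g m \<noteq> \<zero>} \<subseteq> F \<longrightarrow> g \<in> carrier (mpoly_ring R n) \<longrightarrow> Q g"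
    if "F = {m. g m \<noteq> \<zero>}" for F
    unfolding that
  proof (induction rule: finite_induct)
    case empty
    show ?case
    proof (intro allI impI)
      fix g :: "nat multiset \<Rightarrow> 'a" assume "{m. g m \<noteq> \<zero>} \<subseteq> {}"
      then have "g = (\<lambda>m. \<zero>)" by auto
      then show "Q g" using zero by simp
    qed
  next
    case (insert m F)
    show ?case
    proof (intro allI impI)
      fix g :: "nat multiset \<Rightarrow> 'a" assume g: "{m. g m \<noteq> \<zero>} \<subseteq> insert m F" "g \<in> carrier (mpoly_ring R n)"
      define g' where "g' = g(m := \<zero>)"
      have g': "g' \<in> carrier (mpoly_ring R n)" "{m. g' m \<noteq> \<zero>} \<subseteq> F"
        using g by (auto simp: g'_def mpoly_carrier elim: rev_finite_subset)
      have "Q g'" using g' insert.IH by blast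
      show "Q g"
      proof (cases "g m = \<zero>")
        case True
        then have "g' = g" by (auto simp: g'_def)
        then show ?thesis using \<open>Q g'\<close> by simp
      next
        case False
        have "Q (\<lambda>m'. mono_poly R (g m) m m' \<oplus> g' m')"
        proof (rule add)
          show "m \<in> monomials n" using g(2) False by (auto simp: mpoly_carrier)
          show "g' m = \<zero>" by (simp add: g'_def)
        qed (use g g' False \<open>Q g'\<close> in auto)
        moreover have "(\<lambda>m'. mono_poly R (g m) m m' \<oplus> g' m') = g"
          using g by (auto simp: mono_poly_def g'_def)
        ultimately show ?thesis by simp
      qed
    qed
  qed
  then show ?thesis using g by blast
qed

lemma mpoly_mult_comm:
  assumes "g \<in> carrier (mpoly_ring R n)" "h \<in> carrier (mpoly_ring R n)"
  shows "g \<otimes>\<^bsub>mpoly_ring R n\<^esub> h = h \<otimes>\<^bsub>mpoly_ring R n\<^esub> g"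
proof
  fix m :: "nat multiset"
  have "bij_betw (\<lambda>a. m - a) {a. a \<subseteq># m} {a. a \<subseteq># m}"
    by (rule bij_betwI[where g = "\<lambda>a. m - a"]) (auto simp: multiset_eq_iff subseteq_mset_def)
  then have inj: "inj_on (\<lambda>a. m - a) {a. a \<subseteq># m}" and im: "(\<lambda>a. m - a) ` {a. a \<subseteq># m} = {a. a \<subseteq># m}"
    by (auto simp: bij_betw_def)
  have "(\<Oplus>a\<in>{a. a \<subseteq># m}. g a \<otimes> h (m - a)) = (\<Oplus>a\<in>(\<lambda>a. m - a) ` {a. a \<subseteq># m}. g a \<otimes> h (m - a))"
    by (simp only: im)
  also have "\<dots> = (\<Oplus>a\<in>{a. a \<subseteq># m}. g (m - a) \<otimes> h (m - (m - a)))"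
    using assms by (intro finsum_reindex inj) auto
  also have "\<dots> = (\<Oplus>a\<in>{a. a \<subseteq># m}. h a \<otimes> g (m - a))"
  proof (intro finsum_cong')
    fix a :: "nat multiset" assume "a \<in> {a. a \<subseteq># m}"
    then have "m - (m - a) = a" by (auto simp: multiset_eq_iff subseteq_mset_def)
    then show "g (m - a) \<otimes> h (m - (m - a)) = h a \<otimes> g (m - a)"
      using assms by (simp add: m_comm)
  qed (use assms in auto)
  finally show "(g \<otimes>\<^bsub>mpoly_ring R n\<^esub> h) m = (h \<otimes>\<^bsub>mpoly_ring R n\<^esub> g) m"
    by (simp add: mpoly_mult)
qed

lemma mpoly_l_distr:
  assumes "g \<in> carrier (mpoly_ring R n)" "g' \<in> carrier (mpoly_ring R n)" "h \<in> carrier (mpoly_ring R n)"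
  shows "(\<lambda>m. g m \<oplus> g' m) \<otimes>\<^bsub>mpoly_ring R n\<^esub> h =
    (\<lambda>m. (g \<otimes>\<^bsub>mpoly_ring R n\<^esub> h) m \<oplus> (g' \<otimes>\<^bsub>mpoly_ring R n\<^esub> h) m)"
proof
  fix m :: "nat multiset"
  have "(\<Oplus>a\<in>{a. a \<subseteq># m}. (g a \<oplus> g' a) \<otimes> h (m - a)) =
      (\<Oplus>a\<in>{a. a \<subseteq># m}. g a \<otimes> h (m - a) \<oplus> g' a \<otimes> h (m - a))"
    using assms by (intro finsum_cong') (auto simp: l_distr)
  also have "\<dots> = (\<Oplus>a\<in>{a. a \<subseteq># m}. g a \<otimes> h (m - a)) \<oplus> (\<Oplus>a\<in>{a. a \<subseteq># m}. g' a \<otimes> h (m - a))"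
    using assms by (intro finsum_addf) auto
  finally show "((\<lambda>m. g m \<oplus> g' m) \<otimes>\<^bsub>mpoly_ring R n\<^esub> h) m =
      (g \<otimes>\<^bsub>mpoly_ring R n\<^esub> h) m \<oplus> (g' \<otimes>\<^bsub>mpoly_ring R n\<^esub> h) m"
    by (simp add: mpoly_mult)
qed

text \<open>
  For a single term convolution is a shift of exponents.  Associativity is additive in the left
  factor and reduces to this case.
\<close>

lemma mono_mpoly_assoc:
  assumes "c \<in> carrier R" "m \<in> monomials n" "h \<in> carrier (mpoly_ring R n)" "k \<in> carrier (mpoly_ring R n)"
  shows "(mono_poly R c m \<otimes>\<^bsub>mpoly_ring R n\<^esub> h) \<otimes>\<^bsub>mpoly_ring R n\<^esub> k =
    mono_poly R c m \<otimes>\<^bsub>mpoly_ring R n\<^esub> (h \<otimes>\<^bsub>mpoly_ring R n\<^esub> k)"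
proof
  fix m' :: "nat multiset"
  let ?s = "mono_poly R c m \<otimes>\<^bsub>mpoly_ring R n\<^esub> h"
  have s: "?s = (\<lambda>m'. if m \<subseteq># m' then c \<otimes> h (m' - m) else \<zero>)"
    using assms by (intro mono_poly_mult)
  have sc: "?s \<in> carrier (mpoly_ring R n)"
    using assms by (intro mpoly_mult_closed mono_poly_closed)
  have rhs: "(mono_poly R c m \<otimes>\<^bsub>mpoly_ring R n\<^esub> (h \<otimes>\<^bsub>mpoly_ring R n\<^esub> k)) m' =
     (if m \<subseteq># m' then c \<otimes> (\<Oplus>a\<in>{a. a \<subseteq># m' - m}. h a \<otimes> k (m' - m - a)) else \<zero>)"
    using assms mpoly_mult_closed[of h n k] by (simp add: mono_poly_mult) (simp add: mpoly_mult)
  have lhs: "(?s \<otimes>\<^bsub>mpoly_ring R n\<^esub> k) m' = (\<Oplus>a\<in>{a. a \<subseteq># m'}. ?s a \<otimes> k (m' - a))"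
    by (simp add: mpoly_mult)
  show "(?s \<otimes>\<^bsub>mpoly_ring R n\<^esub> k) m' = (mono_poly R c m \<otimes>\<^bsub>mpoly_ring R n\<^esub> (h \<otimes>\<^bsub>mpoly_ring R n\<^esub> k)) m'"
  proof (cases "m \<subseteq># m'")
    case False
    then have "\<not> m \<subseteq># a" if "a \<subseteq># m'" for a
      using that subset_mset.order_trans by blast
    then have "(\<Oplus>a\<in>{a. a \<subseteq># m'}. ?s a \<otimes> k (m' - a)) = \<zero>"
      using assms by (intro add.finprod_one_eqI) (auto simp: s)
    then show ?thesis using False by (simp add: lhs rhs)
  next
    case True
    have im: "(+) m ` {a. a \<subseteq># m' - m} \<subseteq> {a. a \<subseteq># m'}"
      using True by (auto simp: subset_mset.le_diff_conv2 add.commute)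
    have out: "?s a = \<zero>" if "a \<subseteq># m'" "a \<notin> (+) m ` {a. a \<subseteq># m' - m}" for a
    proof -
      have "\<not> m \<subseteq># a"
      proof
        assume "m \<subseteq># a"
        then have "a = m + (a - m)" "a - m \<subseteq># m' - m"
          using that(1) by (auto simp: subset_eq_diff_conv)
        then show False using that(2) by blast
      qed
      then show ?thesis by (simp add: s)
    qed
    have "(\<Oplus>a\<in>{a. a \<subseteq># m'}. ?s a \<otimes> k (m' - a)) = (\<Oplus>a\<in>(+) m ` {a. a \<subseteq># m' - m}. ?s a \<otimes> k (m' - a))"
      using im out sc assms by (intro add.finprod_mono_neutral_cong_right) auto
    also have "\<dots> = (\<Oplus>a\<in>{a. a \<subseteq># m' - m}. ?s (m + a) \<otimes> k (m' - (m + a)))"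
      using sc assms by (intro finsum_reindex) (auto simp: inj_on_def)
    also have "\<dots> = (\<Oplus>a\<in>{a. a \<subseteq># m' - m}. c \<otimes> (h a \<otimes> k (m' - m - a)))"
      using assms by (intro finsum_cong') (auto simp: s m_assoc)
    also have "\<dots> = c \<otimes> (\<Oplus>a\<in>{a. a \<subseteq># m' - m}. h a \<otimes> k (m' - m - a))"
      using assms by (intro finsum_rdistr[symmetric]) auto
    finally show ?thesis using True by (simp add: lhs rhs)
  qed
qed

lemma mpoly_mult_assoc:
  assumes "g \<in> carrier (mpoly_ring R n)" "h \<in> carrier (mpoly_ring R n)" "k \<in> carrier (mpoly_ring R n)"
  shows "(g \<otimes>\<^bsub>mpoly_ring R n\<^esub> h) \<otimes>\<^bsub>mpoly_ring R n\<^esub> k = g \<otimes>\<^bsub>mpoly_ring R n\<^esub> (h \<otimes>\<^bsub>mpoly_ring R n\<^esub> k)"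
  using assms(1)
proof (induction rule: mpoly_induct)
  case zero
  have "(\<lambda>m. \<zero>) \<otimes>\<^bsub>mpoly_ring R n\<^esub> h' = (\<lambda>m. \<zero>)" if "h' \<in> carrier (mpoly_ring R n)" for h'
    using that by (auto simp: mpoly_mult intro!: add.finprod_one_eqI)
  then show ?case using assms mpoly_mult_closed by simp
next
  case (add c m g)
  then show ?case
    using assms by (simp add: mpoly_l_distr mono_poly_closed mpoly_mult_closed mono_mpoly_assoc)
qed

theorem mpoly_cring: "cring (mpoly_ring R n)"
proof (rule cringI)
  have "\<exists>h\<in>carrier (mpoly_ring R n). h \<oplus>\<^bsub>mpoly_ring R n\<^esub> g = \<zero>\<^bsub>mpoly_ring R n\<^esub>"
    if "g \<in> carrier (mpoly_ring R n)" for g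
    using that by (intro bexI[of _ "\<lambda>m. \<ominus> g m"])
      (auto simp: mpoly_add mpoly_zero l_neg mpoly_carrier elim!: rev_finite_subset)
  then show "abelian_group (mpoly_ring R n)"
    by (intro abelian_groupI)
      (auto simp: mpoly_add mpoly_zero mpoly_add_closed mpoly_zero_closed a_ac
        intro!: ext intro: a_comm)
  have one: "\<one>\<^bsub>mpoly_ring R n\<^esub> \<otimes>\<^bsub>mpoly_ring R n\<^esub> g = g" if "g \<in> carrier (mpoly_ring R n)" for g
    using that by (simp add: mpoly_one mono_poly_mult)
  show "Group.comm_monoid (mpoly_ring R n)"
  proof (rule comm_monoidI)
    show "\<one>\<^bsub>mpoly_ring R n\<^esub> \<in> carrier (mpoly_ring R n)"
      by (simp add: mpoly_one mono_poly_closed)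
  qed (use one mpoly_mult_closed mpoly_mult_assoc mpoly_mult_comm in auto)
qed (auto simp: mpoly_add mpoly_l_distr)

end

locale mpoly_over = cring R for R (structure) + fixes n :: nat

abbreviation (in mpoly_over) P where "P \<equiv> mpoly_ring R n"

sublocale mpoly_over \<subseteq> P: cring P
  by (rule mpoly_cring)

section \<open>The lexicographic order on monomials\<close>

definition lex_less :: "nat multiset \<Rightarrow> nat multiset \<Rightarrow> bool" (infix "\<lless>" 50) where
  "a \<lless> b \<longleftrightarrow> eps_less (weight lex_weighting a) (weight lex_weighting b)"

lemma coeff_weight_lex: "Polynomial.coeff (weight lex_weighting m) k = count m k"
  by (induction m) (auto simp: weight_def lex_weighting_def)

text \<open>
  The powers of \<open>\<epsilon>\<close> in the weight of a monomial are its exponents, so the order is the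
  lexicographic one with \<open>x\<^sub>1 > x\<^sub>2 > \<dots>\<close>.
\<close>

lemma lex_less_iff: "a \<lless> b \<longleftrightarrow> (\<exists>k. count a k < count b k \<and> (\<forall>j<k. count a j = count b j))"
  by (simp add: lex_less_def eps_less_def coeff_weight_lex)

lemma lex_irrefl [simp]: "\<not> a \<lless> a"
  by (auto simp: lex_less_iff)

lemma lex_trans: "a \<lless> b \<Longrightarrow> b \<lless> c \<Longrightarrow> a \<lless> c"
proof -
  assume "a \<lless> b" "b \<lless> c"
  then obtain k l where
    "count a k < count b k" "\<forall>j<k. count a j = count b j"
    "count b l < count c l" "\<forall>j<l. count b j = count c j"
    by (auto simp: lex_less_iff)
  then show ?thesis
    unfolding lex_less_iff
    by (intro exI[of _ "min k l"]) (cases k l rule: linorder_cases; auto simp: min_def)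
qed

lemma lex_total: "a \<noteq> b \<Longrightarrow> a \<lless> b \<or> b \<lless> a"
proof -
  assume "a \<noteq> b"
  then have ex: "\<exists>k. count a k \<noteq> count b k" by (auto simp: multiset_eq_iff)
  define k where "k = (LEAST k. count a k \<noteq> count b k)"
  have "count a k \<noteq> count b k" unfolding k_def using ex by (rule LeastI_ex)
  moreover have "\<forall>j<k. count a j = count b j" unfolding k_def using not_less_Least by blast
  ultimately show ?thesis by (auto simp: lex_less_iff) (metis linorder_neqE_nat)
qed

lemma lex_asym: "a \<lless> b \<Longrightarrow> \<not> b \<lless> a"
  using lex_trans lex_irrefl by blast

lemma lex_add_right [simp]: "a + c \<lless> b + c \<longleftrightarrow> a \<lless> b"
  by (simp add: lex_less_iff)

lemma lex_add_left [simp]: "c + a \<lless> c + b \<longleftrightarrow> a \<lless> b"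
  by (simp add: lex_less_iff)

lemma lex_repeat_mset: "a \<lless> b \<Longrightarrow> p > 0 \<Longrightarrow> repeat_mset p a \<lless> repeat_mset p b"
  by (auto simp: lex_less_iff)

text \<open>
  In infinitely many variables the order has infinite descents such as \<open>x\<^sub>1 > x\<^sub>2 > \<dots>\<close>.  Monomials in
  \<open>x\<^sub>1, \<dots>, x\<^sub>n\<close> are exponent lists of one fixed length, for which the lexicographic order is
  well-founded.
\<close>

lemma lex_induct [consumes 1]:
  assumes "b \<in> monomials n"
    and "\<And>b. b \<in> monomials n \<Longrightarrow> (\<And>a. a \<in> monomials n \<Longrightarrow> a \<lless> b \<Longrightarrow> Q a) \<Longrightarrow> Q b"
  shows "Q b"
proof -
  \<comment> \<open>Position \<open>0\<close> of the list is the exponent of a variable that does not occur.\<close>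
  define f where "f = (\<lambda>m. map (count m) [0..<Suc n] :: nat list)"
  have "(f a, f b) \<in> lex less_than" if ab: "a \<in> monomials n" "b \<in> monomials n" "a \<lless> b" for a b
  proof -
    obtain k where k: "count a k < count b k" "\<forall>j<k. count a j = count b j"
      using ab(3) by (auto simp: lex_less_iff)
    have "k \<le> n"
    proof (rule ccontr)
      assume "\<not> k \<le> n"
      then have "k \<notin># b" using ab(2) by (auto simp: monomials_def)
      then show False using k(1) by (simp add: not_in_iff)
    qed
    have "[0..<Suc n] = [0..<k] @ [k..<Suc n]"
      using upt_add_eq_append[of 0 k "Suc n - k"] \<open>k \<le> n\<close> by (simp del: upt_Suc)
    also have "[k..<Suc n] = k # [Suc k..<Suc n]"
      using \<open>k \<le> n\<close> by (intro upt_conv_Cons) simp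
    finally have "map (count m) [0..<Suc n] = map (count m) [0..<k] @ count m k # map (count m) [Suc k..<Suc n]"
      for m :: "nat multiset"
      by (simp del: upt_Suc)
    then have "f m = map (count m) [0..<k] @ count m k # map (count m) [Suc k..<Suc n]" for m
      by (simp add: f_def del: upt_Suc)
    moreover have "map (count a) [0..<k] = map (count b) [0..<k]"
      using k(2) by simp
    moreover have "length (f a) = length (f b)" by (simp add: f_def)
    ultimately show ?thesis
      using k(1) unfolding lex_conv mem_Collect_eq prod.case less_than_iff by metis
  qed
  then have "{(a, b). a \<in> monomials n \<and> b \<in> monomials n \<and> a \<lless> b} \<subseteq> inv_image (lex less_than) f"
    by (auto simp: inv_image_def)
  then have "wf {(a, b). a \<in> monomials n \<and> b \<in> monomials n \<and> a \<lless> b}"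
    by (rule wf_subset[rotated]) (intro wf_inv_image wf_lex wf_less_than)
  then have "b \<in> monomials n \<longrightarrow> Q b"
    by (induction b rule: wf_induct_rule) (use assms(2) in blast)
  then show ?thesis using assms(1) by blast
qed

lemma finite_lex_max:
  assumes "finite A" "A \<noteq> {}"
  shows "\<exists>m\<in>A. \<forall>m'\<in>A. \<not> m \<lless> m'"
  using assms
proof (induction rule: finite_ne_induct)
  case (insert x F)
  then obtain m where "m \<in> F" "\<forall>m'\<in>F. \<not> m \<lless> m'" by blast
  then show ?case
    using lex_trans[of m x] lex_asym by (cases "m \<lless> x") auto
qed auto


section \<open>Leading monomials\<close>

definition lead_at :: "('a, 'b) ring_scheme \<Rightarrow> (nat multiset \<Rightarrow> 'a) \<Rightarrow> nat multiset \<Rightarrow> bool" where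
  "lead_at R g m \<longleftrightarrow> g m \<noteq> \<zero>\<^bsub>R\<^esub> \<and> (\<forall>m'. m \<lless> m' \<longrightarrow> g m' = \<zero>\<^bsub>R\<^esub>)"

definition lead_monos :: "('a, 'b) ring_scheme \<Rightarrow> (nat multiset \<Rightarrow> 'a) set \<Rightarrow> nat multiset set" where
  "lead_monos R I = {m. \<exists>g\<in>I. lead_at R g m}"

text \<open>
  Only the scalars act.  Leading term arguments need no more than this, and the modules of
  coefficients that occur below are not ideals of the full polynomial ring.
\<close>

definition coeff_submodule ::
    "('a, 'b) ring_scheme \<Rightarrow> nat \<Rightarrow> (nat multiset \<Rightarrow> 'a) set \<Rightarrow> bool" where
  "coeff_submodule R n M \<longleftrightarrow> M \<subseteq> carrier (mpoly_ring R n) \<and> (\<lambda>m. \<zero>\<^bsub>R\<^esub>) \<in> M \<and>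
    (\<forall>g\<in>M. \<forall>h\<in>M. \<forall>c\<in>carrier R. \<forall>d\<in>carrier R.
       (\<lambda>m. c \<otimes>\<^bsub>R\<^esub> g m \<oplus>\<^bsub>R\<^esub> d \<otimes>\<^bsub>R\<^esub> h m) \<in> M)"

lemma lead_at_unique: "lead_at R g a \<Longrightarrow> lead_at R g b \<Longrightarrow> a = b"
  using lex_total unfolding lead_at_def by blast

lemma submodule_comb:
  "coeff_submodule R n M \<Longrightarrow> g \<in> M \<Longrightarrow> h \<in> M \<Longrightarrow> c \<in> carrier R \<Longrightarrow> d \<in> carrier R \<Longrightarrow>
    (\<lambda>m. c \<otimes>\<^bsub>R\<^esub> g m \<oplus>\<^bsub>R\<^esub> d \<otimes>\<^bsub>R\<^esub> h m) \<in> M"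
  by (simp add: coeff_submodule_def)

lemma lead_monos_mono: "I \<subseteq> J \<Longrightarrow> lead_monos R I \<subseteq> lead_monos R J"
  by (auto simp: lead_monos_def)

context mpoly_over
begin

lemma lead_at_exists:
  assumes "g \<in> carrier P" "g \<noteq> (\<lambda>m. \<zero>)"
  obtains m where "lead_at R g m"
proof -
  have "finite {m. g m \<noteq> \<zero>}" "{m. g m \<noteq> \<zero>} \<noteq> {}"
    using assms by (auto simp: mpoly_carrier)
  from finite_lex_max[OF this] show ?thesis
    using that by (auto simp: lead_at_def)
qed

lemma lead_at_monomials: "g \<in> carrier P \<Longrightarrow> lead_at R g m \<Longrightarrow> m \<in> monomials n"
  by (auto simp: lead_at_def mpoly_carrier)

lemma ideal_carrier: "ideal I P \<Longrightarrow> g \<in> I \<Longrightarrow> g \<in> carrier P"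
  using ideal.Icarr by metis

lemma scalar_mult:
  "c \<in> carrier R \<Longrightarrow> g \<in> carrier P \<Longrightarrow> mono_poly R c {#} \<otimes>\<^bsub>P\<^esub> g = (\<lambda>m. c \<otimes> g m)"
  by (simp add: mono_poly_mult)

lemma scalar_closed: "c \<in> carrier R \<Longrightarrow> g \<in> carrier P \<Longrightarrow> (\<lambda>m. c \<otimes> g m) \<in> carrier P"
  using P.m_closed[OF mono_poly_closed[of c "{#}" n], of g] by (simp add: scalar_mult)

lemma ideal_zero: "ideal I P \<Longrightarrow> (\<lambda>m. \<zero>) \<in> I"
  using additive_subgroup.zero_closed[of I P] by (auto simp: ideal_def mpoly_zero)

lemma ideal_scalar: "ideal I P \<Longrightarrow> g \<in> I \<Longrightarrow> c \<in> carrier R \<Longrightarrow> (\<lambda>m. c \<otimes> g m) \<in> I"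
  using ideal.I_l_closed[of I P g "mono_poly R c {#}"] ideal_carrier[of I g]
  by (simp add: scalar_mult mono_poly_closed)

lemma ideal_add: "ideal I P \<Longrightarrow> g \<in> I \<Longrightarrow> h \<in> I \<Longrightarrow> (\<lambda>m. g m \<oplus> h m) \<in> I"
  using additive_subgroup.a_closed[of I P g h] by (auto simp: ideal_def mpoly_add)

lemma ideal_submodule: "ideal I P \<Longrightarrow> coeff_submodule R n I"
  unfolding coeff_submodule_def
proof (intro conjI ballI subsetI)
  fix g h c d assume "ideal I P" "g \<in> I" "h \<in> I" "c \<in> carrier R" "d \<in> carrier R"
  then show "(\<lambda>m. c \<otimes> g m \<oplus> d \<otimes> h m) \<in> I"
    by (intro ideal_add ideal_scalar)
qed (use ideal_zero ideal_carrier in auto)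

text \<open>
  Lowering one of two factors lowers the product, so \<open>a + b\<close> is reached by the two top monomials
  only.
\<close>

lemma mult_coeff_above:
  assumes "g \<in> carrier P" "h \<in> carrier P"
    and g: "\<And>m'. a \<lless> m' \<Longrightarrow> g m' = \<zero>" and h: "\<And>m'. b \<lless> m' \<Longrightarrow> h m' = \<zero>"
  shows "(g \<otimes>\<^bsub>P\<^esub> h) (a + b) = g a \<otimes> h b"
    and "\<And>m. a + b \<lless> m \<Longrightarrow> (g \<otimes>\<^bsub>P\<^esub> h) m = \<zero>"
proof -
  have *: "g x \<otimes> h (m - x) = \<zero>" if "x \<subseteq># m" "a + b \<lless> m \<or> m = a + b" "x \<noteq> a \<or> m \<noteq> a + b" for x m
  proof (rule ccontr)
    assume "g x \<otimes> h (m - x) \<noteq> \<zero>"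
    then have "g x \<noteq> \<zero>" "h (m - x) \<noteq> \<zero>" using assms by auto
    then have "\<not> a \<lless> x" "\<not> b \<lless> m - x" using g h by blast+
    then have "x \<lless> a \<or> x = a" "m - x \<lless> b \<or> m - x = b" using lex_total by blast+
    moreover have m: "m = x + (m - x)" using that(1) by simp
    have "x + (m - x) \<lless> a + b" if "x \<noteq> a \<or> m - x \<noteq> b"
    proof -
      have "x + (m - x) \<lless> a + (m - x) \<or> x = a" "a + (m - x) \<lless> a + b \<or> m - x = b"
        using calculation by auto
      then show ?thesis using that lex_trans by metis
    qed
    then have "m \<lless> a + b \<or> (x = a \<and> m = a + b)" using m by metis
    then show False using that lex_asym by auto
  qed
  show "(g \<otimes>\<^bsub>P\<^esub> h) m = \<zero>" if "a + b \<lless> m" for m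
    unfolding mpoly_mult using that by (intro add.finprod_one_eqI *) auto
  have "(\<Oplus>x\<in>{x. x \<subseteq># a + b}. g x \<otimes> h (a + b - x)) = (\<Oplus>x\<in>{a}. g x \<otimes> h (a + b - x))"
    using assms * by (intro add.finprod_mono_neutral_cong_right) auto
  then show "(g \<otimes>\<^bsub>P\<^esub> h) (a + b) = g a \<otimes> h b"
    using assms by (simp add: mpoly_mult)
qed

end

locale mpoly_domain = domain R for R (structure) + fixes n :: nat

sublocale mpoly_domain \<subseteq> mpoly_over R n ..

context mpoly_domain
begin

lemma lead_at_mult:
  assumes "g \<in> carrier P" "h \<in> carrier P" "lead_at R g a" "lead_at R h b"
  shows "lead_at R (g \<otimes>\<^bsub>P\<^esub> h) (a + b)" "(g \<otimes>\<^bsub>P\<^esub> h) (a + b) = g a \<otimes> h b"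
  using mult_coeff_above[of g h a b] assms integral_iff by (auto simp: lead_at_def)

lemma lead_at_mono_poly:
  "c \<noteq> \<zero> \<Longrightarrow> lead_at R (mono_poly R c m) m"
  by (auto simp: lead_at_def mono_poly_def)

lemma lead_at_mono_mult:
  assumes "g \<in> carrier P" "lead_at R g a" "c \<in> carrier R" "c \<noteq> \<zero>" "m \<in> monomials n"
  shows "lead_at R (mono_poly R c m \<otimes>\<^bsub>P\<^esub> g) (m + a)" 
    and "(mono_poly R c m \<otimes>\<^bsub>P\<^esub> g) (m + a) = c \<otimes> g a"
  using lead_at_mult[OF mono_poly_closed[of c m n] assms(1) lead_at_mono_poly assms(2)] assms
  by (auto simp: mono_poly_def)

lemma lead_at_pow:
  assumes "g \<in> carrier P" "lead_at R g a"
  shows "lead_at R (g [^]\<^bsub>P\<^esub> (k::nat)) (repeat_mset k a)" "(g [^]\<^bsub>P\<^esub> k) (repeat_mset k a) = g a [^] k"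
proof -
  have "lead_at R (g [^]\<^bsub>P\<^esub> (k::nat)) (repeat_mset k a) \<and> (g [^]\<^bsub>P\<^esub> k) (repeat_mset k a) = g a [^] k"
  proof (induction k)
    case 0
    then show ?case by (auto simp: mpoly_one lead_at_def mono_poly_def)
  next
    case (Suc k)
    then show ?case
      using lead_at_mult[OF _ assms(1) _ assms(2), of "g [^]\<^bsub>P\<^esub> k" "repeat_mset k a"] assms(1)
      by (auto simp: add.commute)
  qed
  then show "lead_at R (g [^]\<^bsub>P\<^esub> (k::nat)) (repeat_mset k a)" "(g [^]\<^bsub>P\<^esub> k) (repeat_mset k a) = g a [^] k"
    by auto
qed

lemma lead_monos_upward:
  assumes "ideal I P" "m \<in> lead_monos R I" "a \<in> monomials n"
  shows "a + m \<in> lead_monos R I"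
proof -
  obtain g where g: "g \<in> I" "lead_at R g m" using assms(2) by (auto simp: lead_monos_def)
  have "mono_poly R \<one> a \<otimes>\<^bsub>P\<^esub> g \<in> I"
    using assms g by (intro ideal.I_l_closed) (auto simp: mono_poly_closed)
  then show ?thesis
    using lead_at_mono_mult[of g m \<one> a] g assms ideal_carrier by (auto simp: lead_monos_def)
qed

lemma lead_monos_monomials: "ideal I P \<Longrightarrow> m \<in> lead_monos R I \<Longrightarrow> m \<in> monomials n"
  using ideal_carrier lead_at_monomials by (auto simp: lead_monos_def)

lemma lead_monos_superset:
  assumes "ideal I P" "m \<in> lead_monos R I" "m \<subseteq># m'" "m' \<in> monomials n"
  shows "m' \<in> lead_monos R I"
proof -
  have "m' - m \<in> monomials n" using assms(4) diff_subset_eq_self monomials_subset by blast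
  then show ?thesis using lead_monos_upward[OF assms(1,2), of "m' - m"] assms(3) by simp
qed

text \<open>
  Subtracting multiples of elements of \<open>M\<close> removes one leading term after the other, and this
  terminates because the order is well-founded.  The leading coefficients that are needed as
  multipliers accumulate in \<open>U\<close>: over a field these are all nonzero scalars, over the integers
  they will be the divisors of powers of one fixed number.
\<close>

lemma reduction:
  assumes M': "coeff_submodule R n M'" and M: "coeff_submodule R n M" "M \<subseteq> M'"
    and U: "U \<subseteq> carrier R" "\<one> \<in> U" "\<And>u v. u \<in> U \<Longrightarrow> v \<in> U \<Longrightarrow> u \<otimes> v \<in> U"
    and lead: "\<And>m. m \<in> lead_monos R M' \<Longrightarrow> \<exists>g\<in>M. lead_at R g m \<and> g m \<in> U"
    and g: "g \<in> M'"
  shows "\<exists>u\<in>U. (\<lambda>m. u \<otimes> g m) \<in> M"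
proof (cases "g = (\<lambda>m. \<zero>)")
  case True
  then show ?thesis using U M by (intro bexI[of _ \<one>]) (auto simp: coeff_submodule_def)
next
  case False
  have carr: "h \<in> carrier P" if "h \<in> M'" for h using that M' by (auto simp: coeff_submodule_def)
  obtain a where "lead_at R g a" using False g carr lead_at_exists by metis
  moreover have "a \<in> monomials n" using calculation g carr lead_at_monomials by blast
  then have "\<forall>g\<in>M'. lead_at R g a \<longrightarrow> (\<exists>u\<in>U. (\<lambda>m. u \<otimes> g m) \<in> M)"
  proof (induction a rule: lex_induct)
    case (1 a)
    show ?case
    proof (intro ballI impI)
      fix g assume g: "g \<in> M'" "lead_at R g a"
      then obtain h where h: "h \<in> M" "lead_at R h a" "h a \<in> U" using lead[of a] by (auto simp: lead_monos_def)
      have gc: "g m \<in> carrier R" and hc: "h m \<in> carrier R" for m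
        using g h M carr by (auto intro: mpoly_coeff_closed)
      define g' where "g' = (\<lambda>m. h a \<otimes> g m \<oplus> (\<ominus> g a) \<otimes> h m)"
      have "g' \<in> M'" unfolding g'_def
        using g h M(2) gc hc by (intro submodule_comb[OF M']) auto
      have ga: "g' a = \<zero>" unfolding g'_def using gc[of a] hc[of a] by algebra
      have above: "g' m = \<zero>" if "a \<lless> m" for m
        using that g h gc hc by (auto simp: g'_def lead_at_def)
      have "\<exists>u\<in>U. (\<lambda>m. u \<otimes> g' m) \<in> M"
      proof (cases "g' = (\<lambda>m. \<zero>)")
        case True
        then show ?thesis using U M by (intro bexI[of _ \<one>]) (auto simp: coeff_submodule_def)
      next
        case False
        then obtain b where b: "lead_at R g' b" using \<open>g' \<in> M'\<close> carr lead_at_exists by metis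
        then have "b \<lless> a" using ga above lex_total unfolding lead_at_def by metis
        then show ?thesis using 1 b \<open>g' \<in> M'\<close> lead_at_monomials[OF carr b] by blast
      qed
      then obtain u where u: "u \<in> U" "(\<lambda>m. u \<otimes> g' m) \<in> M" by blast
      have uc: "u \<in> carrier R" using u U by blast
      have "(\<lambda>m. \<one> \<otimes> (u \<otimes> g' m) \<oplus> (u \<otimes> g a) \<otimes> h m) \<in> M"
        using u h gc uc by (intro submodule_comb[OF M(1)]) auto
      moreover have "\<one> \<otimes> (u \<otimes> g' m) \<oplus> (u \<otimes> g a) \<otimes> h m = (u \<otimes> h a) \<otimes> g m" for m
        using gc hc[of m] hc[of a] gc[of m] uc unfolding g'_def by algebra
      ultimately show "\<exists>u\<in>U. (\<lambda>m. u \<otimes> g m) \<in> M"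
        using U u h by (intro bexI[of _ "u \<otimes> h a"]) auto
    qed
  qed
  ultimately show ?thesis using g by blast
qed

end

locale mpoly_field = field R for R (structure) + fixes n :: nat

sublocale mpoly_field \<subseteq> mpoly_domain R n ..

lemma (in mpoly_field) submodule_eqI:
  assumes "coeff_submodule R n M'" "coeff_submodule R n M" "M \<subseteq> M'"
    "lead_monos R M' \<subseteq> lead_monos R M"
  shows "M = M'"
proof
  show "M' \<subseteq> M"
  proof
    fix g assume g: "g \<in> M'"
    have Mc: "h m \<in> carrier R" if "h \<in> M" for h m
      using assms(2) that by (auto simp: coeff_submodule_def intro: mpoly_coeff_closed)
    have "\<exists>u\<in>carrier R - {\<zero>}. (\<lambda>m. u \<otimes> g m) \<in> M"
    proof (rule reduction[OF assms(1-3) _ _ _ _ g])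
      fix m assume "m \<in> lead_monos R M'"
      then obtain h where "h \<in> M" "lead_at R h m" using assms(4) by (auto simp: lead_monos_def)
      then show "\<exists>g\<in>M. lead_at R g m \<and> g m \<in> carrier R - {\<zero>}"
        using Mc by (intro bexI[of _ h]) (auto simp: lead_at_def)
    qed (auto simp: integral_iff)
    then obtain u where u: "u \<in> carrier R - {\<zero>}" "(\<lambda>m. u \<otimes> g m) \<in> M" by blast
    then have v: "inv u \<in> carrier R" "inv u \<otimes> u = \<one>"
      using field_Units by auto
    have gc: "g m \<in> carrier R" for m using g assms(1) by (auto simp: coeff_submodule_def intro: mpoly_coeff_closed)
    have "(\<lambda>m. inv u \<otimes> (u \<otimes> g m) \<oplus> \<zero> \<otimes> (u \<otimes> g m)) \<in> M"
      using u(2) v(1) by (intro submodule_comb[OF assms(2)]) auto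
    moreover have "inv u \<otimes> (u \<otimes> g m) \<oplus> \<zero> \<otimes> (u \<otimes> g m) = g m" for m
      using gc[of m] u(1) v m_assoc[symmetric] by simp
    ultimately show "g \<in> M" by simp
  qed
qed (rule assms(3))

section \<open>Coefficientwise homomorphisms and evaluation\<close>

lemma (in ring_hom_cring) mpoly_map_hom:
  "(\<lambda>g m. h (g m)) \<in> ring_hom (mpoly_ring R n) (mpoly_ring S n)"
proof (rule ring_hom_memI)
  fix g assume g: "g \<in> carrier (mpoly_ring R n)"
  have "{m. h (g m) \<noteq> \<zero>\<^bsub>S\<^esub>} \<subseteq> {m. g m \<noteq> \<zero>}" by auto
  then show "(\<lambda>m. h (g m)) \<in> carrier (mpoly_ring S n)"
    using g unfolding R.mpoly_carrier S.mpoly_carrier by (auto intro: finite_subset)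
next
  fix g k assume "g \<in> carrier (mpoly_ring R n)" "k \<in> carrier (mpoly_ring R n)"
  then show "(\<lambda>m. h ((g \<otimes>\<^bsub>mpoly_ring R n\<^esub> k) m)) =
      (\<lambda>m. h (g m)) \<otimes>\<^bsub>mpoly_ring S n\<^esub> (\<lambda>m. h (k m))"
    unfolding R.mpoly_mult S.mpoly_mult
    by (subst hom_finsum) (auto simp: o_def intro!: ext S.finsum_cong')
qed (auto simp: R.mpoly_add S.mpoly_add R.mpoly_one S.mpoly_one mono_poly_def)

lemma (in ring_hom_cring) hom_pow:
  "g \<in> carrier R \<Longrightarrow> h (g [^] (k::nat)) = h g [^]\<^bsub>S\<^esub> k"
  by (induction k) auto

definition mono_eval :: "('b, 'c) ring_scheme \<Rightarrow> nat \<Rightarrow> (nat \<Rightarrow> 'b) \<Rightarrow> nat multiset \<Rightarrow> 'b" where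
  "mono_eval L n x m = (\<Otimes>\<^bsub>L\<^esub>i\<in>{1..n}. x i [^]\<^bsub>L\<^esub> count m i)"

definition mpoly_eval ::
    "('a, 'd) ring_scheme \<Rightarrow> ('b, 'c) ring_scheme \<Rightarrow> ('a \<Rightarrow> 'b) \<Rightarrow> nat \<Rightarrow> (nat \<Rightarrow> 'b)
      \<Rightarrow> (nat multiset \<Rightarrow> 'a) \<Rightarrow> 'b" where
  "mpoly_eval K L h n x g = (\<Oplus>\<^bsub>L\<^esub>m\<in>{m. g m \<noteq> \<zero>\<^bsub>K\<^esub>}. h (g m) \<otimes>\<^bsub>L\<^esub> mono_eval L n x m)"

lemma (in cring) mono_poly_mono_mult:
  assumes "c \<in> carrier R" "d \<in> carrier R" "b \<in> monomials n"
  shows "mono_poly R c a \<otimes>\<^bsub>mpoly_ring R n\<^esub> mono_poly R d b = mono_poly R (c \<otimes> d) (a + b)"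
proof -
  have "m - a = b \<longleftrightarrow> m = a + b" if "a \<subseteq># m" for m using that by auto
  then show ?thesis
    using mono_poly_mult[OF assms(1) mono_poly_closed[OF assms(2,3)], of a] assms
    by (auto simp: mono_poly_def fun_eq_iff)
qed

locale mpoly_evaluation = ring_hom_cring R S h for R (structure) and S (structure) and h +
  fixes n :: nat and x :: "nat \<Rightarrow> 'c"
  assumes point: "\<And>i. i \<in> {1..n} \<Longrightarrow> x i \<in> carrier S"
begin

abbreviation P where "P \<equiv> mpoly_ring R n"
abbreviation me where "me m \<equiv> mono_eval S n x m"
abbreviation ev where "ev g \<equiv> mpoly_eval R S h n x g"

lemma me_closed [simp]: "me m \<in> carrier S"
  unfolding mono_eval_def using point by (intro S.finprod_closed) auto

lemma me_add: "me (a + b) = me a \<otimes>\<^bsub>S\<^esub> me b"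
proof -
  have "me (a + b) = (\<Otimes>\<^bsub>S\<^esub>i\<in>{1..n}. x i [^]\<^bsub>S\<^esub> count a i \<otimes>\<^bsub>S\<^esub> x i [^]\<^bsub>S\<^esub> count b i)"
    unfolding mono_eval_def using point by (intro S.finprod_cong') (auto simp: S.nat_pow_mult)
  also have "\<dots> = me a \<otimes>\<^bsub>S\<^esub> me b"
    unfolding mono_eval_def using point by (intro S.finprod_multf) auto
  finally show ?thesis .
qed

lemma me_empty [simp]: "me {#} = \<one>\<^bsub>S\<^esub>"
  unfolding mono_eval_def by (simp add: S.finprod_one_eqI)

lemma ev_superset:
  assumes "g \<in> carrier P" "finite F" "{m. g m \<noteq> \<zero>} \<subseteq> F"
  shows "ev g = (\<Oplus>\<^bsub>S\<^esub>m\<in>F. h (g m) \<otimes>\<^bsub>S\<^esub> me m)"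
  unfolding mpoly_eval_def using assms
  by (intro S.add.finprod_mono_neutral_cong_left) auto

lemma ev_closed [simp]: "g \<in> carrier P \<Longrightarrow> ev g \<in> carrier S"
  unfolding mpoly_eval_def by (intro S.finsum_closed) auto

lemma ev_add:
  assumes "g \<in> carrier P" "k \<in> carrier P"
  shows "ev (\<lambda>m. g m \<oplus> k m) = ev g \<oplus>\<^bsub>S\<^esub> ev k"
proof -
  let ?F = "{m. g m \<noteq> \<zero>} \<union> {m. k m \<noteq> \<zero>}"
  have F: "finite ?F" using assms by (auto simp: R.mpoly_carrier)
  have "ev (\<lambda>m. g m \<oplus> k m) = (\<Oplus>\<^bsub>S\<^esub>m\<in>?F. h (g m \<oplus> k m) \<otimes>\<^bsub>S\<^esub> me m)"
    using assms F by (intro ev_superset R.mpoly_add_closed) auto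
  also have "\<dots> = (\<Oplus>\<^bsub>S\<^esub>m\<in>?F. h (g m) \<otimes>\<^bsub>S\<^esub> me m \<oplus>\<^bsub>S\<^esub> h (k m) \<otimes>\<^bsub>S\<^esub> me m)"
    using assms by (intro S.finsum_cong') (auto simp: S.l_distr)
  also have "\<dots> = (\<Oplus>\<^bsub>S\<^esub>m\<in>?F. h (g m) \<otimes>\<^bsub>S\<^esub> me m) \<oplus>\<^bsub>S\<^esub> (\<Oplus>\<^bsub>S\<^esub>m\<in>?F. h (k m) \<otimes>\<^bsub>S\<^esub> me m)"
    using assms by (intro S.finsum_addf) auto
  also have "\<dots> = ev g \<oplus>\<^bsub>S\<^esub> ev k"
    using assms F by (simp add: ev_superset[of _ ?F])
  finally show ?thesis .
qed

lemma ev_zero [simp]: "ev (\<lambda>m. \<zero>) = \<zero>\<^bsub>S\<^esub>"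
  by (simp add: mpoly_eval_def)

lemma ev_mono:
  assumes "c \<in> carrier R" "m \<in> monomials n"
  shows "ev (mono_poly R c m) = h c \<otimes>\<^bsub>S\<^esub> me m"
proof -
  have "ev (mono_poly R c m) = (\<Oplus>\<^bsub>S\<^esub>m'\<in>{m}. h (mono_poly R c m m') \<otimes>\<^bsub>S\<^esub> me m')"
    using assms by (intro ev_superset R.mono_poly_closed) (auto simp: mono_poly_def)
  then show ?thesis using assms(1) by (simp add: mono_poly_def)
qed

lemma ev_mono_mult:
  assumes "c \<in> carrier R" "m \<in> monomials n" "g \<in> carrier P"
  shows "ev (mono_poly R c m \<otimes>\<^bsub>P\<^esub> g) = h c \<otimes>\<^bsub>S\<^esub> me m \<otimes>\<^bsub>S\<^esub> ev g"
proof -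
  let ?F = "{m. g m \<noteq> \<zero>}"
  have F: "finite ?F" using assms by (auto simp: R.mpoly_carrier)
  have inj: "inj_on ((+) m) ?F" by (auto simp: inj_on_def)
  have mg: "mono_poly R c m \<otimes>\<^bsub>P\<^esub> g = (\<lambda>m'. if m \<subseteq># m' then c \<otimes> g (m' - m) else \<zero>)"
    using assms by (intro R.mono_poly_mult)
  have "{m'. (mono_poly R c m \<otimes>\<^bsub>P\<^esub> g) m' \<noteq> \<zero>} \<subseteq> (+) m ` ?F"
  proof
    fix m' assume "m' \<in> {m'. (mono_poly R c m \<otimes>\<^bsub>P\<^esub> g) m' \<noteq> \<zero>}"
    then have "m \<subseteq># m'" "g (m' - m) \<noteq> \<zero>"
      using assms by (auto simp: mg split: if_splits)
    then show "m' \<in> (+) m ` ?F"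
      by (intro image_eqI[of _ _ "m' - m"]) auto
  qed
  then have "ev (mono_poly R c m \<otimes>\<^bsub>P\<^esub> g) =
      (\<Oplus>\<^bsub>S\<^esub>m'\<in>(+) m ` ?F. h ((mono_poly R c m \<otimes>\<^bsub>P\<^esub> g) m') \<otimes>\<^bsub>S\<^esub> me m')"
    using assms F by (intro ev_superset R.mpoly_mult_closed R.mono_poly_closed) auto
  also have "\<dots> = (\<Oplus>\<^bsub>S\<^esub>m'\<in>?F. h ((mono_poly R c m \<otimes>\<^bsub>P\<^esub> g) (m + m')) \<otimes>\<^bsub>S\<^esub> me (m + m'))"
    using assms by (intro S.finsum_reindex inj)
      (auto intro!: S.m_closed hom_closed R.mpoly_coeff_closed[of _ n] R.mpoly_mult_closed R.mono_poly_closed)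
  also have "\<dots> = (\<Oplus>\<^bsub>S\<^esub>m'\<in>?F. h c \<otimes>\<^bsub>S\<^esub> me m \<otimes>\<^bsub>S\<^esub> (h (g m') \<otimes>\<^bsub>S\<^esub> me m'))"
  proof (intro S.finsum_cong')
    fix m'
    have "h c \<in> carrier S" "h (g m') \<in> carrier S" "me m \<in> carrier S" "me m' \<in> carrier S"
      using assms by auto
    then have "h c \<otimes>\<^bsub>S\<^esub> h (g m') \<otimes>\<^bsub>S\<^esub> (me m \<otimes>\<^bsub>S\<^esub> me m') = h c \<otimes>\<^bsub>S\<^esub> me m \<otimes>\<^bsub>S\<^esub> (h (g m') \<otimes>\<^bsub>S\<^esub> me m')"
      by (simp add: S.m_ac)
    then show "h ((mono_poly R c m \<otimes>\<^bsub>P\<^esub> g) (m + m')) \<otimes>\<^bsub>S\<^esub> me (m + m') =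
        h c \<otimes>\<^bsub>S\<^esub> me m \<otimes>\<^bsub>S\<^esub> (h (g m') \<otimes>\<^bsub>S\<^esub> me m')"
      using assms by (simp add: mg me_add)
  qed (use assms in auto)
  also have "\<dots> = h c \<otimes>\<^bsub>S\<^esub> me m \<otimes>\<^bsub>S\<^esub> ev g"
    unfolding mpoly_eval_def using assms F by (intro S.finsum_rdistr[symmetric]) auto
  finally show ?thesis .
qed

lemma ev_mult:
  assumes "g \<in> carrier P" "k \<in> carrier P"
  shows "ev (g \<otimes>\<^bsub>P\<^esub> k) = ev g \<otimes>\<^bsub>S\<^esub> ev k"
  using assms(1)
proof (induction rule: R.mpoly_induct)
  case zero
  have "(\<lambda>m. \<zero>) \<otimes>\<^bsub>P\<^esub> k = (\<lambda>m. \<zero>)"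
    using assms by (auto simp: R.mpoly_mult intro!: R.add.finprod_one_eqI)
  then show ?case using assms by simp
next
  case (add c m g)
  then show ?case
    using assms
    by (simp add: R.mpoly_l_distr R.mono_poly_closed R.mpoly_mult_closed ev_add ev_mono_mult ev_mono S.l_distr)
qed

lemma ev_hom: "mpoly_eval R S h n x \<in> ring_hom P S"
  by (rule ring_hom_memI)
    (auto simp: ev_mult R.mpoly_add ev_add R.mpoly_one ev_mono)

end


section \<open>Initial ideals and reducedness\<close>

text \<open>
  For the leading monomials of an ideal, this says that its initial ideal is generated by
  squarefree monomials.
\<close>

definition squarefree_monos :: "nat multiset set \<Rightarrow> bool" where
  "squarefree_monos A \<longleftrightarrow> (\<forall>m\<in>A. mset_set (set_mset m) \<in> A)"

lemma init_form_lead: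
  assumes "lead_at R g m"
  shows "init_form R lex_weighting g = mono_poly R (g m) m"
proof
  fix m'
  have "(\<exists>b. g b \<noteq> \<zero>\<^bsub>R\<^esub> \<and> m' \<lless> b) \<or> m' = m" if "g m' \<noteq> \<zero>\<^bsub>R\<^esub>"
    using assms that lex_total[of m' m] by (auto simp: lead_at_def)
  moreover have "\<not> (\<exists>b. g b \<noteq> \<zero>\<^bsub>R\<^esub> \<and> m \<lless> b)"
    using assms by (auto simp: lead_at_def)
  ultimately show "init_form R lex_weighting g m' = mono_poly R (g m) m m'"
    unfolding init_form_def mono_poly_def mpoly_support_def lex_less_def by auto
qed

context mpoly_field
begin

text \<open>
  The lexicographic order is total, so every initial form is a single term; the span of initial
  forms is the span of the leading monomials.
\<close>

lemma init_ideal_eq: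
  assumes I: "ideal I P"
  shows "init_ideal R n lex_weighting I = {h \<in> carrier P. \<forall>m. h m \<noteq> \<zero> \<longrightarrow> m \<in> lead_monos R I}"
    (is "_ = ?J")
proof
  let ?i = "init_form R lex_weighting" and ?K = "indexed_const ` carrier R"
  have const: "indexed_const c = mono_poly R c {#}" for c
    by (auto simp: indexed_const_def mono_poly_def)
  have cases_init: "g = (\<lambda>m. \<zero>) \<and> ?i g = (\<lambda>m. \<zero>) \<or> (\<exists>m. lead_at R g m \<and> m \<in> monomials n \<and> ?i g = mono_poly R (g m) m)"
    if g: "g \<in> carrier P" for g
  proof (cases "g = (\<lambda>m. \<zero>)")
    case True
    then show ?thesis by (simp add: init_form_def)
  next
    case False
    then obtain m where "lead_at R g m" using lead_at_exists[OF g] by blast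
    then show ?thesis using init_form_lead lead_at_monomials[OF g] by blast
  qed
  show "init_ideal R n lex_weighting I \<subseteq> ?J"
  proof
    fix h assume "h \<in> init_ideal R n lex_weighting I"
    then obtain gs where gs: "set gs \<subseteq> I" "h \<in> P.Span ?K (map ?i gs)"
      by (auto simp: init_ideal_def)
    then show "h \<in> ?J"
    proof (induction gs arbitrary: h)
      case Nil
      then show ?case by (simp add: mpoly_zero mpoly_zero_closed)
    next
      case (Cons g gs)
      then obtain c h' where c: "c \<in> carrier R" and h': "h' \<in> P.Span ?K (map ?i gs)"
        and h: "h = indexed_const c \<otimes>\<^bsub>P\<^esub> ?i g \<oplus>\<^bsub>P\<^esub> h'"
        by (auto simp: P.line_extension_mem_iff)
      have h'J: "h' \<in> ?J" using Cons h' by simp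
      have g: "g \<in> carrier P" "g \<in> I" using Cons.prems ideal_carrier[OF I] by auto
      from cases_init[OF g(1)] show ?case
      proof (elim disjE exE conjE)
        assume "g = (\<lambda>m. \<zero>)" "?i g = (\<lambda>m. \<zero>)"
        then have "h = h'"
          using c h'J unfolding h const by (auto simp: scalar_mult mpoly_zero_closed mpoly_add)
        then show ?thesis using h'J by simp
      next
        fix m assume m: "lead_at R g m" "m \<in> monomials n" "?i g = mono_poly R (g m) m"
        have gm: "mono_poly R (g m) m \<in> carrier P" using m g by (auto intro: mono_poly_closed)
        then have "h = (\<lambda>m'. c \<otimes> mono_poly R (g m) m m' \<oplus> h' m')"
          using c unfolding h const m by (simp add: scalar_mult mpoly_add)
        moreover have "(\<lambda>m'. c \<otimes> mono_poly R (g m) m m' \<oplus> h' m') \<in> carrier P"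
          using c gm h'J by (intro mpoly_add_closed scalar_closed) auto
        moreover have "m \<in> lead_monos R I" using m(1) g by (auto simp: lead_monos_def)
        ultimately show ?thesis
          using h'J c by (auto simp: mono_poly_def)
      qed
    qed
  qed
  show "?J \<subseteq> init_ideal R n lex_weighting I"
  proof
    fix h assume "h \<in> ?J"
    then have h: "h \<in> carrier P" "\<And>m. h m \<noteq> \<zero> \<Longrightarrow> m \<in> lead_monos R I" by auto
    from h have "\<exists>gs. set gs \<subseteq> I \<and> h \<in> P.Span ?K (map ?i gs)"
    proof (induction rule: mpoly_induct)
      case zero
      then show ?case by (intro exI[of _ "[]"]) (simp add: mpoly_zero)
    next
      case (add c m g)
      have "g m' \<noteq> \<zero> \<Longrightarrow> m' \<in> lead_monos R I" for m'
        using add.prems[of m'] add.hyps by (cases "m' = m") (auto simp: mono_poly_def)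
      then obtain gs where gs: "set gs \<subseteq> I" "g \<in> P.Span ?K (map ?i gs)" using add.IH by blast
      have "m \<in> lead_monos R I" using add.prems[of m] add.hyps by (simp add: mono_poly_def)
      then obtain f where f: "f \<in> I" "lead_at R f m" by (auto simp: lead_monos_def)
      have fm: "f m \<in> carrier R" "f m \<noteq> \<zero>" "f \<in> carrier P"
        using f mpoly_coeff_closed[OF ideal_carrier[OF I f(1)]] ideal_carrier[OF I]
        by (auto simp: lead_at_def)
      then have inv: "inv (f m) \<in> carrier R" "inv (f m) \<otimes> f m = \<one>" using field_Units by auto
      let ?k = "c \<otimes> inv (f m)"
      have "indexed_const ?k \<otimes>\<^bsub>P\<^esub> ?i f \<oplus>\<^bsub>P\<^esub> g = (\<lambda>m'. mono_poly R c m m' \<oplus> g m')"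
        using add.hyps inv fm scalar_mult[of ?k "mono_poly R (f m) m"] mono_poly_closed[of "f m" m n]
        unfolding const init_form_lead[OF f(2)] by (auto simp: mpoly_add mono_poly_def m_assoc)
      moreover have "indexed_const ?k \<in> ?K" using inv add.hyps by blast
      ultimately have "(\<lambda>m'. mono_poly R c m m' \<oplus> g m') \<in> P.Span ?K (map ?i (f # gs))"
        using gs(2) by (auto simp: P.line_extension_mem_iff intro!: bexI)
      then show ?case using gs(1) f(1) by (intro exI[of _ "f # gs"]) auto
    qed
    then show "h \<in> init_ideal R n lex_weighting I"
      by (auto simp: init_ideal_def)
  qed
qed

lemma monomial_ideal:
  assumes A: "\<And>a m. m \<in> A \<Longrightarrow> a \<in> monomials n \<Longrightarrow> a + m \<in> A"
  shows "ideal {h \<in> carrier P. \<forall>m. h m \<noteq> \<zero> \<longrightarrow> m \<in> A} P" (is "ideal ?J P")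
proof -
  have mult: "k \<otimes>\<^bsub>P\<^esub> g \<in> ?J" if g: "g \<in> ?J" "k \<in> carrier P" for g k
    using g(2)
  proof (induction rule: mpoly_induct)
    case zero
    have "(\<lambda>m. \<zero>) \<otimes>\<^bsub>P\<^esub> g = (\<lambda>m. \<zero>)"
      using P.l_null[of g] g(1) by (simp add: mpoly_zero)
    then show ?case by (simp add: mpoly_zero_closed)
  next
    case (add c m k)
    have 1: "(mono_poly R c m \<otimes>\<^bsub>P\<^esub> g) m' = \<zero>" if "m' \<notin> A" for m'
    proof (cases "m \<subseteq># m'")
      case True
      then have "g (m' - m) = \<zero>" using A[of "m' - m" m] add.hyps g(1) that by auto
      then show ?thesis using add.hyps g(1) by (simp add: mono_poly_mult)
    qed (use add.hyps g(1) in \<open>simp add: mono_poly_mult\<close>)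
    have 2: "(k \<otimes>\<^bsub>P\<^esub> g) m' = \<zero>" if "m' \<notin> A" for m' using that add.IH by blast
    have "(\<lambda>m'. mono_poly R c m m' \<oplus> k m') \<in> carrier P"
      using add.hyps by (intro mpoly_add_closed mono_poly_closed) auto
    then have "(\<lambda>m'. mono_poly R c m m' \<oplus> k m') \<otimes>\<^bsub>P\<^esub> g \<in> carrier P" using g by auto
    moreover have "((\<lambda>m'. mono_poly R c m m' \<oplus> k m') \<otimes>\<^bsub>P\<^esub> g) m' = \<zero>" if "m' \<notin> A" for m'
      using add.hyps g 1 2 that by (simp add: mpoly_l_distr mono_poly_closed)
    ultimately show ?case by auto
  qed
  show ?thesis
  proof (rule idealI[OF P.ring_axioms])
    show "subgroup ?J (add_monoid P)"
    proof (rule P.add.subgroupI)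
      show "?J \<noteq> {}" using mpoly_zero_closed by auto
      fix g k assume g: "g \<in> ?J" and k: "k \<in> ?J"
      have "\<ominus>\<^bsub>P\<^esub> \<one>\<^bsub>P\<^esub> \<otimes>\<^bsub>P\<^esub> g \<in> ?J" using g by (intro mult) auto
      then show "\<ominus>\<^bsub>P\<^esub> g \<in> ?J" using g by (simp add: P.l_minus)
      show "g \<oplus>\<^bsub>P\<^esub> k \<in> ?J"
        using g k by (auto simp: mpoly_add mpoly_add_closed) (metis r_zero zero_closed)
    qed auto
  qed (use mult P.m_comm in auto)
qed

lemma stanley_reisner_init:
  assumes I: "ideal I P" and sq: "squarefree_monos (lead_monos R I)"
  shows "stanley_reisner R n (init_ideal R n lex_weighting I)"
proof -
  let ?A = "lead_monos R I"
  let ?J = "{h \<in> carrier P. \<forall>m. h m \<noteq> \<zero> \<longrightarrow> m \<in> ?A}"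
  let ?\<S> = "{s. s \<subseteq> {1..n} \<and> mset_set s \<in> ?A}"
  let ?G = "(\<lambda>s. mono_poly R \<one> (mset_set s)) ` ?\<S>"
  have J: "ideal ?J P" using monomial_ideal lead_monos_upward[OF I] by blast
  have mon: "mset_set s \<in> monomials n" if "s \<subseteq> {1..n}" for s
    using that finite_subset[OF that] by (simp add: monomials_def)
  have Gc: "?G \<subseteq> carrier P" using mon by (auto intro: mono_poly_closed)
  have G: "ideal (Idl\<^bsub>P\<^esub> ?G) P" by (rule P.genideal_ideal[OF Gc])
  have "h \<in> Idl\<^bsub>P\<^esub> ?G" if "h \<in> carrier P" "\<And>m. h m \<noteq> \<zero> \<Longrightarrow> m \<in> ?A" for h
    using that
  proof (induction rule: mpoly_induct)
    case zero
    then show ?case using ideal_zero[OF G] by simp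
  next
    case (add c m g)
    have "g m' \<noteq> \<zero> \<Longrightarrow> m' \<in> ?A" for m'
      using add.prems[of m'] add.hyps by (cases "m' = m") (auto simp: mono_poly_def)
    then have g: "g \<in> Idl\<^bsub>P\<^esub> ?G" using add.IH by blast
    have "m \<in> ?A" using add.prems[of m] add.hyps by (simp add: mono_poly_def)
    define s where "s = set_mset m"
    have s: "s \<subseteq> {1..n}" "mset_set s \<in> ?A"
      using \<open>m \<in> ?A\<close> sq add.hyps by (auto simp: s_def squarefree_monos_def monomials_def)
    have sub: "mset_set s \<subseteq># m" by (simp add: s_def mset_set_set_mset_msubset)
    have "mono_poly R \<one> (mset_set s) \<in> Idl\<^bsub>P\<^esub> ?G"
      using P.genideal_self[OF Gc] s by blast
    then have "mono_poly R c (m - mset_set s) \<otimes>\<^bsub>P\<^esub> mono_poly R \<one> (mset_set s) \<in> Idl\<^bsub>P\<^esub> ?G"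
      using add.hyps monomials_subset[OF diff_subset_eq_self]
      by (intro ideal.I_l_closed[OF G] mono_poly_closed) auto
    moreover have "mono_poly R c (m - mset_set s) \<otimes>\<^bsub>P\<^esub> mono_poly R \<one> (mset_set s) = mono_poly R c m"
      using add.hyps mon[OF s(1)] sub by (simp add: mono_poly_mono_mult)
    ultimately show ?case using g by (intro ideal_add[OF G]) auto
  qed
  moreover have "Idl\<^bsub>P\<^esub> ?G \<subseteq> ?J"
    using Gc by (intro P.genideal_minimal[OF J]) (auto simp: mono_poly_def split: if_splits)
  ultimately have "?J = Idl\<^bsub>P\<^esub> ?G" by auto
  then show ?thesis
    unfolding stanley_reisner_def init_ideal_eq[OF I] by (intro exI[of _ ?\<S>]) auto
qed

text \<open>
  The squarefree part of the leading monomial of \<open>g\<^sup>k\<close> divides the leading monomial of \<open>g\<close>, which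
  is therefore the leading monomial of some \<open>f \<in> I\<close>.  Subtracting a multiple of \<open>f\<close> from \<open>g\<close> does
  not change the class of \<open>g\<close> modulo \<open>I\<close> and lowers the leading monomial.
\<close>

lemma squarefree_imp_radical:
  assumes I: "ideal I P" and sq: "squarefree_monos (lead_monos R I)"
    and g: "g \<in> carrier P" "g [^]\<^bsub>P\<^esub> (k::nat) \<in> I"
  shows "g \<in> I"
proof (cases "g = (\<lambda>m. \<zero>) \<or> I = carrier P")
  case True
  then show ?thesis using ideal_zero[OF I] g by auto
next
  case False
  interpret I: ideal I P by (rule I)
  have Q: "ring_hom_cring P (P Quot I) ((+>\<^bsub>P\<^esub>) I)"
    by (rule I.rcos_ring_hom_cring[OF P.is_cring])
  have zero: "\<zero>\<^bsub>P Quot I\<^esub> = I" by (simp add: FactRing_def)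
  obtain a where "lead_at R g a" using False g lead_at_exists by metis
  moreover from this have "a \<in> monomials n" using g lead_at_monomials by blast
  then have "\<forall>g. g \<in> carrier P \<longrightarrow> lead_at R g a \<longrightarrow> g [^]\<^bsub>P\<^esub> k \<in> I \<longrightarrow> g \<in> I"
  proof (induction a rule: lex_induct)
    case (1 a)
    show ?case
    proof (intro allI impI)
      fix g assume g: "g \<in> carrier P" "lead_at R g a" "g [^]\<^bsub>P\<^esub> k \<in> I"
      have "k > 0" using g(3) False I.one_imp_carrier by (cases k) auto
      have "repeat_mset k a \<in> lead_monos R I"
        using lead_at_pow(1)[OF g(1,2)] g(3) by (auto simp: lead_monos_def)
      then have "mset_set (set_mset (repeat_mset k a)) \<in> lead_monos R I"
        using sq by (auto simp: squarefree_monos_def)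
      moreover have "set_mset (repeat_mset k a) = set_mset a"
        using \<open>k > 0\<close> by (auto simp flip: count_greater_zero_iff)
      ultimately have "a \<in> lead_monos R I"
        using lead_monos_superset[OF I _ mset_set_set_mset_msubset 1(1)] by simp
      then obtain f where f: "f \<in> I" "lead_at R f a" by (auto simp: lead_monos_def)
      have fc: "f \<in> carrier P" using f ideal_carrier[OF I] by blast
      have fa: "f a \<in> carrier R" "f a \<noteq> \<zero>" "g a \<in> carrier R"
        using f(2) mpoly_coeff_closed[OF fc] mpoly_coeff_closed[OF g(1)] by (auto simp: lead_at_def)
      then have inv: "inv (f a) \<in> carrier R" "inv (f a) \<otimes> f a = \<one>" using field_Units by auto
      \<comment> \<open>Adding \<open>c f \<in> I\<close> to \<open>g\<close> cancels the leading term of \<open>g\<close>.\<close>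
      define c where "c = \<ominus> (g a \<otimes> inv (f a))"
      have c: "c \<in> carrier R" "c \<otimes> f a = \<ominus> g a"
        using inv fa by (auto simp: c_def l_minus m_assoc)
      define i where "i = (\<lambda>m. c \<otimes> f m)"
      have i: "i \<in> I" unfolding i_def using c f by (intro ideal_scalar[OF I])
      define g' where "g' = g \<oplus>\<^bsub>P\<^esub> i"
      have ic: "i \<in> carrier P" using i ideal_carrier[OF I] by blast
      have g'c: "g' \<in> carrier P" using ic g by (simp add: g'_def)
      have coset: "I +>\<^bsub>P\<^esub> g' = I +>\<^bsub>P\<^esub> g"
        using I.a_rcos_sum[OF g(1) ic] P.a_rcos_zero[OF I i] I.a_rcos_sum[OF g(1) P.zero_closed]
          P.a_rcos_zero[OF I I.zero_closed] g(1)
        by (simp add: g'_def)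
      have "I +>\<^bsub>P\<^esub> (g' [^]\<^bsub>P\<^esub> k) = I"
        using ring_hom_cring.hom_pow[OF Q g'c, of k] ring_hom_cring.hom_pow[OF Q g(1), of k] P.a_rcos_zero[OF I g(3)] coset by metis
      then have g'k: "g' [^]\<^bsub>P\<^esub> k \<in> I"
        using I.rcos_const_imp_mem g'c by simp
      have "g' a = \<zero>" using c fa by (simp add: g'_def i_def mpoly_add r_neg)
      moreover have "g' m = \<zero>" if "a \<lless> m" for m
        using that g f c by (auto simp: g'_def i_def mpoly_add lead_at_def)
      ultimately have less: "b \<lless> a" if "lead_at R g' b" for b
        using that lex_total[of a b] unfolding lead_at_def by blast
      have "g' \<in> I"
      proof (cases "g' = (\<lambda>m. \<zero>)")
        case True
        then show ?thesis using ideal_zero[OF I] by simp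
      next
        case False
        then obtain b where b: "lead_at R g' b" using lead_at_exists[OF g'c] by blast
        then show ?thesis using 1(2)[of b] less lead_at_monomials[OF g'c] g'c g'k by blast
      qed
      then have "I +>\<^bsub>P\<^esub> g = I" using coset P.a_rcos_zero[OF I] by simp
      then show "g \<in> I" using I.rcos_const_imp_mem g(1) by simp
    qed
  qed
  ultimately show ?thesis using g by blast
qed

lemma squarefree_imp_reduced:
  assumes I: "ideal I P" and sq: "squarefree_monos (lead_monos R I)"
  shows "reduced_ring (P Quot I)"
  unfolding reduced_ring_def
proof (intro ballI allI impI)
  interpret I: ideal I P by (rule I)
  have Q: "ring_hom_cring P (P Quot I) ((+>\<^bsub>P\<^esub>) I)"
    by (rule I.rcos_ring_hom_cring[OF P.is_cring])
  have zero: "\<zero>\<^bsub>P Quot I\<^esub> = I" by (simp add: FactRing_def)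
  fix q and k :: nat
  assume "q \<in> carrier (P Quot I)" and 0: "q [^]\<^bsub>P Quot I\<^esub> k = \<zero>\<^bsub>P Quot I\<^esub>"
  then have "q \<in> (\<Union>a\<in>carrier P. {I +>\<^bsub>P\<^esub> a})"
    unfolding FactRing_def by (simp add: A_RCOSETS_def')
  then obtain g where g: "g \<in> carrier P" "q = I +>\<^bsub>P\<^esub> g"
    by blast
  have "I +>\<^bsub>P\<^esub> (g [^]\<^bsub>P\<^esub> k) = q [^]\<^bsub>P Quot I\<^esub> k"
    unfolding g(2) by (rule ring_hom_cring.hom_pow[OF Q g(1)])
  also have "\<dots> = I" unfolding 0 zero ..
  finally have "g [^]\<^bsub>P\<^esub> k \<in> I" using I.rcos_const_imp_mem g(1) by simp
  then have "g \<in> I" using squarefree_imp_radical[OF I sq g(1)] by blast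
  then show "q = \<zero>\<^bsub>P Quot I\<^esub>" unfolding zero g(2) by (rule P.a_rcos_zero[OF I])
qed

end

section \<open>Coefficients of leading squarefree blocks\<close>

lemma lex_split:
  assumes "set_mset \<mu> \<subseteq> {..<i}" "set_mset \<mu>' \<subseteq> {..<i}" "set_mset \<nu> \<subseteq> {i..}" "set_mset \<nu>' \<subseteq> {i..}"
  shows "\<mu> + \<nu> \<lless> \<mu>' + \<nu>' \<longleftrightarrow> \<mu> \<lless> \<mu>' \<or> (\<mu> = \<mu>' \<and> \<nu> \<lless> \<nu>')"
proof -
  have lo: "count \<nu> k = 0" "count \<nu>' k = 0" if "k < i" for k
    using assms that by (auto simp: count_eq_zero_iff)
  have hi: "count \<mu> k = 0" "count \<mu>' k = 0" if "k \<ge> i" for k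
    using assms that by (auto simp: count_eq_zero_iff)
  have 1: "\<mu> + \<nu> \<lless> \<mu>' + \<nu>'" if less: "\<mu> \<lless> \<mu>'"
    and lo: "\<And>k. k < i \<Longrightarrow> count \<nu> k = 0 \<and> count \<nu>' k = 0"
    and hi: "\<And>k. k \<ge> i \<Longrightarrow> count \<mu> k = 0 \<and> count \<mu>' k = 0" for \<nu> \<nu>' \<mu> \<mu>'
  proof -
    obtain k where k: "count \<mu> k < count \<mu>' k" "\<forall>j<k. count \<mu> j = count \<mu>' j"
      using less by (auto simp: lex_less_iff)
    have "k < i" using k(1) hi[of k] by (cases "k < i") auto
    then show ?thesis unfolding lex_less_iff using k lo by (intro exI[of _ k]) auto
  qed
  show ?thesis
  proof
    assume *: "\<mu> + \<nu> \<lless> \<mu>' + \<nu>'"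
    have "\<not> \<mu>' \<lless> \<mu>"
    proof
      assume "\<mu>' \<lless> \<mu>"
      then have "\<mu>' + \<nu>' \<lless> \<mu> + \<nu>" by (rule 1) (use lo hi in auto)
      then show False using lex_asym[OF *] by blast
    qed
    moreover have "\<nu> \<lless> \<nu>'" if "\<mu> = \<mu>'" using * that by simp
    ultimately show "\<mu> \<lless> \<mu>' \<or> (\<mu> = \<mu>' \<and> \<nu> \<lless> \<nu>')" using lex_total by blast
  next
    assume "\<mu> \<lless> \<mu>' \<or> (\<mu> = \<mu>' \<and> \<nu> \<lless> \<nu>')"
    then show "\<mu> + \<nu> \<lless> \<mu>' + \<nu>'"
    proof
      assume "\<mu> \<lless> \<mu>'"
      then show ?thesis by (rule 1) (use lo hi in auto)
    qed simp
  qed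
qed

lemma monomial_split:
  obtains \<mu> \<nu> :: "nat multiset" where "m = \<mu> + \<nu>" "set_mset \<mu> \<subseteq> {..<i}" "set_mset \<nu> \<subseteq> {i..}"
proof
  show "m = filter_mset (\<lambda>k. k < i) m + filter_mset (\<lambda>k. \<not> k < i) m"
    by (simp add: multiset_partition)
qed auto

lemma lex_less_add: "b \<noteq> {#} \<Longrightarrow> a \<lless> a + b" for a b :: "nat multiset"
proof -
  assume "b \<noteq> {#}"
  then have "{#} \<lless> b \<or> b \<lless> {#}" using lex_total by metis
  then have "{#} \<lless> b" by (auto simp: lex_less_iff)
  then show ?thesis using lex_add_left[of a "{#}" b] by simp
qed

definition vars_from :: "('a, 'b) ring_scheme \<Rightarrow> nat \<Rightarrow> (nat multiset \<Rightarrow> 'a) \<Rightarrow> bool" where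
  "vars_from R i u \<longleftrightarrow> (\<forall>m. u m \<noteq> \<zero>\<^bsub>R\<^esub> \<longrightarrow> set_mset m \<subseteq> {i..})"

text \<open>
  View \<open>g\<close> as a polynomial in \<open>x\<^sub>1, \<dots>, x\<^sub>i\<^sub>-\<^sub>1\<close> with coefficients in the remaining variables: no
  monomial beyond \<open>x\<^sub>A\<close>, the product of the variables with index in \<open>A\<close>, occurs, and the
  coefficient of \<open>x\<^sub>A\<close> is \<open>u\<close>.
\<close>

definition leading_block ::
    "('a, 'b) ring_scheme \<Rightarrow> nat \<Rightarrow> nat set \<Rightarrow> (nat multiset \<Rightarrow> 'a) \<Rightarrow> (nat multiset \<Rightarrow> 'a) \<Rightarrow> bool" where
  "leading_block R i A g u \<longleftrightarrow>
    (\<forall>\<nu>. set_mset \<nu> \<subseteq> {i..} \<longrightarrow> g (mset_set A + \<nu>) = u \<nu>) \<and>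
    (\<forall>\<mu> \<nu>. set_mset \<mu> \<subseteq> {..<i} \<longrightarrow> set_mset \<nu> \<subseteq> {i..} \<longrightarrow> mset_set A \<lless> \<mu> \<longrightarrow> g (\<mu> + \<nu>) = \<zero>\<^bsub>R\<^esub>)"

text \<open>
  These modules interpolate between \<open>I\<close> itself, for \<open>i = 1\<close> and \<open>A\<close> empty, and the answer to the
  question whether \<open>x\<^sub>A\<close> is a leading monomial of \<open>I\<close>: for \<open>i = n + 1\<close> they consist of constants,
  and are nonzero iff it is.
\<close>

definition block_coeffs ::
    "('a, 'b) ring_scheme \<Rightarrow> nat \<Rightarrow> (nat multiset \<Rightarrow> 'a) set \<Rightarrow> nat \<Rightarrow> nat set \<Rightarrow> (nat multiset \<Rightarrow> 'a) set" where
  "block_coeffs R n I i A =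
    {u \<in> carrier (mpoly_ring R n). vars_from R i u \<and> (\<exists>g\<in>I. leading_block R i A g u)}"

lemma block_coeffs_mono: "I \<subseteq> J \<Longrightarrow> block_coeffs R n I i A \<subseteq> block_coeffs R n J i A"
  by (auto simp: block_coeffs_def)

lemma vars_from_outside: "vars_from R i u \<Longrightarrow> k \<in># m \<Longrightarrow> k < i \<Longrightarrow> u m = \<zero>\<^bsub>R\<^esub>"
  unfolding vars_from_def by (metis atLeast_iff not_le subsetD)

lemma vars_from_mono: "vars_from R i u \<Longrightarrow> j \<le> i \<Longrightarrow> vars_from R j u"
  unfolding vars_from_def by (meson atLeast_subset_iff order_trans)

context mpoly_field
begin

lemma block_coeffs_submodule:
  assumes "ideal I P"
  shows "coeff_submodule R n (block_coeffs R n I i A)"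
proof -
  have "(\<lambda>m. c \<otimes> u m \<oplus> d \<otimes> v m) \<in> block_coeffs R n I i A"
    if uv: "u \<in> block_coeffs R n I i A" "v \<in> block_coeffs R n I i A" and cd: "c \<in> carrier R" "d \<in> carrier R"
    for c d u v
  proof -
    obtain g k where g: "g \<in> I" "leading_block R i A g u" and k: "k \<in> I" "leading_block R i A k v"
      using uv by (auto simp: block_coeffs_def)
    have "(\<lambda>m. c \<otimes> g m \<oplus> d \<otimes> k m) \<in> I"
      using submodule_comb[OF ideal_submodule[OF assms] g(1) k(1) cd] .
    moreover have "leading_block R i A (\<lambda>m. c \<otimes> g m \<oplus> d \<otimes> k m) (\<lambda>m. c \<otimes> u m \<oplus> d \<otimes> v m)"
      using g(2) k(2) cd by (simp add: leading_block_def)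
    moreover have "(\<lambda>m. c \<otimes> u m \<oplus> d \<otimes> v m) \<in> carrier P"
      using uv cd by (intro mpoly_add_closed scalar_closed) (auto simp: block_coeffs_def)
    moreover have "vars_from R i (\<lambda>m. c \<otimes> u m \<oplus> d \<otimes> v m)"
      unfolding vars_from_def
    proof (intro allI impI, rule ccontr)
      fix m assume 0: "c \<otimes> u m \<oplus> d \<otimes> v m \<noteq> \<zero>" and m: "\<not> set_mset m \<subseteq> {i..}"
      have "u m = \<zero>" "v m = \<zero>" using uv m by (auto simp: block_coeffs_def vars_from_def)
      then show False using 0 cd by simp
    qed
    ultimately show ?thesis by (auto simp: block_coeffs_def)
  qed
  moreover have "(\<lambda>m. \<zero>) \<in> block_coeffs R n I i A"
    using ideal_zero[OF assms]
    by (auto simp: block_coeffs_def mpoly_zero_closed vars_from_def leading_block_def intro!: bexI[of _ "\<lambda>m. \<zero>"])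
  ultimately show ?thesis
    unfolding coeff_submodule_def by (auto simp: block_coeffs_def)
qed

lemma block_coeffs_carrier: "u \<in> block_coeffs R n I i A \<Longrightarrow> u \<in> carrier P"
  by (simp add: block_coeffs_def)

text \<open>
  A polynomial in \<open>x\<^sub>i, x\<^sub>i\<^sub>+\<^sub>1, \<dots>\<close> can be multiplied into the coefficients without touching the
  monomials in the first variables.
\<close>

lemma block_coeffs_mono_mult:
  assumes I: "ideal I P" and u: "u \<in> block_coeffs R n I i A" and A: "A \<subseteq> {..<i}"
    and c: "c \<in> carrier R" and a: "a \<in> monomials n" "set_mset a \<subseteq> {i..}"
  shows "mono_poly R c a \<otimes>\<^bsub>P\<^esub> u \<in> block_coeffs R n I i A"
proof -
  obtain g where g: "g \<in> I" "leading_block R i A g u" using u by (auto simp: block_coeffs_def)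
  have uc: "u \<in> carrier P" and gc: "g \<in> carrier P"
    using u g ideal_carrier[OF I] by (auto simp: block_coeffs_def)
  have mc: "mono_poly R c a \<in> carrier P" using a c by (intro mono_poly_closed)
  have sub: "a \<subseteq># \<mu> + \<nu> \<longleftrightarrow> a \<subseteq># \<nu>" and diff: "\<mu> + \<nu> - a = \<mu> + (\<nu> - a)"
    if "set_mset \<mu> \<subseteq> {..<i}" for \<mu> \<nu>
  proof -
    have c0: "count a k = 0 \<or> count \<mu> k = 0" for k
      using a(2) that by (cases "k < i") (auto simp: count_eq_zero_iff)
    show "a \<subseteq># \<mu> + \<nu> \<longleftrightarrow> a \<subseteq># \<nu>"
    proof
      assume *: "a \<subseteq># \<mu> + \<nu>"
      show "a \<subseteq># \<nu>" unfolding subseteq_mset_def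
      proof
        fix k show "count a k \<le> count \<nu> k"
          using mset_subset_eq_count[OF *, of k] c0[of k] by auto
      qed
    qed (metis mset_subset_eq_add_right subset_mset.order_trans)
    show "\<mu> + \<nu> - a = \<mu> + (\<nu> - a)"
    proof (rule multiset_eqI)
      fix k show "count (\<mu> + \<nu> - a) k = count (\<mu> + (\<nu> - a)) k" using c0[of k] by auto
    qed
  qed
  have Am: "set_mset (mset_set A) \<subseteq> {..<i}" using A finite_subset[OF A] by simp
  have dv: "set_mset (\<nu> - a) \<subseteq> {i..}" if "set_mset \<nu> \<subseteq> {i..}" for \<nu>
    using that by (meson in_diffD subset_iff)
  have "leading_block R i A (mono_poly R c a \<otimes>\<^bsub>P\<^esub> g) (mono_poly R c a \<otimes>\<^bsub>P\<^esub> u)"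
    unfolding leading_block_def mono_poly_mult[OF c gc] mono_poly_mult[OF c uc]
  proof (intro conjI allI impI)
    fix \<nu> assume \<nu>: "set_mset \<nu> \<subseteq> {i..}"
    have "g (mset_set A + (\<nu> - a)) = u (\<nu> - a)"
      using g(2) dv[OF \<nu>] unfolding leading_block_def by blast
    then show "(if a \<subseteq># mset_set A + \<nu> then c \<otimes> g (mset_set A + \<nu> - a) else \<zero>) =
        (if a \<subseteq># \<nu> then c \<otimes> u (\<nu> - a) else \<zero>)"
      by (simp only: sub[OF Am] diff[OF Am])
  next
    fix \<mu> \<nu> assume \<mu>: "set_mset \<mu> \<subseteq> {..<i}" "mset_set A \<lless> \<mu>" and \<nu>: "set_mset \<nu> \<subseteq> {i..}"
    have "g (\<mu> + (\<nu> - a)) = \<zero>"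
      using g(2) \<mu> dv[OF \<nu>] unfolding leading_block_def by blast
    then show "(if a \<subseteq># \<mu> + \<nu> then c \<otimes> g (\<mu> + \<nu> - a) else \<zero>) = \<zero>"
      by (simp only: sub[OF \<mu>(1)] diff[OF \<mu>(1)] r_null[OF c] if_cancel)
  qed
  moreover have "mono_poly R c a \<otimes>\<^bsub>P\<^esub> g \<in> I" using I g mc by (intro ideal.I_l_closed)
  moreover have "vars_from R i (mono_poly R c a \<otimes>\<^bsub>P\<^esub> u)"
    unfolding vars_from_def
  proof (intro allI impI)
    fix m assume "(mono_poly R c a \<otimes>\<^bsub>P\<^esub> u) m \<noteq> \<zero>"
    then have "a \<subseteq># m" "u (m - a) \<noteq> \<zero>"
      using c uc by (auto simp: mono_poly_mult split: if_splits)
    then have "m = a + (m - a)" "set_mset (m - a) \<subseteq> {i..}"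
      using u by (auto simp: block_coeffs_def vars_from_def)
    then show "set_mset m \<subseteq> {i..}" using a(2) by (metis Un_least set_mset_union)
  qed
  ultimately show ?thesis using mc uc by (auto simp: block_coeffs_def)
qed

lemma submodule_add:
  assumes "coeff_submodule R n M" "g \<in> M" "h \<in> M"
  shows "(\<lambda>m. g m \<oplus> h m) \<in> M"
proof -
  have "g m \<in> carrier R" "h m \<in> carrier R" for m
    using assms by (auto simp: coeff_submodule_def intro: mpoly_coeff_closed)
  then show ?thesis using submodule_comb[OF assms one_closed one_closed] by simp
qed

lemma block_coeffs_mult:
  assumes I: "ideal I P" and u: "u \<in> block_coeffs R n I i A" and A: "A \<subseteq> {..<i}"
    and w: "w \<in> carrier P" "vars_from R i w"
  shows "w \<otimes>\<^bsub>P\<^esub> u \<in> block_coeffs R n I i A"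
  using w
proof (induction rule: mpoly_induct)
  case zero
  have "(\<lambda>m. \<zero>) \<otimes>\<^bsub>P\<^esub> u = (\<lambda>m. \<zero>)"
    using P.l_null[of u] u by (simp add: mpoly_zero block_coeffs_def)
  then show ?case
    using block_coeffs_submodule[OF I] by (simp add: coeff_submodule_def)
next
  case (add c m g)
  have "vars_from R i g"
    unfolding vars_from_def
  proof (intro allI impI)
    fix m' assume "g m' \<noteq> \<zero>"
    then have "mono_poly R c m m' \<oplus> g m' \<noteq> \<zero>" using add.hyps by (auto simp: mono_poly_def)
    then show "set_mset m' \<subseteq> {i..}" using add.prems unfolding vars_from_def by blast
  qed
  then have "g \<otimes>\<^bsub>P\<^esub> u \<in> block_coeffs R n I i A" using add.IH by blast
  moreover have "set_mset m \<subseteq> {i..}"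
    using add.prems add.hyps by (auto simp: vars_from_def mono_poly_def split: if_splits)
  then have "mono_poly R c m \<otimes>\<^bsub>P\<^esub> u \<in> block_coeffs R n I i A"
    using add.hyps by (intro block_coeffs_mono_mult[OF I u A])
  ultimately have "(\<lambda>m'. (mono_poly R c m \<otimes>\<^bsub>P\<^esub> u) m' \<oplus> (g \<otimes>\<^bsub>P\<^esub> u) m') \<in> block_coeffs R n I i A"
    by (intro submodule_add[OF block_coeffs_submodule[OF I]])
  then show ?case
    using add.hyps block_coeffs_carrier[OF u] by (simp add: mpoly_l_distr mono_poly_closed)
qed

text \<open>
  To compare monomials lexicographically one compares their parts in \<open>x\<^sub>1, \<dots>, x\<^sub>i\<^sub>-\<^sub>1\<close> first.  Leading
  monomials of coefficients are thus read off from those of \<open>I\<close>; \<open>lead_monos_block\<close> is the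
  converse.
\<close>

lemma lead_block_coeffs:
  assumes A: "A \<subseteq> {..<i}" and u: "u \<in> block_coeffs R n I i A" "lead_at R u \<nu>"
  shows "mset_set A + \<nu> \<in> lead_monos R I"
proof -
  obtain g where g: "g \<in> I" "leading_block R i A g u" and v: "vars_from R i u"
    using u by (auto simp: block_coeffs_def)
  have Am: "set_mset (mset_set A) \<subseteq> {..<i}" using A finite_subset[OF A] by simp
  have \<nu>: "set_mset \<nu> \<subseteq> {i..}" using v u(2) by (auto simp: vars_from_def lead_at_def)
  have "lead_at R g (mset_set A + \<nu>)"
    unfolding lead_at_def
  proof (intro conjI allI impI)
    show "g (mset_set A + \<nu>) \<noteq> \<zero>" using g(2) \<nu> u(2) by (simp add: leading_block_def lead_at_def)
    fix m' assume less: "mset_set A + \<nu> \<lless> m'"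
    obtain \<mu>' \<nu>' where m': "m' = \<mu>' + \<nu>'" "set_mset \<mu>' \<subseteq> {..<i}" "set_mset \<nu>' \<subseteq> {i..}"
      by (rule monomial_split)
    then have "mset_set A \<lless> \<mu>' \<or> (mset_set A = \<mu>' \<and> \<nu> \<lless> \<nu>')"
      using less lex_split[OF Am m'(2) \<nu> m'(3)] by simp
    then show "g m' = \<zero>" using g(2) m' u(2) by (auto simp: leading_block_def lead_at_def)
  qed
  then show ?thesis using g(1) by (auto simp: lead_monos_def)
qed

lemma extract_block_closed:
  assumes gc: "g \<in> carrier P"
  shows "(\<lambda>m. if set_mset m \<subseteq> {i..} then g (mset_set A + m) else \<zero>) \<in> carrier P"
proof -
  define u where "u = (\<lambda>m. if set_mset m \<subseteq> {i..} then g (mset_set A + m) else \<zero>)"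
  have "{m. u m \<noteq> \<zero>} \<subseteq> (\<lambda>m. m - mset_set A) ` {m. g m \<noteq> \<zero>}"
  proof
    fix m assume "m \<in> {m. u m \<noteq> \<zero>}"
    then have "g (mset_set A + m) \<noteq> \<zero>" by (auto simp: u_def split: if_splits)
    then show "m \<in> (\<lambda>m. m - mset_set A) ` {m. g m \<noteq> \<zero>}"
      by (intro image_eqI[of _ _ "mset_set A + m"]) auto
  qed
  then have "finite {m. u m \<noteq> \<zero>}" using gc by (auto simp: mpoly_carrier intro: finite_subset)
  then have "u \<in> carrier P"
    using gc mpoly_coeff_outside[OF gc] unfolding mpoly_carrier u_def by auto
  then show ?thesis unfolding u_def .
qed

lemma vars_from_mult:
  assumes "a \<in> carrier P" "b \<in> carrier P" and v: "vars_from R i a" "vars_from R i b"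
  shows "vars_from R i (a \<otimes>\<^bsub>P\<^esub> b)"
  unfolding vars_from_def
proof (intro allI impI, rule ccontr)
  fix m assume nz: "(a \<otimes>\<^bsub>P\<^esub> b) m \<noteq> \<zero>" and m: "\<not> set_mset m \<subseteq> {i..}"
  have "a x \<otimes> b (m - x) = \<zero>" if "x \<in> {x. x \<subseteq># m}" for x
  proof -
    have "m = x + (m - x)" using that by simp
    then have "\<not> set_mset x \<subseteq> {i..} \<or> \<not> set_mset (m - x) \<subseteq> {i..}"
      using m by (metis Un_least set_mset_union)
    then have "a x = \<zero> \<or> b (m - x) = \<zero>" using v unfolding vars_from_def by blast
    then show ?thesis using assms by auto
  qed
  then have "(a \<otimes>\<^bsub>P\<^esub> b) m = \<zero>" unfolding mpoly_mult by (rule add.finprod_one_eqI)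
  then show False using nz by contradiction
qed

lemma lead_monos_block:
  assumes I: "ideal I P" and A: "A \<subseteq> {..<i}" and \<nu>: "set_mset \<nu> \<subseteq> {i..}"
    and lead: "mset_set A + \<nu> \<in> lead_monos R I"
  shows "\<nu> \<in> lead_monos R (block_coeffs R n I i A)"
proof -
  obtain g where g: "g \<in> I" "lead_at R g (mset_set A + \<nu>)" using lead by (auto simp: lead_monos_def)
  have gc: "g \<in> carrier P" using g ideal_carrier[OF I] by blast
  have Am: "set_mset (mset_set A) \<subseteq> {..<i}" using A finite_subset[OF A] by simp
  define u where "u = (\<lambda>m. if set_mset m \<subseteq> {i..} then g (mset_set A + m) else \<zero>)"
  have "u \<in> carrier P" unfolding u_def by (rule extract_block_closed[OF gc])
  moreover have "vars_from R i u" by (auto simp: vars_from_def u_def)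
  moreover have "leading_block R i A g u"
    unfolding leading_block_def
  proof (intro conjI allI impI)
    fix \<mu> \<nu>' assume \<mu>: "set_mset \<mu> \<subseteq> {..<i}" "mset_set A \<lless> \<mu>" and \<nu>': "set_mset \<nu>' \<subseteq> {i..}"
    have "mset_set A + \<nu> \<lless> \<mu> + \<nu>'" using \<mu> lex_split[OF Am \<mu>(1) \<nu> \<nu>'] by blast
    then show "g (\<mu> + \<nu>') = \<zero>" using g(2) by (simp add: lead_at_def)
  qed (simp add: u_def)
  ultimately have "u \<in> block_coeffs R n I i A" using g(1) by (auto simp: block_coeffs_def)
  moreover have "lead_at R u \<nu>"
    using g(2) \<nu> by (auto simp: lead_at_def u_def)
  ultimately show ?thesis by (auto simp: lead_monos_def)
qed

text \<open>
  If \<open>m\<close> is the leading monomial of \<open>g \<in> I\<close> and of \<open>h \<in> J\<close>, then \<open>g h\<close> lies in \<open>I \<inter> J\<close> and has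
  leading monomial \<open>m\<^sup>2\<close>; squarefreeness returns from \<open>m\<^sup>2\<close> to \<open>m\<close>.
\<close>

lemma lead_monos_inter:
  assumes I: "ideal I P" and J: "ideal J P" and sq: "squarefree_monos (lead_monos R (I \<inter> J))"
  shows "lead_monos R (I \<inter> J) = lead_monos R I \<inter> lead_monos R J"
proof
  have IJ: "ideal (I \<inter> J) P" using P.i_intersect[OF I J] .
  show "lead_monos R I \<inter> lead_monos R J \<subseteq> lead_monos R (I \<inter> J)"
  proof
    fix m assume m: "m \<in> lead_monos R I \<inter> lead_monos R J"
    then obtain g h where g: "g \<in> I" "lead_at R g m" and h: "h \<in> J" "lead_at R h m"
      by (auto simp: lead_monos_def)
    have gc: "g \<in> carrier P" and hc: "h \<in> carrier P"
      using g h ideal_carrier[OF I] ideal_carrier[OF J] by auto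
    have "g \<otimes>\<^bsub>P\<^esub> h \<in> I \<inter> J"
      using ideal.I_r_closed[OF I g(1) hc] ideal.I_l_closed[OF J h(1) gc] by simp
    then have "m + m \<in> lead_monos R (I \<inter> J)"
      using lead_at_mult(1)[OF gc hc g(2) h(2)] by (auto simp: lead_monos_def)
    then have "mset_set (set_mset (m + m)) \<in> lead_monos R (I \<inter> J)"
      using sq unfolding squarefree_monos_def by blast
    then have "mset_set (set_mset m) \<in> lead_monos R (I \<inter> J)" by simp
    then show "m \<in> lead_monos R (I \<inter> J)"
      using lead_monos_superset[OF IJ _ mset_set_set_mset_msubset lead_at_monomials[OF gc g(2)]] by blast
  qed
qed (use lead_monos_mono[of "I \<inter> J"] in blast)

text \<open>
  The smaller of two nested modules with the same leading monomials is the larger one; the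
  leading monomials agree by \<open>lead_monos_inter\<close>.
\<close>

lemma block_coeffs_inter:
  assumes I: "ideal I P" and J: "ideal J P" and sq: "squarefree_monos (lead_monos R (I \<inter> J))"
    and A: "A \<subseteq> {..<i}"
  shows "block_coeffs R n (I \<inter> J) i A = block_coeffs R n I i A \<inter> block_coeffs R n J i A"
proof (rule submodule_eqI)
  have IJ: "ideal (I \<inter> J) P" using P.i_intersect[OF I J] .
  show "coeff_submodule R n (block_coeffs R n (I \<inter> J) i A)" by (rule block_coeffs_submodule[OF IJ])
  show "coeff_submodule R n (block_coeffs R n I i A \<inter> block_coeffs R n J i A)"
    using block_coeffs_submodule[OF I, of i A] block_coeffs_submodule[OF J, of i A]
    by (auto simp: coeff_submodule_def)
  show "block_coeffs R n (I \<inter> J) i A \<subseteq> block_coeffs R n I i A \<inter> block_coeffs R n J i A"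
    using block_coeffs_mono[of "I \<inter> J"] by blast
  show "lead_monos R (block_coeffs R n I i A \<inter> block_coeffs R n J i A)
      \<subseteq> lead_monos R (block_coeffs R n (I \<inter> J) i A)"
  proof
    fix \<nu> assume "\<nu> \<in> lead_monos R (block_coeffs R n I i A \<inter> block_coeffs R n J i A)"
    then obtain u where u: "u \<in> block_coeffs R n I i A" "u \<in> block_coeffs R n J i A" "lead_at R u \<nu>"
      by (auto simp: lead_monos_def)
    then have \<nu>: "set_mset \<nu> \<subseteq> {i..}" by (auto simp: block_coeffs_def vars_from_def lead_at_def)
    have "mset_set A + \<nu> \<in> lead_monos R (I \<inter> J)"
      using lead_block_coeffs[OF A u(1,3)] lead_block_coeffs[OF A u(2,3)] lead_monos_inter[OF I J sq] by simp
    then show "\<nu> \<in> lead_monos R (block_coeffs R n (I \<inter> J) i A)"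
      using lead_monos_block[OF IJ A \<nu>] by simp
  qed
qed

lemma split_next:
  assumes "set_mset \<nu> \<subseteq> {i..}"
  obtains e \<nu>' where "\<nu> = replicate_mset e i + \<nu>'" "set_mset \<nu>' \<subseteq> {Suc i..}" "e = count \<nu> i"
proof
  show "\<nu> = replicate_mset (count \<nu> i) i + filter_mset (\<lambda>k. k \<noteq> i) \<nu>"
    by (auto simp: multiset_eq_iff)
  show "set_mset (filter_mset (\<lambda>k. k \<noteq> i) \<nu>) \<subseteq> {Suc i..}"
    using assms by force
qed simp

text \<open>
  Keeping the block \<open>A\<close> while passing to the next variable selects the elements that do not
  involve \<open>x\<^sub>i\<close>: a positive power of \<open>x\<^sub>i\<close> next to \<open>x\<^sub>A\<close> would be a larger block.  The converse
  inclusion is \<open>block_coeffs_Suc_iff\<close>.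
\<close>

lemma block_coeffs_Suc_subset:
  assumes A: "A \<subseteq> {..<i}"
  shows "block_coeffs R n I (Suc i) A \<subseteq> block_coeffs R n I i A"
proof
  fix u assume u: "u \<in> block_coeffs R n I (Suc i) A"
  then obtain g where g: "g \<in> I" "leading_block R (Suc i) A g u" and v: "vars_from R (Suc i) u"
    by (auto simp: block_coeffs_def)
  have Am: "set_mset (mset_set A) \<subseteq> {..<i}" using A finite_subset[OF A] by simp
  have "leading_block R i A g u"
    unfolding leading_block_def
  proof (intro conjI allI impI)
    fix \<nu> assume "set_mset \<nu> \<subseteq> {i..}"
    then obtain e \<nu>' where \<nu>: "\<nu> = replicate_mset e i + \<nu>'" "set_mset \<nu>' \<subseteq> {Suc i..}"
      using split_next by metis
    show "g (mset_set A + \<nu>) = u \<nu>"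
    proof (cases "e = 0")
      case True
      then show ?thesis using \<nu> g(2) by (simp add: leading_block_def)
    next
      case False
      have s: "set_mset (mset_set A + replicate_mset e i) \<subseteq> {..<Suc i}" using Am by (auto simp: less_Suc_eq)
      have "mset_set A \<lless> mset_set A + replicate_mset e i"
        using False by (intro lex_less_add) (simp add: multiset_eq_iff exI[of _ i])
      then have "g ((mset_set A + replicate_mset e i) + \<nu>') = \<zero>"
        using g(2) s \<nu>(2) unfolding leading_block_def by blast
      moreover have "u \<nu> = \<zero>" using vars_from_outside[OF v, of i \<nu>] False \<nu>(1) by simp
      ultimately show ?thesis using \<nu>(1) by (simp add: add.assoc)
    qed
  next
    fix \<mu> \<nu> assume \<mu>: "set_mset \<mu> \<subseteq> {..<i}" "mset_set A \<lless> \<mu>" and "set_mset \<nu> \<subseteq> {i..}"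
    then obtain e \<nu>' where \<nu>: "\<nu> = replicate_mset e i + \<nu>'" "set_mset \<nu>' \<subseteq> {Suc i..}"
      using split_next by metis
    have s: "set_mset (\<mu> + replicate_mset e i) \<subseteq> {..<Suc i}" using \<mu>(1) by (auto simp: less_Suc_eq)
    have "mset_set A + {#} \<lless> \<mu> + replicate_mset e i"
      using \<mu> Am by (subst lex_split[of _ i]) auto
    then have "g ((\<mu> + replicate_mset e i) + \<nu>') = \<zero>"
      using g(2) s \<nu>(2) unfolding leading_block_def by simp
    then show "g (\<mu> + \<nu>) = \<zero>" using \<nu>(1) by (simp add: add.assoc)
  qed
  then show "u \<in> block_coeffs R n I i A"
    using u g(1) vars_from_mono[OF v, of i] by (auto simp: block_coeffs_def)
qed

lemma split_last:
  assumes "set_mset \<mu> \<subseteq> {..<Suc i}"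
  obtains e \<mu>' where "\<mu> = \<mu>' + replicate_mset e i" "set_mset \<mu>' \<subseteq> {..<i}"
proof
  show "\<mu> = filter_mset (\<lambda>k. k \<noteq> i) \<mu> + replicate_mset (count \<mu> i) i"
    by (auto simp: multiset_eq_iff)
  show "set_mset (filter_mset (\<lambda>k. k \<noteq> i) \<mu>) \<subseteq> {..<i}"
    using assms by force
qed

lemma block_coeffs_Suc_iff:
  assumes A: "A \<subseteq> {..<i}" and u: "u \<in> block_coeffs R n I i A" and v: "vars_from R (Suc i) u"
  shows "u \<in> block_coeffs R n I (Suc i) A"
proof -
  obtain g where g: "g \<in> I" "leading_block R i A g u" using u by (auto simp: block_coeffs_def)
  have Am: "set_mset (mset_set A) \<subseteq> {..<i}" using A finite_subset[OF A] by simp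
  have "leading_block R (Suc i) A g u"
    unfolding leading_block_def
  proof (intro conjI allI impI)
    fix \<nu> assume "set_mset \<nu> \<subseteq> {Suc i..}"
    then have "set_mset \<nu> \<subseteq> {i..}" by (rule order_trans) auto
    then show "g (mset_set A + \<nu>) = u \<nu>"
      using g(2) unfolding leading_block_def by blast
  next
    fix \<mu> \<nu> assume \<mu>: "set_mset \<mu> \<subseteq> {..<Suc i}" "mset_set A \<lless> \<mu>" and \<nu>: "set_mset \<nu> \<subseteq> {Suc i..}"
    obtain e \<mu>' where \<mu>': "\<mu> = \<mu>' + replicate_mset e i" "set_mset \<mu>' \<subseteq> {..<i}"
      using split_last[OF \<mu>(1)] .
    have s: "set_mset (replicate_mset e i + \<nu>) \<subseteq> {i..}"
      using \<nu> by (auto dest: Suc_leD)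
    have "mset_set A + {#} \<lless> \<mu>' + replicate_mset e i" using \<mu>(2) \<mu>'(1) by simp
    then have "mset_set A \<lless> \<mu>' \<or> (mset_set A = \<mu>' \<and> {#} \<lless> replicate_mset e i)"
      by (subst (asm) lex_split[of _ i]) (use Am \<mu>' in auto)
    then have "g (\<mu>' + (replicate_mset e i + \<nu>)) = \<zero>"
    proof
      assume "mset_set A \<lless> \<mu>'"
      then show ?thesis using g(2) \<mu>'(2) s unfolding leading_block_def by blast
    next
      assume *: "mset_set A = \<mu>' \<and> {#} \<lless> replicate_mset e i"
      then have "g (\<mu>' + (replicate_mset e i + \<nu>)) = u (replicate_mset e i + \<nu>)"
        using g(2) s unfolding leading_block_def by blast
      moreover have "e \<noteq> 0" using * by (cases e) auto
      then have "u (replicate_mset e i + \<nu>) = \<zero>" by (intro vars_from_outside[OF v, of i]) auto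
      ultimately show ?thesis by simp
    qed
    then show "g (\<mu> + \<nu>) = \<zero>" using \<mu>'(1) by (simp add: add.assoc)
  qed
  then show ?thesis using u v g(1) by (auto simp: block_coeffs_def)
qed

text \<open>
  The slope \<open>v\<close> is completed to an element of the current module that is linear in \<open>x\<^sub>i\<close>.  On its
  zeros with \<open>v \<noteq> 0\<close>, the coordinate \<open>x\<^sub>i\<close> is \<open>- v\<^sub>0 / v\<close>.
\<close>

definition companion :: "(nat multiset \<Rightarrow> 'a) set \<Rightarrow> nat \<Rightarrow> nat set \<Rightarrow> (nat multiset \<Rightarrow> 'a) \<Rightarrow> (nat multiset \<Rightarrow> 'a) \<Rightarrow> bool" where
  "companion I i A v v\<^sub>0 \<longleftrightarrow> v \<in> block_coeffs R n I (Suc i) (insert i A) \<and>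
    v\<^sub>0 \<in> carrier P \<and> vars_from R (Suc i) v\<^sub>0 \<and>
    mono_poly R \<one> {#i#} \<otimes>\<^bsub>P\<^esub> v \<oplus>\<^bsub>P\<^esub> v\<^sub>0 \<in> block_coeffs R n I i A"

lemma companion_mono: "I \<subseteq> J \<Longrightarrow> companion I i A v v\<^sub>0 \<Longrightarrow> companion J i A v v\<^sub>0"
  unfolding companion_def using block_coeffs_mono[of I J] by blast

text \<open>
  When \<open>x\<^sub>A x\<^sub>i\<close> is the leading block of \<open>g\<close>, the larger blocks \<open>x\<^sub>A x\<^sub>i\<^sup>2, x\<^sub>A x\<^sub>i\<^sup>3, \<dots>\<close> do not occur, so the
  coefficient of \<open>x\<^sub>A\<close> is linear in \<open>x\<^sub>i\<close>.
\<close>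

lemma companion_exists:
  assumes I: "ideal I P" and i: "i \<in> {1..n}" and A: "A \<subseteq> {..<i}" and v: "v \<in> block_coeffs R n I (Suc i) (insert i A)"
  obtains v\<^sub>0 where "companion I i A v v\<^sub>0"
proof -
  obtain g where g: "g \<in> I" "leading_block R (Suc i) (insert i A) g v" and vc: "v \<in> carrier P"
    and vv: "vars_from R (Suc i) v"
    using v by (auto simp: block_coeffs_def)
  have gc: "g \<in> carrier P" using g ideal_carrier[OF I] by blast
  have Am: "set_mset (mset_set A) \<subseteq> {..<i}" using A finite_subset[OF A] by simp
  have iA: "mset_set (insert i A) = mset_set A + {#i#}"
    using A finite_subset[OF A] by (subst mset_set.insert) auto
  define v\<^sub>0 where "v\<^sub>0 = (\<lambda>m. if set_mset m \<subseteq> {Suc i..} then g (mset_set A + m) else \<zero>)"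
  have v0c: "v\<^sub>0 \<in> carrier P" unfolding v\<^sub>0_def by (rule extract_block_closed[OF gc])
  have v0v: "vars_from R (Suc i) v\<^sub>0" by (auto simp: vars_from_def v\<^sub>0_def)
  let ?w = "mono_poly R \<one> {#i#} \<otimes>\<^bsub>P\<^esub> v \<oplus>\<^bsub>P\<^esub> v\<^sub>0"
  have xc: "mono_poly R \<one> {#i#} \<in> carrier P" using i by (intro mono_poly_closed) (auto simp: monomials_def)
  have w: "?w m = (if i \<in># m then v (m - {#i#}) else \<zero>) \<oplus> v\<^sub>0 m" for m
    using vc by (simp add: mpoly_add mono_poly_mult mpoly_coeff_closed[OF vc])
  have vars_w: "vars_from R i ?w"
    unfolding vars_from_def
  proof (intro allI impI, rule ccontr)
    fix m assume nz: "?w m \<noteq> \<zero>" and m: "\<not> set_mset m \<subseteq> {i..}"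
    then obtain k where "k \<in># m" "k \<notin> {i..}" by blast
    then have k: "k \<in># m" "k < i" by auto
    have "v\<^sub>0 m = \<zero>" using vars_from_outside[OF v0v k(1)] k(2) by simp
    moreover have "v (m - {#i#}) = \<zero>"
      using k by (intro vars_from_outside[OF vv, of k]) (auto simp: in_diff_count)
    ultimately show False using nz w by (simp split: if_splits)
  qed
  have "leading_block R i A g ?w"
    unfolding leading_block_def
  proof (intro conjI allI impI)
    fix \<nu> assume "set_mset \<nu> \<subseteq> {i..}"
    then obtain e \<nu>' where \<nu>: "\<nu> = replicate_mset e i + \<nu>'" "set_mset \<nu>' \<subseteq> {Suc i..}"
      using split_next by metis
    have ni: "i \<notin># \<nu>'" using \<nu>(2) by force
    consider "e = 0" | "e = 1" | "e \<ge> 2" by linarith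
    then show "g (mset_set A + \<nu>) = ?w \<nu>"
    proof cases
      case 1
      then show ?thesis unfolding w using \<nu> ni by (simp add: v\<^sub>0_def mpoly_coeff_closed[OF gc])
    next
      case 2
      then have "g (mset_set (insert i A) + \<nu>') = v \<nu>'"
        using g(2) \<nu>(2) unfolding leading_block_def by blast
      then have "g (mset_set A + \<nu>) = v \<nu>'" using 2 \<nu>(1) iA by simp
      moreover have "v\<^sub>0 \<nu> = \<zero>" using 2 \<nu>(1) by (intro vars_from_outside[OF v0v, of i]) auto
      ultimately show ?thesis using 2 \<nu>(1) w mpoly_coeff_closed[OF vc] by simp
    next
      case 3
      then obtain e' where e: "e = Suc (Suc e')" by (metis add_2_eq_Suc le_Suc_ex)
      have s: "set_mset (mset_set A + replicate_mset e i) \<subseteq> {..<Suc i}" using Am by (auto simp: less_Suc_eq)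
      have "mset_set (insert i A) \<lless> mset_set (insert i A) + replicate_mset (Suc e') i"
        by (intro lex_less_add) simp
      then have "mset_set (insert i A) \<lless> mset_set A + replicate_mset e i" using iA e by simp
      then have "g ((mset_set A + replicate_mset e i) + \<nu>') = \<zero>"
        using g(2) s \<nu>(2) unfolding leading_block_def by blast
      then have "g (mset_set A + \<nu>) = \<zero>" using \<nu>(1) by (simp add: add.assoc)
      moreover have "v\<^sub>0 \<nu> = \<zero>" using e \<nu>(1) by (intro vars_from_outside[OF v0v, of i]) auto
      moreover have "v (\<nu> - {#i#}) = \<zero>" using e \<nu>(1) by (intro vars_from_outside[OF vv, of i]) auto
      ultimately show ?thesis using w by simp
    qed
  next
    fix \<mu> \<nu> assume \<mu>: "set_mset \<mu> \<subseteq> {..<i}" "mset_set A \<lless> \<mu>" and "set_mset \<nu> \<subseteq> {i..}"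
    then obtain e \<nu>' where \<nu>: "\<nu> = replicate_mset e i + \<nu>'" "set_mset \<nu>' \<subseteq> {Suc i..}"
      using split_next by metis
    have s: "set_mset (\<mu> + replicate_mset e i) \<subseteq> {..<Suc i}" using \<mu>(1) by (auto simp: less_Suc_eq)
    have "mset_set A + {#i#} \<lless> \<mu> + replicate_mset e i"
      using \<mu> Am by (subst lex_split[of _ i]) auto
    then have "g ((\<mu> + replicate_mset e i) + \<nu>') = \<zero>"
      using g(2) s \<nu>(2) iA unfolding leading_block_def by metis
    then show "g (\<mu> + \<nu>) = \<zero>" using \<nu>(1) by (simp add: add.assoc)
  qed
  then have "?w \<in> block_coeffs R n I i A"
    using vars_w g(1) xc vc v0c by (auto simp: block_coeffs_def)
  then show ?thesis using that v v0c v0v unfolding companion_def by blast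
qed

text \<open>
  Cross-multiplication eliminates \<open>x\<^sub>i\<close> from two linear equations.
\<close>

lemma companion_cross:
  assumes I: "ideal I P" and i: "i \<in> {1..n}" and A: "A \<subseteq> {..<i}"
    and v: "companion I i A v v\<^sub>0" and t: "companion I i A t t\<^sub>0"
  shows "v \<otimes>\<^bsub>P\<^esub> t\<^sub>0 \<ominus>\<^bsub>P\<^esub> t \<otimes>\<^bsub>P\<^esub> v\<^sub>0 \<in> block_coeffs R n I (Suc i) A"
proof -
  let ?x = "mono_poly R \<one> {#i#}"
  have xc: "?x \<in> carrier P" using i by (intro mono_poly_closed) (auto simp: monomials_def)
  have c: "v \<in> carrier P" "v\<^sub>0 \<in> carrier P" "t \<in> carrier P" "t\<^sub>0 \<in> carrier P"
    and vars: "vars_from R (Suc i) v" "vars_from R (Suc i) v\<^sub>0" "vars_from R (Suc i) t" "vars_from R (Suc i) t\<^sub>0"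
    using v t by (auto simp: companion_def block_coeffs_def)
  \<comment> \<open>As a combination of the two linear elements \<open>?W\<close> lies in the current module; after cancellation of \<open>x\<^sub>i v t\<close> it is free of \<open>x\<^sub>i\<close>.\<close>
  let ?W = "v \<otimes>\<^bsub>P\<^esub> (?x \<otimes>\<^bsub>P\<^esub> t \<oplus>\<^bsub>P\<^esub> t\<^sub>0) \<ominus>\<^bsub>P\<^esub> t \<otimes>\<^bsub>P\<^esub> (?x \<otimes>\<^bsub>P\<^esub> v \<oplus>\<^bsub>P\<^esub> v\<^sub>0)"
  have sub: "a \<ominus>\<^bsub>P\<^esub> b = (\<lambda>m. \<one> \<otimes> a m \<oplus> (\<ominus> \<one>) \<otimes> b m)" if "a \<in> carrier P" "b \<in> carrier P" for a b
  proof -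
    have "(\<lambda>m. (\<ominus> \<one>) \<otimes> b m) \<oplus>\<^bsub>P\<^esub> b = \<zero>\<^bsub>P\<^esub>"
      using that mpoly_coeff_closed[OF that(2)] by (auto simp: mpoly_add mpoly_zero l_minus l_neg)
    then have "\<ominus>\<^bsub>P\<^esub> b = (\<lambda>m. (\<ominus> \<one>) \<otimes> b m)"
      using that scalar_closed[of "\<ominus> \<one>" b] by (intro P.minus_equality) auto
    then show ?thesis using that mpoly_coeff_closed[OF that(1)] by (simp add: a_minus_def mpoly_add)
  qed
  have W: "?W = v \<otimes>\<^bsub>P\<^esub> t\<^sub>0 \<ominus>\<^bsub>P\<^esub> t \<otimes>\<^bsub>P\<^esub> v\<^sub>0"
    using xc c by algebra
  have "v \<otimes>\<^bsub>P\<^esub> (?x \<otimes>\<^bsub>P\<^esub> t \<oplus>\<^bsub>P\<^esub> t\<^sub>0) \<in> block_coeffs R n I i A"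
    "t \<otimes>\<^bsub>P\<^esub> (?x \<otimes>\<^bsub>P\<^esub> v \<oplus>\<^bsub>P\<^esub> v\<^sub>0) \<in> block_coeffs R n I i A"
    using v t c vars vars_from_mono[of R "Suc i" _ i]
    by (auto intro!: block_coeffs_mult[OF I _ A] simp: companion_def)
  then have "?W \<in> block_coeffs R n I i A"
    using xc c by (subst sub) (auto intro!: submodule_comb[OF block_coeffs_submodule[OF I]])
  then have 1: "v \<otimes>\<^bsub>P\<^esub> t\<^sub>0 \<ominus>\<^bsub>P\<^esub> t \<otimes>\<^bsub>P\<^esub> v\<^sub>0 \<in> block_coeffs R n I i A" using W by simp
  have "vars_from R (Suc i) (v \<otimes>\<^bsub>P\<^esub> t\<^sub>0)" "vars_from R (Suc i) (t \<otimes>\<^bsub>P\<^esub> v\<^sub>0)"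
    using vars_from_mult c vars by auto
  then have "vars_from R (Suc i) (v \<otimes>\<^bsub>P\<^esub> t\<^sub>0 \<ominus>\<^bsub>P\<^esub> t \<otimes>\<^bsub>P\<^esub> v\<^sub>0)"
    using c by (subst sub) (auto simp: vars_from_def, metis r_null r_zero zero_closed subsetD atLeast_iff a_inv_closed one_closed)
  then show ?thesis using block_coeffs_Suc_iff[OF A 1] by blast
qed

end

section \<open>The degeneration map\<close>

locale mpoly_points = mpoly_field K n for K :: "'a ring" (structure) and n :: nat

abbreviation (in mpoly_points) L where "L \<equiv> field.alg_closure K"

sublocale mpoly_points \<subseteq> L: field L
  using alg_closureE(1) algebraic_closure.axioms(1) by blast

context mpoly_points
begin

abbreviation val where "val \<equiv> eval_at K n"

lemma eval_at_eq: "val g y = mpoly_eval K L indexed_const n y g"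
  by (simp add: eval_at_def mpoly_eval_def mono_eval_def mpoly_support_def Let_def)

lemma affine_coord: "y \<in> affine_space K n \<Longrightarrow> i \<in> {1..n} \<Longrightarrow> y i \<in> carrier L"
  by (auto simp: affine_space_def)

lemma evaluation: "y \<in> affine_space K n \<Longrightarrow> mpoly_evaluation K L indexed_const n y"
  by (intro mpoly_evaluation.intro ring_hom_cring.intro ring_hom_cring_axioms.intro
      mpoly_evaluation_axioms.intro alg_closureE(2) affine_coord is_cring L.is_cring)

lemma val_closed [simp]: "y \<in> affine_space K n \<Longrightarrow> g \<in> carrier P \<Longrightarrow> val g y \<in> carrier L"
  unfolding eval_at_eq by (intro mpoly_evaluation.ev_closed evaluation)

lemma val_add:
  "y \<in> affine_space K n \<Longrightarrow> g \<in> carrier P \<Longrightarrow> h \<in> carrier P \<Longrightarrow> val (g \<oplus>\<^bsub>P\<^esub> h) y = val g y \<oplus>\<^bsub>L\<^esub> val h y"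
  unfolding eval_at_eq using ring_hom_add[OF mpoly_evaluation.ev_hom[OF evaluation]] by metis

lemma val_mult:
  "y \<in> affine_space K n \<Longrightarrow> g \<in> carrier P \<Longrightarrow> h \<in> carrier P \<Longrightarrow> val (g \<otimes>\<^bsub>P\<^esub> h) y = val g y \<otimes>\<^bsub>L\<^esub> val h y"
  unfolding eval_at_eq using ring_hom_mult[OF mpoly_evaluation.ev_hom[OF evaluation]] by metis

lemma val_one: "y \<in> affine_space K n \<Longrightarrow> val \<one>\<^bsub>P\<^esub> y = \<one>\<^bsub>L\<^esub>"
  unfolding eval_at_eq using ring_hom_one[OF mpoly_evaluation.ev_hom[OF evaluation]] by metis

lemma val_minus:
  assumes y: "y \<in> affine_space K n" and g: "g \<in> carrier P" and h: "h \<in> carrier P"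
  shows "val (g \<ominus>\<^bsub>P\<^esub> h) y = val g y \<ominus>\<^bsub>L\<^esub> val h y"
proof -
  have "val g y = val ((g \<ominus>\<^bsub>P\<^esub> h) \<oplus>\<^bsub>P\<^esub> h) y"
    using g h P.add.m_assoc[of g "\<ominus>\<^bsub>P\<^esub> h" h] by (simp add: P.minus_eq P.l_neg)
  also have "\<dots> = val (g \<ominus>\<^bsub>P\<^esub> h) y \<oplus>\<^bsub>L\<^esub> val h y"
    using assms by (intro val_add) auto
  finally have "val g y \<ominus>\<^bsub>L\<^esub> val h y = (val (g \<ominus>\<^bsub>P\<^esub> h) y \<oplus>\<^bsub>L\<^esub> val h y) \<ominus>\<^bsub>L\<^esub> val h y" by simp
  also have "\<dots> = val (g \<ominus>\<^bsub>P\<^esub> h) y"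
    using assms val_closed[OF y h] val_closed[OF y, of "g \<ominus>\<^bsub>P\<^esub> h"]
    by (simp add: L.minus_eq L.add.m_assoc L.r_neg)
  finally show ?thesis ..
qed

lemma mono_eval_eq_cong:
  assumes "\<And>k. k \<in># m \<Longrightarrow> x k = y k" "x \<in> affine_space K n" "y \<in> affine_space K n"
  shows "mono_eval L n x m = mono_eval L n y m"
  unfolding mono_eval_def
proof (intro L.finprod_cong')
  fix i assume i: "i \<in> {1..n}"
  show "x i [^]\<^bsub>L\<^esub> count m i = y i [^]\<^bsub>L\<^esub> count m i"
    using assms(1)[of i] by (cases "i \<in># m") (auto simp: not_in_iff)
qed (use assms affine_coord in auto)

lemma val_cong:
  assumes g: "g \<in> carrier P" "vars_from K i g" and xy: "x \<in> affine_space K n" "y \<in> affine_space K n"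
    and eq: "\<And>k. k \<in> {i..n} \<Longrightarrow> x k = y k"
  shows "val g x = val g y"
proof -
  have "mono_eval L n x m = mono_eval L n y m" if "g m \<noteq> \<zero>" for m
  proof (intro mono_eval_eq_cong eq xy)
    fix k assume "k \<in># m"
    moreover have "set_mset m \<subseteq> {i..}" "set_mset m \<subseteq> {1..n}"
      using g that by (auto simp: vars_from_def mpoly_carrier monomials_def)
    ultimately show "k \<in> {i..n}" by auto
  qed
  then show ?thesis
    unfolding eval_at_eq mpoly_eval_def
    using mpoly_evaluation.me_closed[OF evaluation[OF xy(2)]] ring_hom_closed[OF alg_closureE(2)] g(1)
    by (intro L.finsum_cong') auto
qed

lemma var_closed: "i \<in> {1..n} \<Longrightarrow> mono_poly K \<one> {#i#} \<in> carrier P"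
  by (intro mono_poly_closed) (auto simp: monomials_def)

lemma val_mono:
  assumes "y \<in> affine_space K n" "c \<in> carrier K" "m \<in> monomials n"
  shows "val (mono_poly K c m) y = indexed_const c \<otimes>\<^bsub>L\<^esub> mono_eval L n y m"
  unfolding eval_at_eq using mpoly_evaluation.ev_mono[OF evaluation] assms by metis

lemma val_var:
  assumes y: "y \<in> affine_space K n" and i: "i \<in> {1..n}"
  shows "val (mono_poly K \<one> {#i#}) y = y i"
proof -
  have "mono_eval L n y {#i#} = (\<Otimes>\<^bsub>L\<^esub>k\<in>{1..n}. if i = k then y k else \<one>\<^bsub>L\<^esub>)"
    unfolding mono_eval_def using y affine_coord by (intro L.finprod_cong') auto
  also have "\<dots> = y i"
    using i y affine_coord by (intro L.finprod_singleton) auto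
  finally show ?thesis
    using val_mono[OF y, of \<one> "{#i#}"] i ring_hom_one[OF alg_closureE(2)] affine_coord[OF y i]
    by (simp add: monomials_def)
qed

lemma val_monomial_zero_iff:
  assumes y: "y \<in> affine_space K n"
  shows "mono_eval L n y m = \<zero>\<^bsub>L\<^esub> \<longleftrightarrow> (\<exists>i\<in>{1..n}. i \<in># m \<and> y i = \<zero>\<^bsub>L\<^esub>)"
proof -
  have pow: "a [^]\<^bsub>L\<^esub> k = \<zero>\<^bsub>L\<^esub> \<longleftrightarrow> a = \<zero>\<^bsub>L\<^esub> \<and> k > 0" if "a \<in> carrier L" for a and k :: nat
    using that by (induction k) (auto simp: L.integral_iff)
  have *: "(\<Otimes>\<^bsub>L\<^esub>i\<in>F. f i) = \<zero>\<^bsub>L\<^esub> \<longleftrightarrow> (\<exists>i\<in>F. f i = \<zero>\<^bsub>L\<^esub>)"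
    if "finite F" "f \<in> F \<rightarrow> carrier L" for F :: "nat set" and f
    using that by (induction F rule: finite_induct) (auto simp: L.integral_iff L.finprod_closed)
  have "mono_eval L n y m = \<zero>\<^bsub>L\<^esub> \<longleftrightarrow> (\<exists>i\<in>{1..n}. y i [^]\<^bsub>L\<^esub> count m i = \<zero>\<^bsub>L\<^esub>)"
    unfolding mono_eval_def using affine_coord[OF y] by (intro *) auto
  also have "\<dots> \<longleftrightarrow> (\<exists>i\<in>{1..n}. i \<in># m \<and> y i = \<zero>\<^bsub>L\<^esub>)"
    using affine_coord[OF y] pow by auto
  finally show ?thesis .
qed

end

text \<open>
  The degeneration map exists for such families over any field, whatever the source of their
  squarefreeness.
\<close>

locale lex_family = mpoly_points K n for K :: "'a ring" (structure) and n :: nat +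
  fixes Is :: "(nat multiset \<Rightarrow> 'a) set set"
  assumes ideals: "\<And>I. I \<in> Is \<Longrightarrow> ideal I P"
    and inter: "\<And>I J. I \<in> Is \<Longrightarrow> J \<in> Is \<Longrightarrow> I \<inter> J \<in> Is"
    and squarefree: "\<And>I. I \<in> Is \<Longrightarrow> squarefree_monos (lead_monos K I)"
begin

text \<open>
  The equations of \<open>I\<close> at this stage are consistent over the later coordinates of \<open>y\<close> after
  elimination of \<open>x\<^sub>i\<close>, and at least one of them determines \<open>x\<^sub>i\<close>.
\<close>

definition active :: "(nat multiset \<Rightarrow> 'a) set \<Rightarrow> nat \<Rightarrow> nat set \<Rightarrow> (nat \<Rightarrow> 'a closure_elem) \<Rightarrow> bool" where
  "active I i A y \<longleftrightarrow> I \<in> Is \<and>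
    (\<forall>u\<in>block_coeffs K n I (Suc i) A. val u y = \<zero>\<^bsub>L\<^esub>) \<and>
    (\<exists>v\<in>block_coeffs K n I (Suc i) (insert i A). val v y \<noteq> \<zero>\<^bsub>L\<^esub>)"

text \<open>
  The translation that moves to \<open>0\<close> the value of \<open>x\<^sub>i\<close> determined by the equations, for all active
  members of the family at once.
\<close>

definition is_shift :: "nat \<Rightarrow> nat set \<Rightarrow> (nat \<Rightarrow> 'a closure_elem) \<Rightarrow> 'a closure_elem \<Rightarrow> bool" where
  "is_shift i A y a \<longleftrightarrow> a \<in> carrier L \<and>
    (\<forall>I v v\<^sub>0. active I i A y \<longrightarrow> companion I i A v v\<^sub>0 \<longrightarrow> a \<otimes>\<^bsub>L\<^esub> val v y = val v\<^sub>0 y)"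

definition shift :: "nat \<Rightarrow> nat set \<Rightarrow> (nat \<Rightarrow> 'a closure_elem) \<Rightarrow> 'a closure_elem" where
  "shift i A y = (if \<exists>I. active I i A y then SOME a. is_shift i A y a else \<zero>\<^bsub>L\<^esub>)"

lemma companion_closed:
  assumes "companion I i A v v\<^sub>0"
  shows "v \<in> carrier P" "v\<^sub>0 \<in> carrier P" "vars_from K (Suc i) v" "vars_from K (Suc i) v\<^sub>0"
  using assms by (auto simp: companion_def block_coeffs_def)

lemma companion_cross_val:
  assumes y: "y \<in> affine_space K n" and act: "active I i A y" and i: "i \<in> {1..n}" and A: "A \<subseteq> {..<i}"
    and v: "companion I i A v v\<^sub>0" and t: "companion I i A t t\<^sub>0"
  shows "val v y \<otimes>\<^bsub>L\<^esub> val t\<^sub>0 y = val t y \<otimes>\<^bsub>L\<^esub> val v\<^sub>0 y"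
proof -
  have I: "ideal I P" using act ideals by (simp add: active_def)
  note c = companion_closed[OF v] companion_closed[OF t]
  have "val (v \<otimes>\<^bsub>P\<^esub> t\<^sub>0 \<ominus>\<^bsub>P\<^esub> t \<otimes>\<^bsub>P\<^esub> v\<^sub>0) y = \<zero>\<^bsub>L\<^esub>"
    using companion_cross[OF I i A v t] act by (simp add: active_def)
  then have "val v y \<otimes>\<^bsub>L\<^esub> val t\<^sub>0 y \<ominus>\<^bsub>L\<^esub> val t y \<otimes>\<^bsub>L\<^esub> val v\<^sub>0 y = \<zero>\<^bsub>L\<^esub>"
    using c y by (simp add: val_minus val_mult)
  then show ?thesis using c y by (simp add: L.r_right_minus_eq)
qed

text \<open>
  Let \<open>I\<close> and \<open>J\<close> be active, with slopes \<open>v\<close> and \<open>w\<close> that do not vanish at \<open>y\<close>.  Then \<open>t = v w\<close> is a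
  slope of both, hence of \<open>I \<inter> J\<close> by \<open>block_coeffs_inter\<close>.  A companion of \<open>t\<close> for \<open>I \<inter> J\<close> is one
  for \<open>I\<close> and for \<open>J\<close>, so all of them determine the same value of \<open>x\<^sub>i\<close>.
\<close>

lemma is_shift_exists:
  assumes y: "y \<in> affine_space K n" and act: "active I i A y" and i: "i \<in> {1..n}" and A: "A \<subseteq> {..<i}"
  shows "\<exists>a. is_shift i A y a"
proof -
  have A': "insert i A \<subseteq> {..<Suc i}" using A by (auto simp: less_Suc_eq)
  have I: "ideal I P" "I \<in> Is" using act ideals by (simp_all add: active_def)
  obtain v where v: "v \<in> block_coeffs K n I (Suc i) (insert i A)" "val v y \<noteq> \<zero>\<^bsub>L\<^esub>"
    using act by (auto simp: active_def)
  obtain v\<^sub>0 where c: "companion I i A v v\<^sub>0" using companion_exists[OF I(1) i A v(1)] .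
  note cc = companion_closed[OF c]
  have vL: "val v y \<in> carrier L" "val v\<^sub>0 y \<in> carrier L" using cc y by auto
  have inv: "inv\<^bsub>L\<^esub> (val v y) \<in> carrier L" "inv\<^bsub>L\<^esub> (val v y) \<otimes>\<^bsub>L\<^esub> val v y = \<one>\<^bsub>L\<^esub>"
    using vL(1) v(2) L.field_Units by auto
  \<comment> \<open>The translation determined by \<open>I\<close>; it will turn out to serve every active \<open>J\<close>.\<close>
  define a where "a = val v\<^sub>0 y \<otimes>\<^bsub>L\<^esub> inv\<^bsub>L\<^esub> (val v y)"
  have aL: "a \<in> carrier L" and av: "a \<otimes>\<^bsub>L\<^esub> val v y = val v\<^sub>0 y"
    using vL inv by (auto simp: a_def L.m_assoc)
  have "a \<otimes>\<^bsub>L\<^esub> val v' y = val v\<^sub>0' y" if act': "active J i A y" and c': "companion J i A v' v\<^sub>0'" for J v' v\<^sub>0'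
  proof -
    have J: "ideal J P" "J \<in> Is" using act' ideals by (simp_all add: active_def)
    note cc' = companion_closed[OF c']
    obtain w where w: "w \<in> block_coeffs K n J (Suc i) (insert i A)" "val w y \<noteq> \<zero>\<^bsub>L\<^esub>"
      using act' by (auto simp: active_def)
    have wc: "w \<in> carrier P" "vars_from K (Suc i) w" using w by (auto simp: block_coeffs_def)
    define t where "t = w \<otimes>\<^bsub>P\<^esub> v"
    have "t \<in> block_coeffs K n I (Suc i) (insert i A)"
      unfolding t_def by (rule block_coeffs_mult[OF I(1) v(1) A' wc])
    moreover have "v \<otimes>\<^bsub>P\<^esub> w \<in> block_coeffs K n J (Suc i) (insert i A)"
      by (rule block_coeffs_mult[OF J(1) w(1) A' cc(1,3)])
    then have "t \<in> block_coeffs K n J (Suc i) (insert i A)"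
      using P.m_comm[OF cc(1) wc(1)] by (simp add: t_def)
    ultimately have "t \<in> block_coeffs K n (I \<inter> J) (Suc i) (insert i A)"
      using block_coeffs_inter[OF I(1) J(1) squarefree[OF inter[OF I(2) J(2)]] A'] by simp
    then obtain t\<^sub>0 where t0: "companion (I \<inter> J) i A t t\<^sub>0"
      using companion_exists[OF ideals[OF inter[OF I(2) J(2)]] i A] by blast
    have tI: "companion I i A t t\<^sub>0" and tJ: "companion J i A t t\<^sub>0"
      using companion_mono[OF _ t0] by auto
    note tc = companion_closed[OF t0]
    have tL: "val t y \<in> carrier L" "val t\<^sub>0 y \<in> carrier L" using tc y by auto
    have v'L: "val v' y \<in> carrier L" "val v\<^sub>0' y \<in> carrier L" using cc' y by auto
    have nz: "val t y \<noteq> \<zero>\<^bsub>L\<^esub>"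
      using v(2) w(2) vL(1) wc(1) cc(1) y by (simp add: t_def val_mult L.integral_iff)
    have "val v y \<otimes>\<^bsub>L\<^esub> val t\<^sub>0 y = val v y \<otimes>\<^bsub>L\<^esub> (val t y \<otimes>\<^bsub>L\<^esub> a)"
      using companion_cross_val[OF y act i A c tI] vL tL aL by (simp add: av[symmetric] L.m_ac)
    then have t0a: "val t\<^sub>0 y = val t y \<otimes>\<^bsub>L\<^esub> a"
      using L.m_lcancel[OF v(2) vL(1)] tL aL by simp
    have "val t y \<otimes>\<^bsub>L\<^esub> (a \<otimes>\<^bsub>L\<^esub> val v' y) = val v' y \<otimes>\<^bsub>L\<^esub> val t\<^sub>0 y"
      unfolding t0a using tL aL v'L by (simp add: L.m_ac)
    also have "\<dots> = val t y \<otimes>\<^bsub>L\<^esub> val v\<^sub>0' y"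
      by (rule companion_cross_val[OF y act' i A c' tJ])
    finally show ?thesis using L.m_lcancel[OF nz tL(1)] v'L aL by simp
  qed
  then have "is_shift i A y a" using aL unfolding is_shift_def by metis
  then show ?thesis by (intro exI[of _ a])
qed

lemma shift_is_shift:
  assumes "y \<in> affine_space K n" "active I i A y" "i \<in> {1..n}" "A \<subseteq> {..<i}"
  shows "is_shift i A y (shift i A y)"
  using someI_ex[OF is_shift_exists[OF assms]] assms(2) by (auto simp: shift_def)

lemma shift_closed:
  assumes "y \<in> affine_space K n" "i \<in> {1..n}" "A \<subseteq> {..<i}"
  shows "shift i A y \<in> carrier L"
proof (cases "\<exists>I. active I i A y")
  case True
  then show ?thesis using shift_is_shift[OF assms(1) _ assms(2,3)] by (auto simp: is_shift_def)
qed (simp add: shift_def)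

lemma active_cong:
  assumes "x \<in> affine_space K n" "y \<in> affine_space K n" "\<And>k. k \<in> {Suc i..n} \<Longrightarrow> x k = y k"
  shows "active I i A x \<longleftrightarrow> active I i A y"
proof -
  have "val u x = val u y" if "u \<in> block_coeffs K n I (Suc i) B" for u B
    using that assms by (intro val_cong[of u "Suc i"]) (auto simp: block_coeffs_def)
  then show ?thesis unfolding active_def by simp
qed

lemma shift_cong:
  assumes "x \<in> affine_space K n" "y \<in> affine_space K n" "\<And>k. k \<in> {Suc i..n} \<Longrightarrow> x k = y k"
  shows "shift i A x = shift i A y"
proof -
  have act: "active I i A x \<longleftrightarrow> active I i A y" for I using active_cong assms by blast
  have "val v x = val v y" "val v\<^sub>0 x = val v\<^sub>0 y" if "companion I i A v v\<^sub>0" for I v v\<^sub>0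
    using companion_closed[OF that] assms by (auto intro!: val_cong[of _ "Suc i"])
  then have "is_shift i A x a \<longleftrightarrow> is_shift i A y a" for a
    unfolding is_shift_def act by (simp cong: imp_cong)
  then have "is_shift i A x = is_shift i A y" by (intro ext)
  then show ?thesis unfolding shift_def act by simp
qed

primrec nonzeros :: "(nat \<Rightarrow> 'a closure_elem) \<Rightarrow> nat \<Rightarrow> nat set" where
  "nonzeros y 0 = {}"
| "nonzeros y (Suc j) =
    (if y (Suc j) \<oplus>\<^bsub>L\<^esub> shift (Suc j) (nonzeros y j) y = \<zero>\<^bsub>L\<^esub> then nonzeros y j
     else insert (Suc j) (nonzeros y j))"

text \<open>
  The earlier coordinates influence the \<open>i\<close>-th one only through the set of those that have become
  nonzero.  As this set is visible in the image, the map can be inverted from the last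
  coordinate down.
\<close>

definition degen :: "(nat \<Rightarrow> 'a closure_elem) \<Rightarrow> (nat \<Rightarrow> 'a closure_elem)" where
  "degen y = (\<lambda>i\<in>{1..n}. y i \<oplus>\<^bsub>L\<^esub> shift i (nonzeros y (i - 1)) y)"

lemma nonzeros_subset: "nonzeros y j \<subseteq> {1..j}"
  by (induction j) (auto simp: le_Suc_eq)

lemma nonzeros_less: "nonzeros y j \<subseteq> {..<Suc j}"
  using nonzeros_subset[of y j] by auto

lemma degen_closed: "y \<in> affine_space K n \<Longrightarrow> degen y \<in> affine_space K n"
  unfolding affine_space_def degen_def
proof (rule restrict_PiE_iff[THEN iffD2], rule ballI)
  fix i assume y: "y \<in> {1..n} \<rightarrow>\<^sub>E carrier L" and i: "i \<in> {1..n}"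
  then have "nonzeros y (i - 1) \<subseteq> {..<i}" using nonzeros_less[of y "i - 1"] by simp
  then show "y i \<oplus>\<^bsub>L\<^esub> shift i (nonzeros y (i - 1)) y \<in> carrier L"
    using y i by (intro L.a_closed shift_closed) (auto simp: affine_space_def)
qed

lemma nonzeros_iff: "j \<le> n \<Longrightarrow> k \<in> nonzeros y j \<longleftrightarrow> k \<in> {1..j} \<and> degen y k \<noteq> \<zero>\<^bsub>L\<^esub>"
proof (induction j)
  case (Suc j)
  have "degen y (Suc j) = y (Suc j) \<oplus>\<^bsub>L\<^esub> shift (Suc j) (nonzeros y j) y"
    using Suc.prems by (simp add: degen_def)
  then show ?case using Suc by (auto simp: le_Suc_eq)
qed simp

text \<open>
  If all slopes vanish at \<open>y\<close>, the equations pass to the next stage for either choice of the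
  block.  Otherwise \<open>I\<close> is active, the \<open>i\<close>-th coordinate is moved to \<open>0\<close>, and the block does not
  grow.
\<close>

lemma block_coeffs_vanish:
  assumes y: "y \<in> affine_space K n" and I: "I \<in> Is" and van: "\<And>g. g \<in> I \<Longrightarrow> val g y = \<zero>\<^bsub>L\<^esub>"
    and "j \<le> n" "u \<in> block_coeffs K n I (Suc j) (nonzeros y j)"
  shows "val u y = \<zero>\<^bsub>L\<^esub>"
  using assms(4,5)
proof (induction j arbitrary: u)
  case 0
  then obtain g where g: "g \<in> I" "leading_block K 1 {} g u" and u: "u \<in> carrier P"
    by (auto simp: block_coeffs_def)
  have "g \<in> carrier P" using g(1) ideal_carrier[OF ideals[OF I]] by blast
  have "g m = u m" for m
  proof (cases "m \<in> monomials n")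
    case True
    then have "set_mset m \<subseteq> {1..}" by (auto simp: monomials_def)
    then have "g (mset_set {} + m) = u m" using g(2) unfolding leading_block_def by blast
    then show ?thesis by simp
  qed (use mpoly_coeff_outside u \<open>g \<in> carrier P\<close> in metis)
  then have "g = u" by blast
  then show ?case using van[OF g(1)] by simp
next
  case (Suc j)
  let ?i = "Suc j" and ?A = "nonzeros y j"
  have i: "?i \<in> {1..n}" using Suc.prems by simp
  have A: "?A \<subseteq> {..<?i}" by (rule nonzeros_less)
  have IH: "val u y = \<zero>\<^bsub>L\<^esub>" if "u \<in> block_coeffs K n I ?i ?A" for u
    using Suc.IH that Suc.prems(1) by simp
  have Pi: "val u y = \<zero>\<^bsub>L\<^esub>" if "u \<in> block_coeffs K n I (Suc ?i) ?A" for u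
    using IH block_coeffs_Suc_subset[OF A] that by blast
  show ?case
  proof (cases "\<exists>v\<in>block_coeffs K n I (Suc ?i) (insert ?i ?A). val v y \<noteq> \<zero>\<^bsub>L\<^esub>")
    case False
    then show ?thesis using Pi Suc.prems(2) by (auto split: if_splits)
  next
    case True
    then obtain v where v: "v \<in> block_coeffs K n I (Suc ?i) (insert ?i ?A)" "val v y \<noteq> \<zero>\<^bsub>L\<^esub>" by blast
    have act: "active I ?i ?A y" using True Pi I by (auto simp: active_def)
    obtain v\<^sub>0 where c: "companion I ?i ?A v v\<^sub>0" using companion_exists[OF ideals[OF I] i A v(1)] .
    note cc = companion_closed[OF c]
    have sh: "shift ?i ?A y \<otimes>\<^bsub>L\<^esub> val v y = val v\<^sub>0 y" "shift ?i ?A y \<in> carrier L"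
      using shift_is_shift[OF y act i A] act c by (auto simp: is_shift_def)
    have "val (mono_poly K \<one> {#?i#} \<otimes>\<^bsub>P\<^esub> v \<oplus>\<^bsub>P\<^esub> v\<^sub>0) y = \<zero>\<^bsub>L\<^esub>"
      using IH c by (simp add: companion_def)
    then have "y ?i \<otimes>\<^bsub>L\<^esub> val v y \<oplus>\<^bsub>L\<^esub> val v\<^sub>0 y = \<zero>\<^bsub>L\<^esub>"
      using cc y i var_closed[OF i] by (simp add: val_add val_mult val_var)
    then have "(y ?i \<oplus>\<^bsub>L\<^esub> shift ?i ?A y) \<otimes>\<^bsub>L\<^esub> val v y = \<zero>\<^bsub>L\<^esub>"
      using sh cc y affine_coord[OF y i] by (simp add: L.l_distr)
    then have "y ?i \<oplus>\<^bsub>L\<^esub> shift ?i ?A y = \<zero>\<^bsub>L\<^esub>"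
      using v(2) cc y affine_coord[OF y i] sh(2) by (simp add: L.integral_iff)
    then show ?thesis using Pi Suc.prems(2) by simp
  qed
qed

text \<open>
  After the last variable the coefficients are constants that vanish at a point, so they are
  zero: the product of the variables that are nonzero at the image is not a leading monomial of
  \<open>I\<close>.  By squarefreeness no leading monomial involves only these variables, that is, each
  leading monomial vanishes at the image.
\<close>

lemma degen_in_init:
  assumes I: "I \<in> Is" and y: "y \<in> zeros K n I"
  shows "degen y \<in> zeros K n (init_ideal K n lex_weighting I)"
proof -
  have ya: "y \<in> affine_space K n" and van: "\<And>g. g \<in> I \<Longrightarrow> val g y = \<zero>\<^bsub>L\<^esub>"
    using y by (auto simp: zeros_def)
  have da: "degen y \<in> affine_space K n" by (rule degen_closed[OF ya])
  have mono0: "mono_eval L n (degen y) m = \<zero>\<^bsub>L\<^esub>" if m: "m \<in> lead_monos K I" for m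
  proof (rule ccontr)
    assume nz: "mono_eval L n (degen y) m \<noteq> \<zero>\<^bsub>L\<^esub>"
    let ?A = "nonzeros y n"
    have A: "?A \<subseteq> {..<Suc n}" by (rule nonzeros_less)
    have "set_mset m \<subseteq> ?A"
      using nz val_monomial_zero_iff[OF da] nonzeros_iff[of n _ y] lead_monos_monomials[OF ideals[OF I] m]
      by (auto simp: monomials_def)
    then have "mset_set (set_mset m) \<subseteq># mset_set ?A"
      using finite_subset[OF A] by (simp add: subset_imp_msubset_mset_set)
    moreover have "mset_set (set_mset m) \<in> lead_monos K I"
      using squarefree[OF I] m by (auto simp: squarefree_monos_def)
    moreover have "mset_set ?A \<in> monomials n"
      using nonzeros_subset[of y n] finite_subset[OF A] by (auto simp: monomials_def)
    ultimately have "mset_set ?A + {#} \<in> lead_monos K I"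
      using lead_monos_superset[OF ideals[OF I]] by simp
    then have "{#} \<in> lead_monos K (block_coeffs K n I (Suc n) ?A)"
      by (intro lead_monos_block[OF ideals[OF I] A]) auto
    then obtain u where u: "u \<in> block_coeffs K n I (Suc n) ?A" "u {#} \<noteq> \<zero>"
      by (auto simp: lead_monos_def lead_at_def)
    have uc: "u \<in> carrier P" "vars_from K (Suc n) u" using u by (auto simp: block_coeffs_def)
    have "u = mono_poly K (u {#}) {#}"
    proof
      fix m show "u m = mono_poly K (u {#}) {#} m"
      proof (cases "m = {#} \<or> u m = \<zero>")
        case False
        then have "set_mset m \<subseteq> {1..n}" "set_mset m \<subseteq> {Suc n..}"
          using uc by (auto simp: mpoly_carrier monomials_def vars_from_def)
        then show ?thesis using False by (metis atLeastAtMost_iff atLeast_iff multiset_nonemptyE not_less_eq_eq subset_iff)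
      qed (auto simp: mono_poly_def)
    qed
    then have "val u y = indexed_const (u {#}) \<otimes>\<^bsub>L\<^esub> mono_eval L n y {#}"
      using val_mono[OF ya mpoly_coeff_closed[OF uc(1)], of "{#}" "{#}"] by simp
    then have "val u y = indexed_const (u {#})"
      using mpoly_evaluation.me_empty[OF evaluation[OF ya]]
        ring_hom_closed[OF alg_closureE(2) mpoly_coeff_closed[OF uc(1)]] by simp
    moreover have "val u y = \<zero>\<^bsub>L\<^esub>"
      using block_coeffs_vanish[OF ya I van _ u(1)] by blast
    ultimately have "indexed_const (u {#}) = \<zero>\<^bsub>L\<^esub>" by simp
    moreover have "inv (u {#}) \<otimes> u {#} = \<one>" "inv (u {#}) \<in> carrier K"
      using u(2) mpoly_coeff_closed[OF uc(1)] field_Units by auto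
    then have "indexed_const (inv (u {#})) \<otimes>\<^bsub>L\<^esub> indexed_const (u {#}) = \<one>\<^bsub>L\<^esub>"
      using ring_hom_mult[OF alg_closureE(2), of "inv (u {#})" "u {#}"] ring_hom_one[OF alg_closureE(2)]
        mpoly_coeff_closed[OF uc(1)] by simp
    ultimately show False
      using ring_hom_closed[OF alg_closureE(2) \<open>inv (u {#}) \<in> carrier K\<close>] by simp
  qed
  have "val h (degen y) = \<zero>\<^bsub>L\<^esub>" if "h \<in> init_ideal K n lex_weighting I" for h
  proof -
    have h: "h \<in> carrier P" "\<And>m. h m \<noteq> \<zero> \<Longrightarrow> m \<in> lead_monos K I"
      using that init_ideal_eq[OF ideals[OF I]] by auto
    have "indexed_const (h m) \<otimes>\<^bsub>L\<^esub> mono_eval L n (degen y) m = \<zero>\<^bsub>L\<^esub>" if "h m \<noteq> \<zero>" for m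
      using mono0[OF h(2)[OF that]] ring_hom_closed[OF alg_closureE(2) mpoly_coeff_closed[OF h(1)]] by simp
    then show ?thesis
      unfolding eval_at_eq mpoly_eval_def by (intro L.add.finprod_one_eqI) auto
  qed
  then show ?thesis using da by (simp add: zeros_def)
qed

lemma degen_inj: "inj_on degen (affine_space K n)"
proof (rule inj_onI)
  fix x y assume x: "x \<in> affine_space K n" and y: "y \<in> affine_space K n" and eq: "degen x = degen y"
  have nz: "nonzeros x j = nonzeros y j" if "j \<le> n" for j
    using nonzeros_iff[OF that] eq by auto
  have "\<forall>k\<in>{n - d<..n}. x k = y k" if "d \<le> n" for d
    using that
  proof (induction d)
    case (Suc d)
    define i where "i = n - d"
    have i: "i \<in> {1..n}" using Suc.prems by (simp add: i_def)
    have IH: "\<And>k. k \<in> {Suc i..n} \<Longrightarrow> x k = y k" using Suc by (auto simp: i_def)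
    have s: "shift i (nonzeros x (i - 1)) x = shift i (nonzeros y (i - 1)) y"
      using shift_cong[OF x y IH] nz[of "i - 1"] i by auto
    have "nonzeros y (i - 1) \<subseteq> {..<i}" using nonzeros_less[of y "i - 1"] i by simp
    then have "shift i (nonzeros y (i - 1)) y \<in> carrier L" using shift_closed[OF y i] by blast
    moreover have "x i \<oplus>\<^bsub>L\<^esub> shift i (nonzeros x (i - 1)) x = y i \<oplus>\<^bsub>L\<^esub> shift i (nonzeros y (i - 1)) y"
      using fun_cong[OF eq, of i] i by (simp add: degen_def)
    ultimately have "x i = y i"
      using s affine_coord[OF x i] affine_coord[OF y i] by simp
    moreover have "{n - Suc d<..n} = insert i {Suc i..n}" using Suc.prems by (auto simp: i_def)
    ultimately show ?case using IH by auto
  qed simp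
  from this[of n] have "\<forall>k\<in>{1..n}. x k = y k" by auto
  then show "x = y" using x y unfolding affine_space_def by (intro PiE_ext) auto
qed

text \<open>
  The blocks are prescribed by the target \<open>z\<close>.  The coordinates are chosen from the last one down;
  the shift of a coordinate depends on later coordinates only, which are no longer changed.
\<close>

lemma degen_surj: "affine_space K n \<subseteq> degen ` affine_space K n"
proof
  fix z assume z: "z \<in> affine_space K n"
  define B where "B = (\<lambda>j. {i\<in>{1..j}. z i \<noteq> \<zero>\<^bsub>L\<^esub>})"
  have B: "B (i - 1) \<subseteq> {..<i}" if "i \<ge> 1" for i using that by (auto simp: B_def)
  have "\<exists>y\<in>affine_space K n. \<forall>k\<in>{n - d<..n}. y k \<oplus>\<^bsub>L\<^esub> shift k (B (k - 1)) y = z k" if "d \<le> n" for d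
    using that
  proof (induction d)
    case 0
    then show ?case using z by auto
  next
    case (Suc d)
    then obtain y where y: "y \<in> affine_space K n" "\<forall>k\<in>{n - d<..n}. y k \<oplus>\<^bsub>L\<^esub> shift k (B (k - 1)) y = z k"
      by auto
    define i where "i = n - d"
    have i: "i \<in> {1..n}" using Suc.prems by (simp add: i_def)
    define s where "s = shift i (B (i - 1)) y"
    have s: "s \<in> carrier L" unfolding s_def using shift_closed[OF y(1) i] B i by simp
    \<comment> \<open>Only coordinate \<open>i\<close> changes, and no shift with index at least \<open>i\<close> depends on it.\<close>
    define y' where "y' = y(i := z i \<ominus>\<^bsub>L\<^esub> s)"
    have y': "y' \<in> affine_space K n"
      using y(1) i s affine_coord[OF z i] unfolding y'_def affine_space_def
      by (auto simp: PiE_iff extensional_def)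
    have eq: "shift k (B (k - 1)) y' = shift k (B (k - 1)) y" if "k \<ge> i" for k
      using that by (intro shift_cong[OF y' y(1)]) (auto simp: y'_def)
    have "y' k \<oplus>\<^bsub>L\<^esub> shift k (B (k - 1)) y' = z k" if k: "k \<in> {n - Suc d<..n}" for k
    proof (cases "k = i")
      case True
      have "shift i (B (i - 1)) y' = s" using eq[of i] by (simp only: s_def order_refl)
      then show ?thesis
        unfolding True using s affine_coord[OF z i]
        by (simp only: fun_upd_same y'_def L.minus_eq L.add.m_assoc L.l_neg L.a_inv_closed L.r_zero)
    next
      case False
      then have "k \<in> {n - d<..n}" "k \<ge> i" using k by (auto simp: i_def)
      then show ?thesis using y(2) eq[of k] False by (simp add: y'_def)
    qed
    then show ?case using y' by blast
  qed
  from this[of n] obtain y where y: "y \<in> affine_space K n"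
    and k: "\<And>k. k \<in> {1..n} \<Longrightarrow> y k \<oplus>\<^bsub>L\<^esub> shift k (B (k - 1)) y = z k" by auto
  have "j \<le> n \<Longrightarrow> nonzeros y j = B j" for j
  proof (induction j)
    case (Suc j)
    have "y (Suc j) \<oplus>\<^bsub>L\<^esub> shift (Suc j) (B j) y = z (Suc j)"
      using k[of "Suc j"] Suc.prems by simp
    moreover have "B (Suc j) = (if z (Suc j) = \<zero>\<^bsub>L\<^esub> then B j else insert (Suc j) (B j))"
      by (auto simp: B_def le_Suc_eq)
    ultimately show ?case using Suc by simp
  qed (simp add: B_def)
  then have "degen y i = z i" if "i \<in> {1..n}" for i
    using k[OF that] that by (auto simp: degen_def)
  then have "degen y = z"
    using degen_closed[OF y] z unfolding affine_space_def by (intro PiE_ext) auto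
  then show "z \<in> degen ` affine_space K n" using y by blast
qed

lemma degen_bij: "bij_betw degen (affine_space K n) (affine_space K n)"
  unfolding bij_betw_def
  by (intro conjI degen_inj subset_antisym degen_surj image_subsetI degen_closed)

end

section \<open>Constructibility of the degeneration map\<close>

context mpoly_points
begin

lemma vanishing_ideal:
  assumes y: "y \<in> affine_space K n"
  shows "ideal {g \<in> carrier P. val g y = \<zero>\<^bsub>L\<^esub>} P"
proof -
  have "ring_hom_ring P L (mpoly_eval K L indexed_const n y)"
    by (intro ring_hom_ringI2 P.ring_axioms L.ring_axioms mpoly_evaluation.ev_hom evaluation y)
  from ring_hom_ring.kernel_is_ideal[OF this] show ?thesis
    by (simp add: a_kernel_def' eval_at_eq)
qed

lemma zeros_genideal:
  assumes "T \<subseteq> carrier P"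
  shows "zeros K n (Idl\<^bsub>P\<^esub> T) = zeros K n T"
proof
  show "zeros K n (Idl\<^bsub>P\<^esub> T) \<subseteq> zeros K n T"
    using P.genideal_self[OF assms] by (auto simp: zeros_def)
  show "zeros K n T \<subseteq> zeros K n (Idl\<^bsub>P\<^esub> T)"
  proof
    fix y assume y: "y \<in> zeros K n T"
    then have "y \<in> affine_space K n" by (simp add: zeros_def)
    moreover from this have "Idl\<^bsub>P\<^esub> T \<subseteq> {g \<in> carrier P. val g y = \<zero>\<^bsub>L\<^esub>}"
      using y assms by (intro P.genideal_minimal vanishing_ideal) (auto simp: zeros_def)
    ultimately show "y \<in> zeros K n (Idl\<^bsub>P\<^esub> T)" by (auto simp: zeros_def)
  qed
qed

lemma zeros_Un:
  assumes I: "ideal I P" and J: "ideal J P"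
  shows "zeros K n I \<union> zeros K n J = zeros K n (I \<inter> J)"
proof
  show "zeros K n (I \<inter> J) \<subseteq> zeros K n I \<union> zeros K n J"
  proof (rule subsetI, rule ccontr)
    fix y assume y: "y \<in> zeros K n (I \<inter> J)" and "y \<notin> zeros K n I \<union> zeros K n J"
    then obtain g h where g: "g \<in> I" "val g y \<noteq> \<zero>\<^bsub>L\<^esub>" and h: "h \<in> J" "val h y \<noteq> \<zero>\<^bsub>L\<^esub>"
      by (auto simp: zeros_def)
    have c: "g \<in> carrier P" "h \<in> carrier P" "y \<in> affine_space K n"
      using g h y ideal_carrier[OF I] ideal_carrier[OF J] by (auto simp: zeros_def)
    have "g \<otimes>\<^bsub>P\<^esub> h \<in> I \<inter> J"
      using ideal.I_r_closed[OF I g(1) c(2)] ideal.I_l_closed[OF J h(1) c(1)] by simp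
    then have "val (g \<otimes>\<^bsub>P\<^esub> h) y = \<zero>\<^bsub>L\<^esub>" using y by (auto simp: zeros_def)
    then show False using g h c by (simp add: val_mult L.integral_iff)
  qed
qed (auto simp: zeros_def)

lemma zeros_finite_Union:
  assumes "finite F" "\<And>T. T \<in> F \<Longrightarrow> T \<subseteq> carrier P"
  shows "\<exists>J. ideal J P \<and> (\<Union>T\<in>F. zeros K n T) = zeros K n J"
  using assms
proof (induction F rule: finite_induct)
  case empty
  have "\<exists>g\<in>carrier P. val g y \<noteq> \<zero>\<^bsub>L\<^esub>" if "y \<in> affine_space K n" for y
    using val_one[OF that] L.one_not_zero by (intro bexI[of _ "\<one>\<^bsub>P\<^esub>"]) auto
  then have "zeros K n (carrier P) = {}" by (auto simp: zeros_def)
  then show ?case using P.oneideal by (intro exI[of _ "carrier P"]) auto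
next
  case (insert T F)
  then obtain J where J: "ideal J P" "(\<Union>T\<in>F. zeros K n T) = zeros K n J" by auto
  have T: "T \<subseteq> carrier P" using insert by blast
  then have IX: "ideal (Idl\<^bsub>P\<^esub> T) P" by (rule P.genideal_ideal)
  have "(\<Union>T\<in>insert T F. zeros K n T) = zeros K n (Idl\<^bsub>P\<^esub> T \<inter> J)"
    using zeros_Un[OF IX J(1)] J(2) zeros_genideal[OF T] by simp
  then show ?case using P.i_intersect[OF IX J(1)] by blast
qed

definition stratum :: "(nat multiset \<Rightarrow> 'a) set set \<Rightarrow> (nat multiset \<Rightarrow> 'a) set set \<Rightarrow> (nat \<Rightarrow> 'a closure_elem) set" where
  "stratum F G = {y \<in> affine_space K n. \<forall>T\<in>F. y \<in> zeros K n T \<longleftrightarrow> T \<in> G}"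

lemma stratum_locally_closed:
  assumes "finite F" "\<And>T. T \<in> F \<Longrightarrow> T \<subseteq> carrier P" "G \<subseteq> F"
  shows "locally_closed K n (stratum F G)"
proof -
  obtain J where J: "ideal J P" "(\<Union>T\<in>F - G. zeros K n T) = zeros K n J"
    using zeros_finite_Union[of "F - G"] assms by auto
  have G: "\<Union>G \<subseteq> carrier P" using assms by blast
  have "stratum F G = zeros K n (\<Union>G) - zeros K n J"
  proof
    show "stratum F G \<subseteq> zeros K n (\<Union>G) - zeros K n J"
      unfolding J(2)[symmetric] stratum_def using assms(3) by (fastforce simp: zeros_def)
    show "zeros K n (\<Union>G) - zeros K n J \<subseteq> stratum F G"
    proof
      fix y assume y: "y \<in> zeros K n (\<Union>G) - zeros K n J"
      then have "y \<in> zeros K n T" if "T \<in> G" for T using that unfolding zeros_def by blast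
      then show "y \<in> stratum F G"
        using y unfolding J(2)[symmetric] stratum_def by (auto simp: zeros_def)
    qed
  qed
  then show ?thesis
    using zeros_genideal[OF G] P.genideal_ideal[OF G] J(1) unfolding locally_closed_def
    by (intro exI[of _ "Idl\<^bsub>P\<^esub> (\<Union>G)"] exI[of _ J]) simp
qed

end

lemma (in mpoly_field) squarefree_lead_monos_eqI:
  assumes I: "ideal I P" "squarefree_monos (lead_monos R I)" and J: "ideal J P" "squarefree_monos (lead_monos R J)"
    and eq: "{s \<in> Pow {1..n}. mset_set s \<in> lead_monos R I} = {s \<in> Pow {1..n}. mset_set s \<in> lead_monos R J}"
  shows "lead_monos R I = lead_monos R J"
proof -
  have "lead_monos R I = {m \<in> monomials n. set_mset m \<in> {s \<in> Pow {1..n}. mset_set s \<in> lead_monos R I}}"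
    if I: "ideal I P" and sq: "squarefree_monos (lead_monos R I)" for I
  proof (rule Set.set_eqI)
    fix m
    have "m \<in> lead_monos R I \<longleftrightarrow> mset_set (set_mset m) \<in> lead_monos R I" if "m \<in> monomials n"
      using that sq lead_monos_superset[OF I _ mset_set_set_mset_msubset, of m]
      unfolding squarefree_monos_def by blast
    then show "m \<in> lead_monos R I \<longleftrightarrow>
        m \<in> {m \<in> monomials n. set_mset m \<in> {s \<in> Pow {1..n}. mset_set s \<in> lead_monos R I}}"
      using lead_monos_monomials[OF I, of m] by (auto simp: monomials_def)
  qed
  from this[OF I] this[OF J] show ?thesis unfolding eq by (rule trans[OF _ sym])
qed

context lex_family
begin

text \<open>
  A squarefree set of leading monomials is determined by its squarefree members, and two ideals
  of the family with the same leading monomials coincide with their intersection.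
\<close>

lemma family_finite: "finite Is"
proof -
  let ?f = "\<lambda>I. {s \<in> Pow {1..n}. mset_set s \<in> lead_monos K I}"
  have sub: "I \<inter> J = I" if "I \<in> Is" "J \<in> Is" "?f I = ?f J" for I J
  proof (rule submodule_eqI)
    have "lead_monos K I = lead_monos K J"
      using that ideals squarefree by (intro squarefree_lead_monos_eqI) auto
    then show "lead_monos K I \<subseteq> lead_monos K (I \<inter> J)"
      using lead_monos_inter[OF ideals ideals squarefree[OF inter]] that by auto
  qed (use that ideals inter ideal_submodule in auto)
  have "inj_on ?f Is"
  proof (rule inj_onI)
    fix I J assume "I \<in> Is" "J \<in> Is" "?f I = ?f J"
    then show "I = J" using sub[of I J] sub[of J I] by (auto simp: Int_commute)
  qed
  moreover have "?f ` Is \<subseteq> Pow (Pow {1..n})" by auto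
  then have "finite (?f ` Is)" by (rule finite_subset) simp
  ultimately show ?thesis using finite_imageD by blast
qed

definition linear_part :: "(nat multiset \<Rightarrow> 'a) set \<Rightarrow> nat \<Rightarrow> nat set \<Rightarrow> (nat multiset \<Rightarrow> 'a) set" where
  "linear_part I i A = {mono_poly K \<one> {#i#} \<otimes>\<^bsub>P\<^esub> v \<oplus>\<^bsub>P\<^esub> v\<^sub>0 | v v\<^sub>0. companion I i A v v\<^sub>0}"

text \<open>
  A finite list of closed conditions that decide at every stage which ideals are active and
  whether the new coordinate vanishes.  On the points that satisfy exactly the same conditions
  the blocks are therefore constant.
\<close>

definition equations :: "(nat multiset \<Rightarrow> 'a) set set" where
  "equations = (\<lambda>i. {mono_poly K \<one> {#i#}}) ` {1..n} \<union>
    (\<lambda>(I, i, A). block_coeffs K n I (Suc i) A) ` (Is \<times> {1..n} \<times> Pow {1..n}) \<union>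
    (\<lambda>(I, i, A). linear_part I i A) ` (Is \<times> {1..n} \<times> Pow {1..n})"

lemma equations_finite: "finite equations"
  unfolding equations_def using family_finite by (intro finite_UnI finite_imageI finite_cartesian_product) auto

lemma equations_carrier: "T \<in> equations \<Longrightarrow> T \<subseteq> carrier P"
  unfolding equations_def linear_part_def companion_def block_coeffs_def by (auto simp: var_closed)

text \<open>
  Up to a factor \<open>v\<close>, every companion equation at \<open>y\<close> says that the shifted coordinate vanishes.
\<close>

lemma coord_zero_iff:
  assumes y: "y \<in> affine_space K n" and i: "i \<in> {1..n}" and A: "A \<subseteq> {..<i}" and act: "active I i A y"
  shows "y i \<oplus>\<^bsub>L\<^esub> shift i A y = \<zero>\<^bsub>L\<^esub> \<longleftrightarrow> y \<in> zeros K n (linear_part I i A)"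
proof -
  let ?s = "shift i A y"
  have I: "ideal I P" using act ideals by (simp add: active_def)
  have sL: "?s \<in> carrier L" by (rule shift_closed[OF y i A])
  have val_lin: "val (mono_poly K \<one> {#i#} \<otimes>\<^bsub>P\<^esub> v \<oplus>\<^bsub>P\<^esub> v\<^sub>0) y = (y i \<oplus>\<^bsub>L\<^esub> ?s) \<otimes>\<^bsub>L\<^esub> val v y"
    if c: "companion I i A v v\<^sub>0" for v v\<^sub>0
  proof -
    note cc = companion_closed[OF c]
    have "?s \<otimes>\<^bsub>L\<^esub> val v y = val v\<^sub>0 y"
      using shift_is_shift[OF y act i A] act c unfolding is_shift_def by blast
    then show ?thesis
      using cc y i var_closed[OF i] affine_coord[OF y i] sL by (simp add: val_add val_mult val_var L.l_distr)
  qed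
  obtain v where v: "v \<in> block_coeffs K n I (Suc i) (insert i A)" "val v y \<noteq> \<zero>\<^bsub>L\<^esub>"
    using act by (auto simp: active_def)
  obtain v\<^sub>0 where c: "companion I i A v v\<^sub>0" using companion_exists[OF I i A v(1)] .
  show ?thesis
  proof
    assume "y i \<oplus>\<^bsub>L\<^esub> ?s = \<zero>\<^bsub>L\<^esub>"
    then have "val (mono_poly K \<one> {#i#} \<otimes>\<^bsub>P\<^esub> v \<oplus>\<^bsub>P\<^esub> v\<^sub>0) y = \<zero>\<^bsub>L\<^esub>"
      if "companion I i A v v\<^sub>0" for v v\<^sub>0
      using val_lin[OF that] companion_closed[OF that] y by simp
    then show "y \<in> zeros K n (linear_part I i A)"
      using y unfolding zeros_def linear_part_def by blast
  next
    assume "y \<in> zeros K n (linear_part I i A)"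
    then have "val (mono_poly K \<one> {#i#} \<otimes>\<^bsub>P\<^esub> v \<oplus>\<^bsub>P\<^esub> v\<^sub>0) y = \<zero>\<^bsub>L\<^esub>"
      using c unfolding zeros_def linear_part_def by blast
    then show "y i \<oplus>\<^bsub>L\<^esub> ?s = \<zero>\<^bsub>L\<^esub>"
      using val_lin[OF c] v(2) companion_closed[OF c] y affine_coord[OF y i] sL by (simp add: L.integral_iff)
  qed
qed

lemma active_same:
  assumes xy: "x \<in> affine_space K n" "y \<in> affine_space K n"
    and same: "\<And>T. T \<in> equations \<Longrightarrow> x \<in> zeros K n T \<longleftrightarrow> y \<in> zeros K n T"
    and i: "i \<in> {1..n}" and A: "A \<subseteq> {1..n}"
  shows "active I i A x \<longleftrightarrow> active I i A y"
proof (cases "I \<in> Is")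
  case True
  have act: "active I i A z \<longleftrightarrow> z \<in> zeros K n (block_coeffs K n I (Suc i) A) \<and>
      z \<notin> zeros K n (block_coeffs K n I (Suc i) (insert i A))" if "z \<in> affine_space K n" for z
    using that True by (auto simp: active_def zeros_def)
  have "block_coeffs K n I (Suc i) B \<in> equations" if "B \<subseteq> {1..n}" for B
    unfolding equations_def using True i that by (intro UnI1 UnI2 image_eqI[of _ _ "(I, i, B)"]) auto
  then have "block_coeffs K n I (Suc i) A \<in> equations" "block_coeffs K n I (Suc i) (insert i A) \<in> equations"
    using A i by auto
  then show ?thesis using act xy same by simp
qed (simp add: active_def)

lemma nonzeros_same:
  assumes xy: "x \<in> affine_space K n" "y \<in> affine_space K n"
    and same: "\<And>T. T \<in> equations \<Longrightarrow> x \<in> zeros K n T \<longleftrightarrow> y \<in> zeros K n T"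
    and "j \<le> n"
  shows "nonzeros x j = nonzeros y j"
  using \<open>j \<le> n\<close>
proof (induction j)
  case (Suc j)
  let ?i = "Suc j" and ?A = "nonzeros y j"
  have IH: "nonzeros x j = ?A" using Suc by simp
  have i: "?i \<in> {1..n}" using Suc.prems by simp
  have A: "?A \<subseteq> {..<?i}" by (rule nonzeros_less)
  have A': "?A \<subseteq> {1..n}" using nonzeros_subset[of y j] Suc.prems by auto
  have "x ?i \<oplus>\<^bsub>L\<^esub> shift ?i ?A x = \<zero>\<^bsub>L\<^esub> \<longleftrightarrow> y ?i \<oplus>\<^bsub>L\<^esub> shift ?i ?A y = \<zero>\<^bsub>L\<^esub>"
  proof (cases "\<exists>I. active I ?i ?A y")
    case True
    then obtain I where act: "active I ?i ?A y" by blast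
    have "linear_part I ?i ?A \<in> equations"
      unfolding equations_def using act i A'
      by (intro UnI2 image_eqI[of _ _ "(I, ?i, ?A)"]) (auto simp: active_def)
    then show ?thesis
      using coord_zero_iff[OF xy(1) i A] coord_zero_iff[OF xy(2) i A] active_same[OF xy same i A'] act same
      by simp
  next
    case False
    have zero_iff: "z ?i = \<zero>\<^bsub>L\<^esub> \<longleftrightarrow> z \<in> zeros K n {mono_poly K \<one> {#?i#}}" if "z \<in> affine_space K n" for z
      using that val_var[OF that i] by (simp add: zeros_def)
    have "{mono_poly K \<one> {#?i#}} \<in> equations" unfolding equations_def using i by blast
    then have "x ?i = \<zero>\<^bsub>L\<^esub> \<longleftrightarrow> y ?i = \<zero>\<^bsub>L\<^esub>"
      using zero_iff[OF xy(1)] zero_iff[OF xy(2)] same by simp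
    moreover have "\<not> (\<exists>I. active I ?i ?A x)"
      using False active_same[OF xy same i A'] by simp
    ultimately show ?thesis
      using False affine_coord[OF xy(1) i] affine_coord[OF xy(2) i] by (simp add: shift_def)
  qed
  then show ?case using IH by simp
qed simp

text \<open>
  One slope \<open>v\<close> that does not vanish at \<open>x\<close> describes the map on all points of the stratum with
  \<open>v \<noteq> 0\<close>: the \<open>i\<close>-th coordinate of the image is \<open>(x\<^sub>i v + v\<^sub>0) / v\<close>.
\<close>

lemma degen_regular:
  "regular_on K n (stratum equations G) degen"
  unfolding regular_on_def
proof (intro ballI)
  fix i x assume i: "i \<in> {1..n}" and xS: "x \<in> stratum equations G"
  then have x: "x \<in> affine_space K n" by (simp add: stratum_def)
  let ?A = "nonzeros x (i - 1)" and ?x = "mono_poly K \<one> {#i#}"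
  have A: "?A \<subseteq> {..<i}" using nonzeros_less[of x "i - 1"] i by simp
  have A': "?A \<subseteq> {1..n}" using i by (intro order_trans[OF nonzeros_subset]) auto
  have stratum: "y \<in> affine_space K n" "nonzeros y (i - 1) = ?A" "\<And>I. active I i ?A y \<longleftrightarrow> active I i ?A x"
    if "y \<in> stratum equations G" for y
  proof -
    show y: "y \<in> affine_space K n" using that by (simp add: stratum_def)
    have same: "y \<in> zeros K n T \<longleftrightarrow> x \<in> zeros K n T" if "T \<in> equations" for T
      using that xS \<open>y \<in> stratum equations G\<close> by (simp add: stratum_def)
    show "nonzeros y (i - 1) = ?A" using i by (intro nonzeros_same[OF y x same]) auto
    show "active I i ?A y \<longleftrightarrow> active I i ?A x" for I by (rule active_same[OF y x same i A'])
  qed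
  have degen_i: "degen y i = y i \<oplus>\<^bsub>L\<^esub> shift i ?A y" if "y \<in> stratum equations G" for y
    using i stratum(2)[OF that] by (simp add: degen_def)
  show "\<exists>J g h. ideal J P \<and> x \<notin> zeros K n J \<and> g \<in> carrier P \<and> h \<in> carrier P \<and>
      (\<forall>y\<in>stratum equations G - zeros K n J. val h y \<noteq> \<zero>\<^bsub>L\<^esub> \<and> degen y i \<otimes>\<^bsub>L\<^esub> val h y = val g y)"
  proof (cases "\<exists>I. active I i ?A x")
    case True
    then obtain I where act: "active I i ?A x" by blast
    have I: "ideal I P" using act ideals by (simp add: active_def)
    obtain v where v: "v \<in> block_coeffs K n I (Suc i) (insert i ?A)" "val v x \<noteq> \<zero>\<^bsub>L\<^esub>"
      using act by (auto simp: active_def)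
    obtain v\<^sub>0 where c: "companion I i ?A v v\<^sub>0" using companion_exists[OF I i A v(1)] .
    note cc = companion_closed[OF c]
    let ?J = "Idl\<^bsub>P\<^esub> {v}" and ?g = "?x \<otimes>\<^bsub>P\<^esub> v \<oplus>\<^bsub>P\<^esub> v\<^sub>0"
    have J: "ideal ?J P" "zeros K n ?J = zeros K n {v}"
      using cc by (auto intro!: P.genideal_ideal zeros_genideal)
    have "val v y \<noteq> \<zero>\<^bsub>L\<^esub> \<and> degen y i \<otimes>\<^bsub>L\<^esub> val v y = val ?g y"
      if y: "y \<in> stratum equations G - zeros K n ?J" for y
    proof
      have ya: "y \<in> affine_space K n" and yS: "y \<in> stratum equations G" using y stratum by auto
      show "val v y \<noteq> \<zero>\<^bsub>L\<^esub>" using y ya unfolding J(2) by (auto simp: zeros_def)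
      have "active I i ?A y" using stratum(3)[OF yS] act by simp
      then have "shift i ?A y \<otimes>\<^bsub>L\<^esub> val v y = val v\<^sub>0 y"
        using shift_is_shift[OF ya _ i A] c unfolding is_shift_def by blast
      then show "degen y i \<otimes>\<^bsub>L\<^esub> val v y = val ?g y"
        unfolding degen_i[OF yS]
        using cc ya i var_closed[OF i] affine_coord[OF ya i] shift_closed[OF ya i A]
        by (simp add: val_add val_mult val_var L.l_distr)
    qed
    moreover have "x \<notin> zeros K n ?J" using v(2) unfolding J(2) by (auto simp: zeros_def)
    ultimately show ?thesis using J(1) cc var_closed[OF i]
      by (intro exI[of _ ?J] exI[of _ ?g] exI[of _ v]) auto
  next
    case False
    have "\<one>\<^bsub>P\<^esub> \<in> carrier P" "val \<one>\<^bsub>P\<^esub> x \<noteq> \<zero>\<^bsub>L\<^esub>"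
      using val_one[OF x] L.one_not_zero by auto
    then have "x \<notin> zeros K n (carrier P)" unfolding zeros_def by blast
    moreover have "val \<one>\<^bsub>P\<^esub> y \<noteq> \<zero>\<^bsub>L\<^esub> \<and> degen y i \<otimes>\<^bsub>L\<^esub> val \<one>\<^bsub>P\<^esub> y = val ?x y"
      if yS: "y \<in> stratum equations G" for y
    proof -
      have ya: "y \<in> affine_space K n" using stratum(1)[OF yS] .
      have "shift i ?A y = \<zero>\<^bsub>L\<^esub>" using False stratum(3)[OF yS] by (simp add: shift_def)
      then show ?thesis
        unfolding degen_i[OF yS] using affine_coord[OF ya i] by (simp add: val_one[OF ya] val_var[OF ya i])
    qed
    ultimately show ?thesis
      using P.oneideal x var_closed[OF i]
      by (intro exI[of _ "carrier P"] exI[of _ ?x] exI[of _ "\<one>\<^bsub>P\<^esub>"]) auto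
  qed
qed

theorem degen_constructible: "constructible_map K n degen"
  unfolding constructible_map_def
proof (intro conjI exI[of _ "stratum equations ` Pow equations"])
  show "degen \<in> affine_space K n \<rightarrow> affine_space K n" using degen_closed by blast
  show "finite (stratum equations ` Pow equations)" using equations_finite by simp
  show "disjoint (stratum equations ` Pow equations)"
    unfolding disjoint_def by (auto simp: stratum_def)
  show "\<Union> (stratum equations ` Pow equations) = affine_space K n"
  proof
    show "affine_space K n \<subseteq> \<Union> (stratum equations ` Pow equations)"
    proof
      fix y assume "y \<in> affine_space K n"
      then have "y \<in> stratum equations {T \<in> equations. y \<in> zeros K n T}" by (simp add: stratum_def)
      then show "y \<in> \<Union> (stratum equations ` Pow equations)"
        by (intro UnionI[OF imageI]) auto
    qed
  qed (auto simp: stratum_def)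
  show "\<forall>Z\<in>stratum equations ` Pow equations. locally_closed K n Z \<and> regular_on K n Z degen"
    using stratum_locally_closed[OF equations_finite equations_carrier] degen_regular by auto
qed

theorem simultaneous_degeneration:
  "\<exists>\<Phi>. constructible_map K n \<Phi> \<and> bij_betw \<Phi> (affine_space K n) (affine_space K n) \<and>
    (\<forall>I\<in>Is. \<Phi> ` zeros K n I \<subseteq> zeros K n (init_ideal K n lex_weighting I))"
  by (intro exI[of _ degen] conjI ballI image_subsetI degen_constructible degen_bij degen_in_init)

end

section \<open>The Frobenius map on polynomials over a prime field\<close>

lemma (in cring) binomial_expansion:
  assumes x: "x \<in> carrier R" and y: "y \<in> carrier R"
  shows "(x \<oplus> y) [^] (n::nat) = (\<Oplus>k\<in>{..n}. [(n choose k)] \<cdot>\<^bsub>R\<^esub> (x [^] k \<otimes> y [^] (n - k)))"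
proof (induction n)
  case (Suc n)
  define g where "g = (\<lambda>k. [(n choose k)] \<cdot>\<^bsub>R\<^esub> (x [^] k \<otimes> y [^] (Suc n - k)))"
  define h where "h = (\<lambda>k. [(n choose k)] \<cdot>\<^bsub>R\<^esub> (x [^] Suc k \<otimes> y [^] (n - k)))"
  define f where "f = (\<lambda>n k. [(n choose k)] \<cdot>\<^bsub>R\<^esub> (x [^] k \<otimes> y [^] (n - k)))"
  have c: "g k \<in> carrier R" "h k \<in> carrier R" "f j k \<in> carrier R" for j k
    using x y by (auto simp: g_def h_def f_def)
  have xf: "f n k \<otimes> x = h k" for k
    using x y add_pow_ldistr[of "x [^] k \<otimes> y [^] (n - k)" x "n choose k"]
    by (simp add: f_def h_def m_ac)
  have yf: "f n k \<otimes> y = g k" if "k \<le> n" for k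
    using x y add_pow_ldistr[of "x [^] k \<otimes> y [^] (n - k)" y "n choose k"] that
    by (simp add: f_def g_def m_ac Suc_diff_le)
  have f0: "f (Suc n) 0 = g 0" by (simp add: f_def g_def)
  have fSuc: "f (Suc n) (Suc k) = h k \<oplus> g (Suc k)" for k
    using x y add.nat_pow_mult[of "x [^] Suc k \<otimes> y [^] (n - k)" "n choose k" "n choose Suc k"]
    by (simp add: f_def g_def h_def)
  have gS: "g (Suc n) = \<zero>" using x y by (simp add: g_def binomial_eq_0)
  have "(\<Oplus>k\<in>{..Suc n}. f (Suc n) k) = (\<Oplus>k\<in>{..n}. h k \<oplus> g (Suc k)) \<oplus> g 0"
    using c by (subst finsum_Suc2) (auto simp: fSuc f0)
  also have "\<dots> = (\<Oplus>k\<in>{..n}. h k) \<oplus> ((\<Oplus>k\<in>{..n}. g (Suc k)) \<oplus> g 0)"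
    using c by (simp add: finsum_addf a_assoc)
  also have "(\<Oplus>k\<in>{..n}. g (Suc k)) \<oplus> g 0 = (\<Oplus>k\<in>{..Suc n}. g k)"
    using c by (intro finsum_Suc2[symmetric]) auto
  also have "\<dots> = (\<Oplus>k\<in>{..n}. g k)"
    using c gS by (subst finsum_Suc) auto
  also have "(\<Oplus>k\<in>{..n}. g k) = (\<Oplus>k\<in>{..n}. f n k \<otimes> y)"
    using c yf by (intro finsum_cong') auto
  also have "(\<Oplus>k\<in>{..n}. h k) = (\<Oplus>k\<in>{..n}. f n k \<otimes> x)"
    using c xf by (intro finsum_cong') auto
  also have "(\<Oplus>k\<in>{..n}. f n k \<otimes> x) \<oplus> (\<Oplus>k\<in>{..n}. f n k \<otimes> y) = (\<Oplus>k\<in>{..n}. f n k) \<otimes> (x \<oplus> y)"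
    using c x y finsum_ldistr[of "{..n}" x "f n"] finsum_ldistr[of "{..n}" y "f n"]
    by (simp add: r_distr)
  also have "\<dots> = (x \<oplus> y) [^] Suc n"
    using Suc.IH by (simp add: f_def)
  finally show ?case by (simp add: f_def)
qed simp

lemma (in cring) freshmans_dream:
  assumes p: "Factorial_Ring.prime (p::nat)" and char: "[p] \<cdot>\<^bsub>R\<^esub> \<one> = \<zero>"
    and x: "x \<in> carrier R" and y: "y \<in> carrier R"
  shows "(x \<oplus> y) [^] p = x [^] p \<oplus> y [^] p"
proof -
  obtain q where q: "p = Suc q" using p prime_gt_0_nat gr0_implies_Suc by blast
  define f where "f = (\<lambda>k. [(p choose k)] \<cdot>\<^bsub>R\<^esub> (x [^] k \<otimes> y [^] (p - k)))"
  have c: "f k \<in> carrier R" for k using x y by (simp add: f_def)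
  have zero: "f k = \<zero>" if "0 < k" "k < p" for k
  proof -
    let ?z = "x [^] k \<otimes> y [^] (p - k)"
    have "p dvd (p choose k)" using p that by (intro dvd_choose_prime) auto
    then obtain j where j: "p choose k = p * j" by blast
    have "[p] \<cdot>\<^bsub>R\<^esub> ?z = ([p] \<cdot>\<^bsub>R\<^esub> \<one>) \<otimes> ?z"
      using x y add_pow_ldistr[of \<one> ?z p] by simp
    then have "[p] \<cdot>\<^bsub>R\<^esub> ?z = \<zero>" using char x y by simp
    then show ?thesis
      using x y add.nat_pow_pow[of ?z j p] by (simp add: f_def j)
  qed
  have "(x \<oplus> y) [^] p = (\<Oplus>k\<in>{..Suc q}. f k)"
    using binomial_expansion[OF x y, of p] by (simp add: f_def q)
  also have "\<dots> = f (Suc q) \<oplus> (\<Oplus>k\<in>{..q}. f k)"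
    using c by (intro finsum_Suc) auto
  also have "(\<Oplus>k\<in>{..q}. f k) = (\<Oplus>k\<in>{0}. f k)"
    using c zero q by (intro add.finprod_mono_neutral_cong_right) auto
  finally show ?thesis using x y by (simp add: f_def q)
qed

locale frobenius =
  fixes p n :: nat
  assumes prime: "Factorial_Ring.prime p"
begin

abbreviation K where "K \<equiv> Fp p"

lemma residues_prime: "residues_prime p"
  using prime by (simp add: residues_prime_def)

end

sublocale frobenius \<subseteq> mpoly_points K n
  by (intro mpoly_points.intro mpoly_field.intro residues_prime.is_field residues_prime)

context frobenius
begin

lemma p_pos: "p > 0"
  using prime prime_gt_0_nat by blast

lemma Fp_simps:
  "carrier K = {0..int p - 1}" "x \<otimes>\<^bsub>K\<^esub> y = x * y mod int p" "x \<oplus>\<^bsub>K\<^esub> y = (x + y) mod int p"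
  "\<zero>\<^bsub>K\<^esub> = 0" "\<one>\<^bsub>K\<^esub> = 1"
  by (auto simp: residue_ring_def)

lemma residues: "residues (int p)"
  using prime prime_gt_1_nat by (simp add: residues_def)

lemma mod_closed: "a mod int p \<in> carrier K"
  using residues.mod_in_carrier[OF residues] .

lemma mod_carrier: "a \<in> carrier K \<Longrightarrow> a mod int p = a"
  by (simp add: Fp_simps)

lemma Fp_pow_p: "a \<in> carrier K \<Longrightarrow> a [^]\<^bsub>K\<^esub> p = a"
proof -
  assume a: "a \<in> carrier K"
  define b where "b = nat a"
  have ab: "a = int b" "b < p" using a by (auto simp: b_def Fp_simps)
  have "[b ^ p = b] (mod p)"
  proof (cases "b = 0")
    case True
    then show ?thesis using p_pos by (simp add: zero_power)
  next
    case False
    then have "\<not> p dvd b" using ab(2) nat_dvd_not_less by blast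
    then have "[b * b ^ (p - 1) = b * 1] (mod p)"
      using fermat_theorem[OF prime] by (intro cong_mult cong_refl)
    then show ?thesis using p_pos by (metis mult.right_neutral power_eq_if not_gr_zero)
  qed
  then have "a ^ p mod int p = a mod int p"
    unfolding ab(1) by (metis cong_def of_nat_mod of_nat_power)
  then show ?thesis
    using residues.pow_cong[OF residues, of a p] mod_carrier[OF a] by simp
qed

lemma Fp_char: "[k] \<cdot>\<^bsub>K\<^esub> \<one>\<^bsub>K\<^esub> = int k mod int p"
proof (induction k)
  case (Suc k)
  then show ?case by (simp add: Fp_simps mod_simps add.commute)
qed (simp add: Fp_simps)

text \<open>
  The multiples of the unit are computed in the constant term.
\<close>

lemma mpoly_char: "[p] \<cdot>\<^bsub>P\<^esub> \<one>\<^bsub>P\<^esub> = \<zero>\<^bsub>P\<^esub>"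
proof -
  have "[k] \<cdot>\<^bsub>P\<^esub> \<one>\<^bsub>P\<^esub> = mono_poly K ([k] \<cdot>\<^bsub>K\<^esub> \<one>\<^bsub>K\<^esub>) {#}" for k :: nat
  proof (induction k)
    case 0
    then show ?case by (simp add: mpoly_zero mono_poly_def)
  next
    case (Suc k)
    then show ?case by (simp add: mpoly_one mpoly_add mono_poly_def fun_eq_iff)
  qed
  moreover have "[p] \<cdot>\<^bsub>K\<^esub> \<one>\<^bsub>K\<^esub> = \<zero>\<^bsub>K\<^esub>" unfolding Fp_char by (simp add: Fp_simps)
  ultimately show ?thesis by (simp add: mpoly_zero mono_poly_def fun_eq_iff)
qed

lemma frobenius_add:
  "g \<in> carrier P \<Longrightarrow> h \<in> carrier P \<Longrightarrow> (g \<oplus>\<^bsub>P\<^esub> h) [^]\<^bsub>P\<^esub> p = g [^]\<^bsub>P\<^esub> p \<oplus>\<^bsub>P\<^esub> h [^]\<^bsub>P\<^esub> p"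
  using P.freshmans_dream[OF prime mpoly_char] .

lemma mono_poly_pow:
  assumes "c \<in> carrier K" "m \<in> monomials n"
  shows "mono_poly K c m [^]\<^bsub>P\<^esub> (k::nat) = mono_poly K (c [^]\<^bsub>K\<^esub> k) (repeat_mset k m)"
proof (induction k)
  case (Suc k)
  then show ?case using assms by (simp add: mono_poly_mono_mult add.commute)
qed (simp add: mpoly_one)


section \<open>The trace map\<close>

abbreviation all_vars :: "nat multiset" where "all_vars \<equiv> mset_set {1..n}"

text \<open>
  The condition that \<open>m\<close> times all variables is the \<open>p\<close>-th power of \<open>m'\<close> times all variables reads
  \<open>m = p m' + (p - 1) (1, \<dots>, 1)\<close> in exponents.
\<close>

definition trace :: "(nat multiset \<Rightarrow> int) \<Rightarrow> (nat multiset \<Rightarrow> int)" where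
  "trace = (\<lambda>g\<in>carrier P. \<lambda>m. g (repeat_mset p m + repeat_mset (p - 1) all_vars))"

lemma repeat_mset_monomials: "k > 0 \<Longrightarrow> repeat_mset k m \<in> monomials n \<longleftrightarrow> m \<in> monomials n"
proof -
  assume "k > 0"
  then have "set_mset (repeat_mset k m) = set_mset m" by (auto simp flip: count_greater_zero_iff)
  then show ?thesis by (simp add: monomials_def)
qed

lemma trace_apply: "g \<in> carrier P \<Longrightarrow> trace g = (\<lambda>m. g (repeat_mset p m + repeat_mset (p - 1) all_vars))"
  by (simp add: trace_def)

lemma repeat_mset_cancel: "repeat_mset p a = repeat_mset p b \<longleftrightarrow> a = b"
  using p_pos by (auto simp: multiset_eq_iff)

lemma trace_closed: "g \<in> carrier P \<Longrightarrow> trace g \<in> carrier P"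
proof -
  assume g: "g \<in> carrier P"
  let ?e = "\<lambda>m. repeat_mset p m + repeat_mset (p - 1) all_vars"
  have inj: "inj ?e" using repeat_mset_cancel by (auto simp: inj_on_def)
  have "finite {m. g m \<noteq> \<zero>\<^bsub>K\<^esub>}" using g by (simp add: mpoly_carrier)
  then have "finite (?e -` {m. g m \<noteq> \<zero>\<^bsub>K\<^esub>})" using inj by (rule finite_vimageI)
  moreover have "m \<in> monomials n" if "g (?e m) \<noteq> \<zero>\<^bsub>K\<^esub>" for m
  proof -
    have "?e m \<in> monomials n" using g that unfolding mpoly_carrier by blast
    then show ?thesis using repeat_mset_monomials[OF p_pos] by simp
  qed
  ultimately show ?thesis
    using g unfolding trace_apply[OF g] by (auto simp: mpoly_carrier vimage_def)
qed

lemma trace_add: "g \<in> carrier P \<Longrightarrow> h \<in> carrier P \<Longrightarrow> trace (g \<oplus>\<^bsub>P\<^esub> h) = trace g \<oplus>\<^bsub>P\<^esub> trace h"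
  by (simp add: trace_apply mpoly_add mpoly_add_closed)

lemma trace_mono_mult:
  assumes c: "c \<in> carrier K" and m: "m \<in> monomials n" and b: "b \<in> carrier P"
  shows "trace (mono_poly K c m [^]\<^bsub>P\<^esub> p \<otimes>\<^bsub>P\<^esub> b) = mono_poly K c m \<otimes>\<^bsub>P\<^esub> trace b"
proof
  fix m'
  let ?w = "repeat_mset (p - 1) all_vars"
  have mp: "mono_poly K c m [^]\<^bsub>P\<^esub> p = mono_poly K c (repeat_mset p m)"
    using c m by (simp add: mono_poly_pow Fp_pow_p)
  have pm: "repeat_mset p m \<in> monomials n" using m repeat_mset_monomials p_pos by simp
  have pmc: "mono_poly K c (repeat_mset p m) \<otimes>\<^bsub>P\<^esub> b \<in> carrier P"
    using c pm b by (intro P.m_closed mono_poly_closed)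
  have sub: "repeat_mset p m \<subseteq># repeat_mset p m' + ?w \<longleftrightarrow> m \<subseteq># m'"
  proof -
    have "p * count m k \<le> p * count m' k + count ?w k \<longleftrightarrow> count m k \<le> count m' k" for k
    proof
      assume "p * count m k \<le> p * count m' k + count ?w k"
      moreover have "count ?w k < p" using p_pos by (auto simp: count_mset_set')
      ultimately have "p * count m k < p * Suc (count m' k)" by simp
      then show "count m k \<le> count m' k" using p_pos by (simp only: mult_less_cancel1 less_Suc_eq_le)
    qed (simp add: trans_le_add1)
    then show ?thesis by (simp add: subseteq_mset_def)
  qed
  have diff: "repeat_mset p m' + ?w - repeat_mset p m = repeat_mset p (m' - m) + ?w" if "m \<subseteq># m'"
  proof (rule multiset_eqI)
    fix k
    have "count m k \<le> count m' k" using that by (simp add: subseteq_mset_def)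
    then have "p * count m k \<le> p * count m' k" by simp
    then show "count (repeat_mset p m' + ?w - repeat_mset p m) k = count (repeat_mset p (m' - m) + ?w) k"
      by (simp add: diff_mult_distrib2)
  qed
  show "trace (mono_poly K c m [^]\<^bsub>P\<^esub> p \<otimes>\<^bsub>P\<^esub> b) m' = (mono_poly K c m \<otimes>\<^bsub>P\<^esub> trace b) m'"
    unfolding mp trace_apply[OF pmc]
    unfolding mono_poly_mult[OF c b] mono_poly_mult[OF c trace_closed[OF b]]
    unfolding sub trace_apply[OF b]
    using diff by simp
qed

text \<open>
  By additivity of the \<open>p\<close>-th power it suffices to consider a single term \<open>a\<close>, whose coefficient is
  its own \<open>p\<close>-th power.
\<close>

lemma trace_linear:
  assumes a: "a \<in> carrier P" and b: "b \<in> carrier P"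
  shows "trace (a [^]\<^bsub>P\<^esub> p \<otimes>\<^bsub>P\<^esub> b) = a \<otimes>\<^bsub>P\<^esub> trace b"
  using a
proof (induction rule: mpoly_induct)
  case zero
  have "\<zero>\<^bsub>P\<^esub> [^]\<^bsub>P\<^esub> p = \<zero>\<^bsub>P\<^esub>" using P.nat_pow_zero p_pos by simp
  moreover have "trace \<zero>\<^bsub>P\<^esub> = \<zero>\<^bsub>P\<^esub>"
    by (simp add: trace_apply) (simp add: mpoly_zero)
  ultimately show ?case using b trace_closed[OF b] unfolding mpoly_zero[of n, symmetric] by simp
next
  case (add c m g)
  have mc: "mono_poly K c m \<in> carrier P" using add.hyps by (intro mono_poly_closed)
  have "(mono_poly K c m \<oplus>\<^bsub>P\<^esub> g) [^]\<^bsub>P\<^esub> p \<otimes>\<^bsub>P\<^esub> b =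
      mono_poly K c m [^]\<^bsub>P\<^esub> p \<otimes>\<^bsub>P\<^esub> b \<oplus>\<^bsub>P\<^esub> g [^]\<^bsub>P\<^esub> p \<otimes>\<^bsub>P\<^esub> b"
    using mc add.hyps b by (simp add: frobenius_add P.l_distr)
  then have "trace ((mono_poly K c m \<oplus>\<^bsub>P\<^esub> g) [^]\<^bsub>P\<^esub> p \<otimes>\<^bsub>P\<^esub> b) = (mono_poly K c m \<oplus>\<^bsub>P\<^esub> g) \<otimes>\<^bsub>P\<^esub> trace b"
    using mc add.hyps add.IH b trace_closed[OF b] by (simp add: trace_add trace_mono_mult P.l_distr)
  then show ?case by (simp add: mpoly_add)
qed

lemma trace_near_splitting: "near_splitting p P trace"
  unfolding near_splitting_def
  using trace_closed trace_add trace_linear by (auto simp: trace_def)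

lemma trace_monomial:
  assumes m: "m \<in> monomials n"
  shows "m + all_vars = repeat_mset p q \<Longrightarrow>
      trace (mono_poly K \<one>\<^bsub>K\<^esub> m) = mono_poly K \<one>\<^bsub>K\<^esub> (q - all_vars)"
    and "\<nexists>q. m + all_vars = repeat_mset p q \<Longrightarrow> trace (mono_poly K \<one>\<^bsub>K\<^esub> m) = \<zero>\<^bsub>P\<^esub>"
proof -
  have tr: "trace (mono_poly K \<one>\<^bsub>K\<^esub> m) m' =
      (if m + all_vars = repeat_mset p (m' + all_vars) then \<one>\<^bsub>K\<^esub> else \<zero>\<^bsub>K\<^esub>)" for m'
  proof -
    have "repeat_mset p (m' + all_vars) = repeat_mset p m' + repeat_mset (p - 1) all_vars + all_vars"
      using p_pos by (auto simp: multiset_eq_iff algebra_simps count_mset_set')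
    then have "repeat_mset p m' + repeat_mset (p - 1) all_vars = m \<longleftrightarrow> m + all_vars = repeat_mset p (m' + all_vars)"
      by auto
    then show ?thesis using mono_poly_closed[OF one_closed m] by (simp add: trace_apply mono_poly_def)
  qed
  show "trace (mono_poly K \<one>\<^bsub>K\<^esub> m) = mono_poly K \<one>\<^bsub>K\<^esub> (q - all_vars)" if q: "m + all_vars = repeat_mset p q"
  proof -
    have "all_vars \<subseteq># q"
      unfolding subseteq_mset_def
    proof
      fix k show "count all_vars k \<le> count q k"
        using arg_cong[OF q, of "\<lambda>m. count m k"] by (cases "count q k") (auto simp: count_mset_set')
    qed
    then have "repeat_mset p q = repeat_mset p (m' + all_vars) \<longleftrightarrow> m' = q - all_vars" for m'
      unfolding repeat_mset_cancel by (metis add_diff_cancel_right' subset_mset.diff_add)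
    then show ?thesis by (intro ext) (simp only: tr q, simp only: mono_poly_def)
  qed
  show "trace (mono_poly K \<one>\<^bsub>K\<^esub> m) = \<zero>\<^bsub>P\<^esub>" if "\<nexists>q. m + all_vars = repeat_mset p q"
  proof
    fix m'
    have "m + all_vars \<noteq> repeat_mset p (m' + all_vars)" using that by blast
    then show "trace (mono_poly K \<one>\<^bsub>K\<^esub> m) m' = \<zero>\<^bsub>P\<^esub> m'" by (simp only: tr mpoly_zero if_False)
  qed
qed

text \<open>
  Scalars are \<open>p\<close>-th powers, so a near-splitting is linear over the prime field and determined by
  its values on monomials.
\<close>

lemma near_splitting_eqI:
  assumes \<phi>: "near_splitting p P \<phi>" and \<psi>: "near_splitting p P \<psi>"
    and eq: "\<And>m. m \<in> monomials n \<Longrightarrow> \<phi> (mono_poly K \<one>\<^bsub>K\<^esub> m) = \<psi> (mono_poly K \<one>\<^bsub>K\<^esub> m)"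
  shows "\<phi> = \<psi>"
proof
  have mono: "\<phi> (mono_poly K c m) = mono_poly K c {#} \<otimes>\<^bsub>P\<^esub> \<phi> (mono_poly K \<one>\<^bsub>K\<^esub> m)"
    if "near_splitting p P \<phi>" "c \<in> carrier K" "m \<in> monomials n" for \<phi> c m
  proof -
    have "mono_poly K c m = mono_poly K c {#} [^]\<^bsub>P\<^esub> p \<otimes>\<^bsub>P\<^esub> mono_poly K \<one>\<^bsub>K\<^esub> m"
      using that by (simp add: mono_poly_pow Fp_pow_p mono_poly_mono_mult)
    then show ?thesis
      using that mono_poly_closed[OF that(2) monomials_empty, of n] mono_poly_closed[OF one_closed that(3)]
      unfolding near_splitting_def by metis
  qed
  have van: "\<phi> (\<lambda>m. \<zero>\<^bsub>K\<^esub>) = (\<lambda>m. \<zero>\<^bsub>K\<^esub>)" if "near_splitting p P \<phi>" for \<phi>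
  proof -
    have "\<zero>\<^bsub>P\<^esub> = \<zero>\<^bsub>P\<^esub> [^]\<^bsub>P\<^esub> p \<otimes>\<^bsub>P\<^esub> \<zero>\<^bsub>P\<^esub>" by simp
    then have "\<phi> \<zero>\<^bsub>P\<^esub> = \<zero>\<^bsub>P\<^esub> \<otimes>\<^bsub>P\<^esub> \<phi> \<zero>\<^bsub>P\<^esub>"
      using that P.zero_closed unfolding near_splitting_def by metis
    moreover have "\<phi> \<zero>\<^bsub>P\<^esub> \<in> carrier P" using that P.zero_closed unfolding near_splitting_def by blast
    ultimately have "\<phi> \<zero>\<^bsub>P\<^esub> = \<zero>\<^bsub>P\<^esub>" by (metis P.l_null)
    then show ?thesis by (simp add: mpoly_zero)
  qed
  fix g show "\<phi> g = \<psi> g"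
  proof (cases "g \<in> carrier P")
    case True
    then show ?thesis
    proof (induction rule: mpoly_induct)
      case zero
      then show ?case using van[OF \<phi>] van[OF \<psi>] by simp
    next
      case (add c m g)
      have "mono_poly K c m \<in> carrier P" using add.hyps by (intro mono_poly_closed)
      then have split: "\<phi>' (mono_poly K c m \<oplus>\<^bsub>P\<^esub> g) = \<phi>' (mono_poly K c m) \<oplus>\<^bsub>P\<^esub> \<phi>' g"
        if "near_splitting p P \<phi>'" for \<phi>'
        using that add.hyps(4) unfolding near_splitting_def by blast
      have "\<phi> (mono_poly K c m) = \<psi> (mono_poly K c m)"
        unfolding mono[OF \<phi> add.hyps(1,3)] mono[OF \<psi> add.hyps(1,3)] eq[OF add.hyps(3)] ..
      then have "\<phi> (mono_poly K c m \<oplus>\<^bsub>P\<^esub> g) = \<psi> (mono_poly K c m \<oplus>\<^bsub>P\<^esub> g)"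
        unfolding split[OF \<phi>] split[OF \<psi>] add.IH by simp
      then show ?case unfolding mpoly_add .
    qed
  next
    case False
    have "\<phi> \<in> extensional (carrier P)" "\<psi> \<in> extensional (carrier P)"
      using \<phi> \<psi> unfolding near_splitting_def by (auto simp: PiE_def)
    then show ?thesis using False by (simp add: extensional_def)
  qed
qed

lemma Tr_eq: "Tr p n = trace"
  unfolding Tr_def
proof (rule the_equality)
  show "near_splitting p P trace \<and>
       (\<forall>m. set_mset m \<subseteq> {1..n} \<longrightarrow>
          (\<forall>q. m + all_vars = repeat_mset p q \<longrightarrow>
             trace (mono_poly K \<one>\<^bsub>K\<^esub> m) = mono_poly K \<one>\<^bsub>K\<^esub> (q - all_vars)) \<and>
          ((\<nexists>q. m + all_vars = repeat_mset p q) \<longrightarrow>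
             trace (mono_poly K \<one>\<^bsub>K\<^esub> m) = \<zero>\<^bsub>P\<^esub>))"
    using trace_near_splitting trace_monomial unfolding monomials_def by blast
  fix \<phi> assume \<phi>: "near_splitting p P \<phi> \<and>
       (\<forall>m. set_mset m \<subseteq> {1..n} \<longrightarrow>
          (\<forall>q. m + all_vars = repeat_mset p q \<longrightarrow>
             \<phi> (mono_poly K \<one>\<^bsub>K\<^esub> m) = mono_poly K \<one>\<^bsub>K\<^esub> (q - all_vars)) \<and>
          ((\<nexists>q. m + all_vars = repeat_mset p q) \<longrightarrow>
             \<phi> (mono_poly K \<one>\<^bsub>K\<^esub> m) = \<zero>\<^bsub>P\<^esub>))"
  show "\<phi> = trace"
  proof (rule near_splitting_eqI)
    fix m assume m: "m \<in> monomials n"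
    show "\<phi> (mono_poly K \<one>\<^bsub>K\<^esub> m) = trace (mono_poly K \<one>\<^bsub>K\<^esub> m)"
      using \<phi> trace_monomial[OF m] m unfolding monomials_def
      by (cases "\<exists>q. m + all_vars = repeat_mset p q") auto
  qed (use \<phi> trace_near_splitting in auto)
qed

text \<open>
  The exponent map \<open>m \<mapsto> p m + (p - 1) (1, \<dots>, 1)\<close> is strictly increasing.
\<close>

lemma lead_at_trace:
  assumes g: "g \<in> carrier P" and lead: "lead_at K g (repeat_mset p a + repeat_mset (p - 1) all_vars)"
  shows "lead_at K (trace g) a"
  using lead lex_repeat_mset[OF _ p_pos] unfolding lead_at_def trace_apply[OF g] by simp

definition twisted_trace :: "(nat multiset \<Rightarrow> int) \<Rightarrow> (nat multiset \<Rightarrow> int) \<Rightarrow> (nat multiset \<Rightarrow> int)" where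
  "twisted_trace F g = trace (F [^]\<^bsub>P\<^esub> (p - 1) \<otimes>\<^bsub>P\<^esub> g)"

lemma split_mod_iff:
  "split_mod p n f I \<longleftrightarrow> ideal I P \<and> (\<forall>g\<in>I. twisted_trace (mod_poly p f) g \<in> I)"
  unfolding split_mod_def compatible_def Let_def Tr_eq twisted_trace_def by auto

context
  fixes F assumes F: "F \<in> carrier P"
begin

lemma twisted_trace_closed: "g \<in> carrier P \<Longrightarrow> twisted_trace F g \<in> carrier P"
  unfolding twisted_trace_def using F by (intro trace_closed) auto

lemma twisted_trace_add:
  "g \<in> carrier P \<Longrightarrow> h \<in> carrier P \<Longrightarrow> twisted_trace F (g \<oplus>\<^bsub>P\<^esub> h) = twisted_trace F g \<oplus>\<^bsub>P\<^esub> twisted_trace F h"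
  unfolding twisted_trace_def using F by (simp add: P.r_distr trace_add)

lemma twisted_trace_linear:
  assumes "a \<in> carrier P" "g \<in> carrier P"
  shows "twisted_trace F (a [^]\<^bsub>P\<^esub> p \<otimes>\<^bsub>P\<^esub> g) = a \<otimes>\<^bsub>P\<^esub> twisted_trace F g"
proof -
  have "F [^]\<^bsub>P\<^esub> (p - 1) \<otimes>\<^bsub>P\<^esub> (a [^]\<^bsub>P\<^esub> p \<otimes>\<^bsub>P\<^esub> g) = a [^]\<^bsub>P\<^esub> p \<otimes>\<^bsub>P\<^esub> (F [^]\<^bsub>P\<^esub> (p - 1) \<otimes>\<^bsub>P\<^esub> g)"
    using F assms by (intro P.m_lcomm) auto
  then show ?thesis unfolding twisted_trace_def using F assms by (simp add: trace_linear)
qed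

lemma twisted_trace_principal:
  assumes "g \<in> carrier P"
  shows "twisted_trace F (g \<otimes>\<^bsub>P\<^esub> F) = F \<otimes>\<^bsub>P\<^esub> trace g"
proof -
  have "F [^]\<^bsub>P\<^esub> (p - 1) \<otimes>\<^bsub>P\<^esub> (g \<otimes>\<^bsub>P\<^esub> F) = (F [^]\<^bsub>P\<^esub> (p - 1) \<otimes>\<^bsub>P\<^esub> F) \<otimes>\<^bsub>P\<^esub> g"
    using F assms by (simp add: P.m_ac)
  also have "F [^]\<^bsub>P\<^esub> (p - 1) \<otimes>\<^bsub>P\<^esub> F = F [^]\<^bsub>P\<^esub> p"
    using p_pos P.nat_pow_Suc[of F "p - 1"] by simp
  finally show ?thesis unfolding twisted_trace_def using trace_linear[OF F assms] by simp
qed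

text \<open>
  If \<open>g \<in> I\<close> has leading monomial \<open>a\<^sup>p\<close>, multiply it with the \<open>(p-1)\<close>-st powers of \<open>F\<close> and of the
  variables missing from the leading monomial of \<open>F\<close>.  The leading exponent becomes
  \<open>p a + (p - 1) (1, \<dots>, 1)\<close>, so the trace is an element of \<open>I\<close> with leading monomial \<open>a\<close>.
\<close>

lemma trace_stable_squarefree:
  assumes S: "S \<subseteq> {1..n}" and lead: "lead_at K F (mset_set S)"
    and I: "ideal I P" and stable: "\<And>g. g \<in> I \<Longrightarrow> twisted_trace F g \<in> I"
  shows "squarefree_monos (lead_monos K I)"
proof -
  let ?w' = "mset_set ({1..n} - S)"
  have w: "all_vars = mset_set S + ?w'"
    using S mset_set_Union[of S "{1..n} - S"] finite_subset[OF S] by (simp add: Un_absorb1)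
  have w'm: "repeat_mset (p - 1) ?w' \<in> monomials n"
  proof (cases "p - 1")
    case (Suc k)
    then show ?thesis using repeat_mset_monomials[of "p - 1" ?w'] by (simp add: monomials_def)
  qed simp
  have root: "a \<in> lead_monos K I" if pa: "repeat_mset p a \<in> lead_monos K I" for a
  proof -
    obtain g where g: "g \<in> I" "lead_at K g (repeat_mset p a)" using pa by (auto simp: lead_monos_def)
    have gc: "g \<in> carrier P" using g ideal_carrier[OF I] by blast
    define x where "x = mono_poly K \<one>\<^bsub>K\<^esub> (repeat_mset (p - 1) ?w')"
    have xc: "x \<in> carrier P" unfolding x_def using w'm by (intro mono_poly_closed) auto
    have xg: "x \<otimes>\<^bsub>P\<^esub> g \<in> I" using ideal.I_l_closed[OF I g(1) xc] .
    have "lead_at K (x \<otimes>\<^bsub>P\<^esub> g) (repeat_mset (p - 1) ?w' + repeat_mset p a)"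
      unfolding x_def using gc g w'm by (intro lead_at_mono_mult) auto
    then have "lead_at K (F [^]\<^bsub>P\<^esub> (p - 1) \<otimes>\<^bsub>P\<^esub> (x \<otimes>\<^bsub>P\<^esub> g))
        (repeat_mset (p - 1) (mset_set S) + (repeat_mset (p - 1) ?w' + repeat_mset p a))"
      using F xc gc lead by (intro lead_at_mult(1)[of _ "x \<otimes>\<^bsub>P\<^esub> g"] lead_at_pow(1)) auto
    also have "repeat_mset (p - 1) (mset_set S) + (repeat_mset (p - 1) ?w' + repeat_mset p a) =
        repeat_mset p a + repeat_mset (p - 1) all_vars"
      unfolding w by (simp add: ac_simps)
    finally have "lead_at K (twisted_trace F (x \<otimes>\<^bsub>P\<^esub> g)) a"
      unfolding twisted_trace_def using F xc gc by (intro lead_at_trace) auto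
    then show ?thesis using stable[OF xg] by (auto simp: lead_monos_def)
  qed
  show ?thesis
    unfolding squarefree_monos_def
  proof
    fix m assume m: "m \<in> lead_monos K I"
    let ?s = "mset_set (set_mset m)"
    have mm: "m \<in> monomials n" using lead_monos_monomials[OF I m] .
    then have sm: "?s \<in> monomials n" by (simp add: monomials_def)
    have "repeat_mset (p ^ e) ?s \<in> lead_monos K I \<Longrightarrow> ?s \<in> lead_monos K I" for e
    proof (induction e)
      case (Suc e)
      then show ?case using root[of "repeat_mset (p ^ e) ?s"] by simp
    qed simp
    \<comment> \<open>No exponent of \<open>m\<close> exceeds its degree, which is less than \<open>p\<close> to the power of the degree.\<close>
    moreover have "m \<subseteq># repeat_mset (p ^ size m) ?s"
      unfolding subseteq_mset_def
    proof
      fix k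
      have "size m < p ^ size m" using prime prime_gt_1_nat power_gt_expt by simp
      moreover have "count m k \<le> size m" by (rule count_le_size)
      ultimately show "count m k \<le> count (repeat_mset (p ^ size m) ?s) k"
        by (cases "k \<in># m") (auto simp: not_in_iff)
    qed
    then have "repeat_mset (p ^ size m) ?s \<in> lead_monos K I"
      using sm repeat_mset_monomials[of "p ^ size m"] p_pos by (intro lead_monos_superset[OF I m]) auto
    ultimately show "?s \<in> lead_monos K I" by blast
  qed
qed

end

end

section \<open>Dickson's lemma\<close>

text \<open>
  A nonincreasing sequence of natural numbers is constant from its minimum on.
\<close>

lemma nat_mono_subseq:
  fixes f :: "nat \<Rightarrow> nat"
  obtains r :: "nat \<Rightarrow> nat" where "strict_mono r" "mono (\<lambda>i. f (r i))"
proof -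
  obtain r where r: "strict_mono r" "monoseq (\<lambda>i. f (r i))" using seq_monosub by blast
  show ?thesis
  proof (cases "incseq (\<lambda>i. f (r i))")
    case True
    then show ?thesis using r(1) that by blast
  next
    case False
    then have dec: "\<And>i j. i \<le> j \<Longrightarrow> f (r j) \<le> f (r i)"
      using r(2) by (auto simp: monoseq_iff decseq_def)
    obtain N where N: "\<And>i. f (r N) \<le> f (r i)"
      using ex_has_least_nat[of "\<lambda>_. True" 0 "\<lambda>i. f (r i)"] by auto
    have "f (r (N + i)) = f (r N)" for i
      using dec[of N "N + i"] N[of "N + i"] by simp
    moreover have "strict_mono (\<lambda>i. r (N + i))" using r(1) by (simp add: strict_mono_def)
    ultimately show ?thesis using that[of "\<lambda>i. r (N + i)"] by (simp add: monoI)
  qed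
qed

text \<open>
  Pass to subsequences along which the exponents of \<open>x\<^sub>1\<close>, then those of \<open>x\<^sub>2\<close>, and so on, do not
  decrease.
\<close>

lemma dickson_sequence:
  fixes s :: "nat \<Rightarrow> nat multiset"
  assumes "\<And>i. s i \<in> monomials n"
  shows "\<exists>i j. i < j \<and> s i \<subseteq># s j"
proof -
  have "\<exists>r :: nat \<Rightarrow> nat. strict_mono r \<and> (\<forall>l\<in>{1..k}. mono (\<lambda>i. count (s (r i)) l))" for k
  proof (induction k)
    case 0
    show ?case by (intro exI[of _ id]) (auto simp: strict_mono_def)
  next
    case (Suc k)
    then obtain r :: "nat \<Rightarrow> nat" where r: "strict_mono r" "\<forall>l\<in>{1..k}. mono (\<lambda>i. count (s (r i)) l)" by blast
    obtain q :: "nat \<Rightarrow> nat" where q: "strict_mono q" "mono (\<lambda>i. count (s (r (q i))) (Suc k))"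
      by (rule nat_mono_subseq[of "\<lambda>i. count (s (r i)) (Suc k)"])
    have "mono (\<lambda>i. count (s (r (q i))) l)" if "l \<in> {1..Suc k}" for l
    proof (cases "l = Suc k")
      case False
      then have "mono (\<lambda>i. count (s (r i)) l)" using r(2) that by auto
      then show ?thesis using strict_mono_mono[OF q(1)] by (auto simp: mono_def)
    qed (use q in simp)
    then show ?case
      using strict_mono_o[OF r(1) q(1)] by (intro exI[of _ "\<lambda>i. r (q i)"]) (auto simp: o_def)
  qed
  then obtain r :: "nat \<Rightarrow> nat" where r: "strict_mono r" "\<forall>l\<in>{1..n}. mono (\<lambda>i. count (s (r i)) l)" by blast
  have "s (r 0) \<subseteq># s (r 1)"
    unfolding subseteq_mset_def
  proof
    fix l show "count (s (r 0)) l \<le> count (s (r 1)) l"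
    proof (cases "l \<in> {1..n}")
      case True
      then show ?thesis using r(2) by (auto simp: mono_def)
    next
      case False
      then have "l \<notin># s (r 0)" using assms[of "r 0"] by (auto simp: monomials_def)
      then show ?thesis by (simp add: not_in_iff)
    qed
  qed
  moreover have "r 0 < r 1" using r(1) by (simp add: strict_mono_def)
  ultimately show ?thesis by blast
qed

text \<open>
  The minimal elements form an antichain.
\<close>

lemma dickson:
  assumes "A \<subseteq> monomials n"
  obtains B where "finite B" "B \<subseteq> A" "\<forall>m\<in>A. \<exists>b\<in>B. b \<subseteq># m"
proof
  let ?B = "{b \<in> A. \<forall>a\<in>A. a \<subseteq># b \<longrightarrow> a = b}"
  show "?B \<subseteq> A" by blast
  have "\<exists>b\<in>?B. b \<subseteq># m" if "m \<in> A" for m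
    using that
  proof (induction "size m" arbitrary: m rule: less_induct)
    case less
    show ?case
    proof (cases "m \<in> ?B")
      case False
      then obtain a where a: "a \<in> A" "a \<subseteq># m" "a \<noteq> m" using less.prems by blast
      then have "size a < size m" by (simp add: mset_subset_size subset_mset.less_le)
      then obtain b where "b \<in> ?B" "b \<subseteq># a" using less.hyps a(1) by blast
      then show ?thesis using a(2) subset_mset.order_trans by blast
    qed blast
  qed
  then show "\<forall>m\<in>A. \<exists>b\<in>?B. b \<subseteq># m" by blast
  show "finite ?B"
  proof (rule ccontr)
    assume "infinite ?B"
    then obtain s :: "nat \<Rightarrow> nat multiset" where s: "inj s" "range s \<subseteq> ?B"
      using infinite_countable_subset by blast
    have "\<And>i. s i \<in> monomials n" using s(2) assms by blast
    from dickson_sequence[OF this] obtain i j where ij: "i < j" "s i \<subseteq># s j" by blast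
    then have "s i = s j" using s(2) by blast
    then show False using s(1) ij(1) by (simp add: inj_eq)
  qed
qed


section \<open>Images of ideals and minimal primes\<close>

lemma (in ring_hom_cring) surj_image_ideal:
  assumes surj: "h ` carrier R = carrier S" and I: "ideal I R"
  shows "ideal (h ` I) S"
proof (rule idealI[OF S.ring_axioms])
  interpret I: ideal I R by (rule I)
  show "subgroup (h ` I) (add_monoid S)"
  proof (rule S.add.subgroupI)
    show "h ` I \<noteq> {}" using I.zero_closed by blast
    fix a b assume "a \<in> h ` I" "b \<in> h ` I"
    then obtain x y where x: "x \<in> I" "a = h x" and y: "y \<in> I" "b = h y" by blast
    show "\<ominus>\<^bsub>S\<^esub> a \<in> h ` I"
      using x hom_a_inv[OF I.Icarr[OF x(1)]] I.a_inv_closed[OF x(1)] by (metis image_eqI)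
    show "a \<oplus>\<^bsub>S\<^esub> b \<in> h ` I"
      using x y hom_add[OF I.Icarr[OF x(1)] I.Icarr[OF y(1)]] I.a_closed[OF x(1) y(1)] by (metis image_eqI)
  qed (use I.Icarr in auto)
  fix a z assume "a \<in> h ` I" "z \<in> carrier S"
  then obtain x w where x: "x \<in> I" "a = h x" and w: "w \<in> carrier R" "z = h w" using surj by blast
  show "z \<otimes>\<^bsub>S\<^esub> a \<in> h ` I"
    using x w hom_mult[OF w(1) I.Icarr[OF x(1)]] I.I_l_closed[OF x(1) w(1)] by (metis image_eqI)
  show "a \<otimes>\<^bsub>S\<^esub> z \<in> h ` I"
    using x w hom_mult[OF I.Icarr[OF x(1)] w(1)] I.I_r_closed[OF x(1) w(1)] by (metis image_eqI)
qed

lemma (in ring) genideal_of_ideal: "ideal I R \<Longrightarrow> Idl I = I"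
  using genideal_minimal[of I I] genideal_self[of I] ideal.Icarr by (metis order_refl subset_antisym subsetI)

text \<open>
  Localisation at a minimal prime over \<open>I\<close> makes its elements nilpotent modulo \<open>I\<close>.  If no
  \<open>a x\<^sup>k\<close> with \<open>a \<notin> P\<close> were in \<open>I\<close>, an ideal maximal among those that contain \<open>I\<close> and no such
  element would be a prime below \<open>P\<close> without \<open>x\<close>.
\<close>

lemma (in cring) minimal_prime_nilpotent:
  assumes I: "ideal I R" and P: "minimal_prime_over R I P" and x: "x \<in> P"
  shows "\<exists>a\<in>carrier R - P. \<exists>k::nat. a \<otimes> x [^] k \<in> I"
proof (rule ccontr)
  assume neg: "\<not> ?thesis"
  have prime: "primeideal P R" and IP: "I \<subseteq> P"
    and min: "\<And>Q. primeideal Q R \<Longrightarrow> I \<subseteq> Q \<Longrightarrow> Q \<subseteq> P \<Longrightarrow> Q = P"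
    using P by (auto simp: minimal_prime_over_def)
  interpret P: primeideal P R by (rule prime)
  have xc: "x \<in> carrier R" using P.Icarr[OF x] .
  \<comment> \<open>The multiplicative set generated by \<open>x\<close> and the complement of \<open>P\<close>.\<close>
  define S where "S = {a \<otimes> x [^] k | a k. a \<in> carrier R - P \<and> (k::nat) \<in> UNIV}"
  have one: "\<one> \<notin> P" using P.one_imp_carrier P.I_notcarr by blast
  have S_mem: "a \<otimes> x [^] (k::nat) \<in> S" if "a \<in> carrier R" "a \<notin> P" for a k
    using that unfolding S_def by blast
  have S_mult: "s \<otimes> t \<in> S" if st: "s \<in> S" "t \<in> S" for s t
  proof -
    obtain a k b l where a: "a \<in> carrier R" "a \<notin> P" "s = a \<otimes> x [^] (k::nat)"
      and b: "b \<in> carrier R" "b \<notin> P" "t = b \<otimes> x [^] (l::nat)"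
      using st unfolding S_def by blast
    have "s \<otimes> t = (a \<otimes> b) \<otimes> x [^] (k + l)"
      using a b xc by (simp add: nat_pow_mult[symmetric] m_ac)
    moreover have "a \<otimes> b \<notin> P" using P.I_prime[OF a(1) b(1)] a b by blast
    ultimately show ?thesis using S_mem[of "a \<otimes> b" "k + l"] a b by simp
  qed
  define \<A> where "\<A> = {J. ideal J R \<and> I \<subseteq> J \<and> J \<inter> S = {}}"
  have "I \<in> \<A>" using I neg unfolding \<A>_def S_def by blast
  have "\<exists>M\<in>\<A>. \<forall>J\<in>\<A>. M \<subseteq> J \<longrightarrow> J = M"
  proof (rule subset_Zorn_nonempty)
    show "\<A> \<noteq> {}" using \<open>I \<in> \<A>\<close> by blast
    fix C assume C: "C \<noteq> {}" "subset.chain \<A> C"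
    then have "subset.chain {J. ideal J R} C" by (auto simp: pred_on.chain_def \<A>_def)
    then have "ideal (\<Union>C) R" using chain_Union_is_ideal[of C] C(1) by simp
    then show "\<Union>C \<in> \<A>" using C unfolding \<A>_def pred_on.chain_def by blast
  qed
  then obtain M where M: "M \<in> \<A>" "\<And>J. J \<in> \<A> \<Longrightarrow> M \<subseteq> J \<Longrightarrow> J = M" by blast
  have Mi: "ideal M R" and IM: "I \<subseteq> M" and MS: "M \<inter> S = {}" using M(1) by (auto simp: \<A>_def)
  interpret M: ideal M R by (rule Mi)
  have meet: "\<exists>m r. m \<in> M \<and> r \<in> carrier R \<and> m \<oplus> r \<otimes> a \<in> S" if a: "a \<in> carrier R" "a \<notin> M" for a
  proof -
    let ?J = "M <+>\<^bsub>R\<^esub> PIdl a"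
    have J: "ideal ?J R" by (rule add_ideals[OF Mi cgenideal_ideal[OF a(1)]])
    have "y \<in> ?J" if "y \<in> M" for y
    proof -
      have "y = y \<oplus> \<zero> \<otimes> a" using M.Icarr[OF that] a(1) by simp
      then show ?thesis using that unfolding set_add_def' cgenideal_def by blast
    qed
    moreover have "a \<in> ?J"
    proof -
      have "a = \<zero> \<oplus> \<one> \<otimes> a" using a(1) by simp
      then show ?thesis using M.zero_closed unfolding set_add_def' cgenideal_def by blast
    qed
    ultimately have "?J \<notin> \<A>" using M(2)[of ?J] a(2) by blast
    then have "?J \<inter> S \<noteq> {}" using J \<open>\<And>y. y \<in> M \<Longrightarrow> y \<in> ?J\<close> IM unfolding \<A>_def by blast
    then show ?thesis unfolding set_add_def' cgenideal_def by blast
  qed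
  have "primeideal M R"
  proof (rule primeidealI[OF Mi is_cring])
    have "\<one> \<otimes> x [^] (0::nat) \<in> S" using one by (intro S_mem) auto
    then have "\<one> \<in> S" by simp
    then show "carrier R \<noteq> M" using MS one_closed by blast
    fix a b assume a: "a \<in> carrier R" and b: "b \<in> carrier R" and ab: "a \<otimes> b \<in> M"
    show "a \<in> M \<or> b \<in> M"
    proof (rule ccontr)
      assume "\<not> ?thesis"
      then obtain m r k s where m: "m \<in> M" "r \<in> carrier R" "m \<oplus> r \<otimes> a \<in> S"
        and k: "k \<in> M" "s \<in> carrier R" "k \<oplus> s \<otimes> b \<in> S"
        using meet[OF a] meet[OF b] by blast
      have c: "m \<in> carrier R" "k \<in> carrier R" using m k M.Icarr by auto
      have "(m \<oplus> r \<otimes> a) \<otimes> (k \<oplus> s \<otimes> b) = (m \<otimes> (k \<oplus> s \<otimes> b) \<oplus> (r \<otimes> a) \<otimes> k) \<oplus> (r \<otimes> s) \<otimes> (a \<otimes> b)"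
        using a b c m(2) k(2) by algebra
      moreover have "m \<otimes> (k \<oplus> s \<otimes> b) \<in> M" "(r \<otimes> a) \<otimes> k \<in> M" "(r \<otimes> s) \<otimes> (a \<otimes> b) \<in> M"
        using a b c m(2) k(2) M.I_r_closed[OF m(1)] M.I_l_closed[OF k(1)] M.I_l_closed[OF ab] by auto
      ultimately have "(m \<oplus> r \<otimes> a) \<otimes> (k \<oplus> s \<otimes> b) \<in> M"
        using M.a_closed by simp
      then show False using S_mult[OF m(3) k(3)] MS by blast
    qed
  qed
  moreover have "M \<subseteq> P"
  proof
    fix y assume y: "y \<in> M"
    show "y \<in> P"
    proof (rule ccontr)
      assume "y \<notin> P"
      then have "y \<otimes> x [^] (0::nat) \<in> S" using M.Icarr[OF y] by (intro S_mem)
      then show False using y M.Icarr[OF y] MS by auto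
    qed
  qed
  ultimately have "M = P" using min IM by blast
  moreover have "\<one> \<otimes> x [^] (1::nat) \<in> S" using one by (intro S_mem) auto
  then have "x \<in> S" using xc by simp
  ultimately show False using MS x by blast
qed

section \<open>Ideals of integer polynomials and their base changes\<close>

locale zpoly = fixes n :: nat

lemma domain_int: "domain \<Z>"
  using int_is_cring by (intro domain.intro domain_axioms.intro) auto

sublocale zpoly \<subseteq> Z: mpoly_domain \<Z> n
  by (intro mpoly_domain.intro domain_int)

sublocale zpoly \<subseteq> Q: mpoly_points rat_ring n
  by (intro mpoly_points.intro mpoly_field.intro field_from_type_algebra)

lemma rat_ring_simps:
  "carrier rat_ring = UNIV" "x \<otimes>\<^bsub>rat_ring\<^esub> y = x * y" "x \<oplus>\<^bsub>rat_ring\<^esub> y = x + y"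
  "\<zero>\<^bsub>rat_ring\<^esub> = 0" "\<one>\<^bsub>rat_ring\<^esub> = 1"
  by (auto simp: ring_of_type_algebra_def)

context zpoly
begin

abbreviation ZP where "ZP \<equiv> mpoly_ring \<Z> n"
abbreviation QP where "QP \<equiv> mpoly_ring rat_ring n"
abbreviation to_Q :: "(nat multiset \<Rightarrow> int) \<Rightarrow> (nat multiset \<Rightarrow> rat)" where
  "to_Q g \<equiv> (\<lambda>m. rat_of_int (g m))"

lemma Z_comb:
  assumes "ideal I ZP" "g \<in> I" "h \<in> I"
  shows "(\<lambda>m. a * g m + b * h m) \<in> I"
  using submodule_comb[OF Z.ideal_submodule[OF assms(1)] assms(2,3), of a b] by simp

lemma Z_scale: "ideal I ZP \<Longrightarrow> g \<in> I \<Longrightarrow> (\<lambda>m. a * g m) \<in> I"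
  using Z_comb[of I g g a 0] by simp

lemma Z_comb_carrier: "g \<in> carrier ZP \<Longrightarrow> h \<in> carrier ZP \<Longrightarrow> (\<lambda>m. a * g m + b * h m) \<in> carrier ZP"
  using Z_comb[OF Z.P.oneideal] .

lemma lead_at_scale: "c \<noteq> 0 \<Longrightarrow> lead_at \<Z> (\<lambda>m. c * g m) a \<longleftrightarrow> lead_at \<Z> g a"
  by (simp add: lead_at_def)

text \<open>
  The ideal of integer polynomials in the extension of \<open>I\<close> to the rationals.
\<close>

definition saturation :: "(nat multiset \<Rightarrow> int) set \<Rightarrow> (nat multiset \<Rightarrow> int) set" where
  "saturation I = {g \<in> carrier ZP. \<exists>c. c \<noteq> 0 \<and> (\<lambda>m. c * g m) \<in> I}"

lemma to_Q_hom: "ring_hom_cring ZP QP to_Q"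
proof -
  have "ring_hom_cring \<Z> rat_ring rat_of_int"
    by (intro ring_hom_cring.intro ring_hom_cring_axioms.intro int_is_cring Q.is_cring ring_hom_memI)
      (auto simp: rat_ring_simps)
  from ring_hom_cring.mpoly_map_hom[OF this, of n] show ?thesis
    by (intro ring_hom_cring.intro ring_hom_cring_axioms.intro Z.P.is_cring Q.P.is_cring)
qed

lemma to_Q_closed: "g \<in> carrier ZP \<Longrightarrow> to_Q g \<in> carrier QP"
  using ring_hom_closed[OF ring_hom_cring.homh[OF to_Q_hom]] .

lemma clear_denominators:
  assumes "k \<in> carrier QP"
  obtains d :: int and k' :: "nat multiset \<Rightarrow> int" where "d \<noteq> 0" "k' \<in> carrier ZP" "\<forall>m. rat_of_int d * k m = rat_of_int (k' m)"
proof -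
  have "\<exists>d::int. d \<noteq> 0 \<and> (\<forall>x\<in>D. \<exists>z. rat_of_int d * x = rat_of_int z)" if "finite D" for D :: "rat set"
    using that
  proof (induction rule: finite_induct)
    case empty
    show ?case by (intro exI[of _ 1]) simp
  next
    case (insert x D)
    then obtain d where d: "d \<noteq> 0" "\<And>y. y \<in> D \<Longrightarrow> \<exists>z. rat_of_int d * y = rat_of_int z" by blast
    obtain a b where x: "x = rat_of_int a / rat_of_int b" "b \<noteq> 0"
      by (metis Rat_cases_nonzero Fract_of_int_quotient quotient_of_denom_pos' quotient_of_div of_int_0
          less_irrefl prod.collapse)
    have "\<exists>z. rat_of_int (b * d) * y = rat_of_int z" if y: "y \<in> insert x D" for y
    proof (cases "y = x")
      case True
      then show ?thesis using x by (intro exI[of _ "a * d"]) (simp add: field_simps)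
    next
      case False
      then obtain z where "rat_of_int d * y = rat_of_int z" using d(2) y by blast
      then show ?thesis by (intro exI[of _ "b * z"]) (simp add: mult.assoc)
    qed
    then show ?case using d(1) x(2) by (intro exI[of _ "b * d"]) auto
  qed
  moreover have fin: "finite {m. k m \<noteq> 0}" using assms by (simp add: Q.mpoly_carrier rat_ring_simps)
  ultimately obtain d :: int where d: "d \<noteq> 0" "\<And>x. x \<in> k ` {m. k m \<noteq> 0} \<Longrightarrow> \<exists>z. rat_of_int d * x = rat_of_int z"
    by (meson finite_imageI)
  have "\<exists>z. rat_of_int d * k m = rat_of_int z" for m
    using d(2)[of "k m"] by (cases "k m = 0") auto
  then obtain k' where k': "\<And>m. rat_of_int d * k m = rat_of_int (k' m)" by metis
  have "k' m = 0 \<longleftrightarrow> k m = 0" for m using k'[of m] d(1) by (metis mult_eq_0_iff of_int_eq_0_iff)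
  then have "k' \<in> carrier ZP"
    using assms by (simp add: Z.mpoly_carrier Q.mpoly_carrier rat_ring_simps)
  then show ?thesis using that d(1) k' by blast
qed

lemma base_change_Q_eq:
  assumes I: "ideal I ZP"
  shows "base_change_Q n I = {h \<in> carrier QP. \<exists>c. c \<noteq> 0 \<and> (\<exists>g\<in>I. \<forall>m. rat_of_int c * h m = rat_of_int (g m))}"
    (is "_ = ?B")
proof -
  interpret h: ring_hom_cring ZP QP to_Q by (rule to_Q_hom)
  have mem: "h \<in> ?B" if "h \<in> carrier QP" "c \<noteq> 0" "g \<in> I" "\<And>m. rat_of_int c * h m = rat_of_int (g m)" for h c g
    using that by blast
  have gc: "g \<in> carrier ZP" if "g \<in> I" for g using Z.ideal_carrier[OF I that] .
  have mult: "k \<otimes>\<^bsub>QP\<^esub> h \<in> ?B" if h: "h \<in> ?B" and k: "k \<in> carrier QP" for h k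
  proof -
    obtain c g where c: "h \<in> carrier QP" "c \<noteq> 0" "g \<in> I" "\<And>m. rat_of_int c * h m = rat_of_int (g m)"
      using h by blast
    obtain d :: int and k' :: "nat multiset \<Rightarrow> int" where d: "d \<noteq> 0" "k' \<in> carrier ZP" "\<forall>m. rat_of_int d * k m = rat_of_int (k' m)"
      using clear_denominators[OF k] .
    let ?c = "mono_poly rat_ring (rat_of_int c) {#}" and ?d = "mono_poly rat_ring (rat_of_int d) {#}"
    let ?cd = "mono_poly rat_ring (rat_of_int (d * c)) {#}"
    have cc: "?c \<in> carrier QP" "?d \<in> carrier QP" by (auto intro!: Q.mono_poly_closed simp: rat_ring_simps)
    have cd: "?cd = ?d \<otimes>\<^bsub>QP\<^esub> ?c"
      by (subst Q.mono_poly_mono_mult) (auto simp: rat_ring_simps)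
    have "to_Q (k' \<otimes>\<^bsub>ZP\<^esub> g) = to_Q k' \<otimes>\<^bsub>QP\<^esub> to_Q g" using d(2) gc[OF c(3)] by (rule h.hom_mult)
    also have "to_Q k' = ?d \<otimes>\<^bsub>QP\<^esub> k"
      using k d(3) by (subst Q.scalar_mult) (auto simp: rat_ring_simps)
    also have "to_Q g = ?c \<otimes>\<^bsub>QP\<^esub> h"
      using c(1,4) by (subst Q.scalar_mult) (auto simp: rat_ring_simps)
    also have "(?d \<otimes>\<^bsub>QP\<^esub> k) \<otimes>\<^bsub>QP\<^esub> (?c \<otimes>\<^bsub>QP\<^esub> h) = ?cd \<otimes>\<^bsub>QP\<^esub> (k \<otimes>\<^bsub>QP\<^esub> h)"
      unfolding cd using cc c(1) k by (simp add: Q.P.m_ac)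
    also have "\<dots> = (\<lambda>m. rat_of_int (d * c) * (k \<otimes>\<^bsub>QP\<^esub> h) m)"
      using c(1) k by (subst Q.scalar_mult) (auto simp: rat_ring_simps)
    finally have eq: "rat_of_int ((k' \<otimes>\<^bsub>ZP\<^esub> g) m) = rat_of_int (d * c) * (k \<otimes>\<^bsub>QP\<^esub> h) m" for m
      by (rule fun_cong)
    show ?thesis
    proof (rule mem)
      show "k' \<otimes>\<^bsub>ZP\<^esub> g \<in> I" by (rule ideal.I_l_closed[OF I c(3) d(2)])
      show "d * c \<noteq> 0" using c d by simp
    qed (use c k eq in auto)
  qed
  have "ideal ?B QP"
  proof (rule idealI[OF Q.P.ring_axioms])
    show "subgroup ?B (add_monoid QP)"
    proof (rule Q.P.add.subgroupI)
      have "(\<lambda>m. 0) \<in> ?B"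
        using Z.ideal_zero[OF I] Q.mpoly_zero_closed by (intro mem[of _ 1 "\<lambda>m. 0"]) (auto simp: rat_ring_simps)
      then show "?B \<noteq> {}" by blast
      fix h k assume h: "h \<in> ?B" and k: "k \<in> ?B"
      have "\<ominus>\<^bsub>QP\<^esub> \<one>\<^bsub>QP\<^esub> \<otimes>\<^bsub>QP\<^esub> h \<in> ?B" using h by (intro mult) auto
      then show "\<ominus>\<^bsub>QP\<^esub> h \<in> ?B" using h by (simp add: Q.P.l_minus)
      obtain c g where c: "h \<in> carrier QP" "c \<noteq> 0" "g \<in> I" "\<And>m. rat_of_int c * h m = rat_of_int (g m)"
        using h by blast
      obtain d l where d: "k \<in> carrier QP" "d \<noteq> 0" "l \<in> I" "\<And>m. rat_of_int d * k m = rat_of_int (l m)"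
        using k by blast
      have "rat_of_int (c * d) * (h \<oplus>\<^bsub>QP\<^esub> k) m = rat_of_int (d * g m + c * l m)" for m
      proof -
        have "rat_of_int (c * d) * (h m + k m) =
            rat_of_int d * (rat_of_int c * h m) + rat_of_int c * (rat_of_int d * k m)"
          by (simp add: algebra_simps)
        then show ?thesis unfolding c(4) d(4) by (simp add: Q.mpoly_add rat_ring_simps)
      qed
      then show "h \<oplus>\<^bsub>QP\<^esub> k \<in> ?B"
        using c d Z_comb[OF I c(3) d(3)] by (intro mem[of _ "c * d" "\<lambda>m. d * g m + c * l m"]) auto
    qed auto
  qed (use mult Q.P.m_comm in auto)
  moreover have "to_Q ` I \<subseteq> ?B"
  proof
    fix h assume "h \<in> to_Q ` I"
    then obtain g where "g \<in> I" "h = to_Q g" by blast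
    then show "h \<in> ?B" using h.hom_closed[OF gc] by (intro mem[of _ 1 g]) auto
  qed
  ultimately have "Idl\<^bsub>QP\<^esub> (to_Q ` I) \<subseteq> ?B" by (rule Q.P.genideal_minimal)
  moreover have "?B \<subseteq> Idl\<^bsub>QP\<^esub> (to_Q ` I)"
  proof
    fix h assume "h \<in> ?B"
    then obtain c g where c: "h \<in> carrier QP" "c \<noteq> 0" "g \<in> I" "\<And>m. rat_of_int c * h m = rat_of_int (g m)"
      by blast
    have sub: "to_Q ` I \<subseteq> carrier QP" using h.hom_closed gc by blast
    then have id: "ideal (Idl\<^bsub>QP\<^esub> (to_Q ` I)) QP" by (rule Q.P.genideal_ideal)
    have "to_Q g \<in> Idl\<^bsub>QP\<^esub> (to_Q ` I)" using Q.P.genideal_self[OF sub] c(3) by blast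
    then have "(\<lambda>m. inverse (rat_of_int c) * to_Q g m) \<in> Idl\<^bsub>QP\<^esub> (to_Q ` I)"
      using Q.ideal_scalar[OF id, of "to_Q g" "inverse (rat_of_int c)"] by (simp add: rat_ring_simps)
    moreover have "inverse (rat_of_int c) * to_Q g m = h m" for m
      using c(2) c(4)[of m, symmetric] by (simp add: field_simps)
    ultimately show "h \<in> Idl\<^bsub>QP\<^esub> (to_Q ` I)" by simp
  qed
  ultimately show ?thesis unfolding base_change_Q_def by blast
qed

lemma base_change_Q_ideal: "ideal I ZP \<Longrightarrow> ideal (base_change_Q n I) QP"
proof -
  assume I: "ideal I ZP"
  have "to_Q ` I \<subseteq> carrier QP"
    by (intro image_subsetI to_Q_closed Z.ideal_carrier[OF I])
  then show ?thesis unfolding base_change_Q_def by (rule Q.P.genideal_ideal)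
qed

lemma base_change_Q_inter:
  assumes I: "ideal I ZP" and J: "ideal J ZP"
  shows "base_change_Q n (I \<inter> J) = base_change_Q n I \<inter> base_change_Q n J"
proof -
  have "h \<in> base_change_Q n (I \<inter> J)" if "h \<in> base_change_Q n I" "h \<in> base_change_Q n J" for h
  proof -
    obtain c g where c: "h \<in> carrier QP" "c \<noteq> 0" "g \<in> I" "\<And>m. rat_of_int c * h m = rat_of_int (g m)"
      using \<open>h \<in> base_change_Q n I\<close> unfolding base_change_Q_eq[OF I] by blast
    obtain d l where d: "d \<noteq> 0" "l \<in> J" "\<And>m. rat_of_int d * h m = rat_of_int (l m)"
      using \<open>h \<in> base_change_Q n J\<close> unfolding base_change_Q_eq[OF J] by blast
    have 1: "rat_of_int (d * c) * h m = rat_of_int (d * g m)" for m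
      using c(4)[of m] by (simp add: mult.assoc)
    have 2: "rat_of_int (d * c) * h m = rat_of_int (c * l m)" for m
      using d(3)[of m] by (simp add: mult.left_commute mult.assoc)
    have "d * g m = c * l m" for m using 1[of m] 2[of m] of_int_eq_iff[where 'a = rat] by metis
    then have "(\<lambda>m. d * g m) = (\<lambda>m. c * l m)" by (rule ext)
    then have "(\<lambda>m. d * g m) \<in> I \<inter> J" using Z_scale[OF I c(3), of d] Z_scale[OF J d(2), of c] by simp
    then show ?thesis
      unfolding base_change_Q_eq[OF Z.P.i_intersect[OF I J]] using c(1,2) d(1) 1
      by (intro CollectI conjI exI[of _ "d * c"] bexI[of _ "\<lambda>m. d * g m"]) auto
  qed
  moreover have "base_change_Q n (I \<inter> J) \<subseteq> base_change_Q n I \<inter> base_change_Q n J"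
    unfolding base_change_Q_eq[OF Z.P.i_intersect[OF I J]] base_change_Q_eq[OF I] base_change_Q_eq[OF J]
    by (intro subsetI) (elim CollectE conjE exE bexE IntE, intro IntI CollectI conjI exI bexI)
  ultimately show ?thesis by (intro subset_antisym subsetI) auto
qed

lemma lead_monos_base_change_Q:
  assumes I: "ideal I ZP"
  shows "lead_monos rat_ring (base_change_Q n I) = lead_monos \<Z> I"
proof
  have lead: "lead_at rat_ring h a \<longleftrightarrow> lead_at \<Z> g a"
    if "c \<noteq> 0" "\<And>m. rat_of_int c * h m = rat_of_int (g m)" for c h g a
  proof -
    have "h m = 0 \<longleftrightarrow> g m = 0" for m using that(2)[of m] that(1) by (metis mult_eq_0_iff of_int_eq_0_iff)
    then show ?thesis by (simp add: lead_at_def rat_ring_simps)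
  qed
  show "lead_monos rat_ring (base_change_Q n I) \<subseteq> lead_monos \<Z> I"
    unfolding base_change_Q_eq[OF I] lead_monos_def using lead by blast
  show "lead_monos \<Z> I \<subseteq> lead_monos rat_ring (base_change_Q n I)"
  proof
    fix a assume "a \<in> lead_monos \<Z> I"
    then obtain g where g: "g \<in> I" "lead_at \<Z> g a" by (auto simp: lead_monos_def)
    have "to_Q g \<in> carrier QP"
      using to_Q_closed[OF Z.ideal_carrier[OF I g(1)]] .
    then have "to_Q g \<in> base_change_Q n I"
      unfolding base_change_Q_eq[OF I] using g(1)
      by (intro CollectI conjI exI[of _ 1] bexI[of _ g]) auto
    moreover have "lead_at rat_ring (to_Q g) a" using lead[of 1 "to_Q g" g a] g(2) by simp
    ultimately show "a \<in> lead_monos rat_ring (base_change_Q n I)" by (auto simp: lead_monos_def)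
  qed
qed

lemma saturation_iff:
  assumes I: "ideal I ZP" and g: "g \<in> carrier ZP"
  shows "g \<in> saturation I \<longleftrightarrow> to_Q g \<in> base_change_Q n I"
proof -
  have "rat_of_int c * rat_of_int (g m) = rat_of_int (h m) \<longleftrightarrow> c * g m = h m" for c h m
    by (metis of_int_eq_iff of_int_mult)
  then have "to_Q g \<in> base_change_Q n I \<longleftrightarrow> (\<exists>c. c \<noteq> 0 \<and> (\<exists>h\<in>I. \<forall>m. c * g m = h m))"
    unfolding base_change_Q_eq[OF I] using to_Q_closed[OF g] by simp
  moreover have "(\<exists>h\<in>I. \<forall>m. c * g m = h m) \<longleftrightarrow> (\<lambda>m. c * g m) \<in> I" for c
    by (metis ext)
  ultimately show ?thesis using g by (simp add: saturation_def)
qed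

lemma saturation_ideal:
  assumes I: "ideal I ZP"
  shows "ideal (saturation I) ZP"
proof -
  interpret h: ring_hom_cring ZP QP to_Q by (rule to_Q_hom)
  have "ring_hom_ring ZP QP to_Q" by (intro ring_hom_ringI2 Z.P.ring_axioms Q.P.ring_axioms h.homh)
  from ring_hom_ring.ideal_vimage[OF this base_change_Q_ideal[OF I]]
  have "ideal {g \<in> carrier ZP. to_Q g \<in> base_change_Q n I} ZP" .
  moreover have "{g \<in> carrier ZP. to_Q g \<in> base_change_Q n I} = saturation I"
    using saturation_iff[OF I] by (auto simp: saturation_def)
  ultimately show ?thesis by simp
qed

lemma saturation_superset: "ideal I ZP \<Longrightarrow> I \<subseteq> saturation I"
  using Z.ideal_carrier unfolding saturation_def by (auto intro!: exI[of _ 1])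

lemma lead_monos_saturation: "lead_monos \<Z> (saturation I) \<subseteq> lead_monos \<Z> I"
  unfolding lead_monos_def saturation_def using lead_at_scale by blast

text \<open>
  Over the rationals the ideal has the same leading monomials and is radical.
\<close>

lemma saturation_radical:
  assumes I: "ideal I ZP" and sq: "squarefree_monos (lead_monos \<Z> I)"
    and g: "g \<in> carrier ZP" "g [^]\<^bsub>ZP\<^esub> (k::nat) \<in> saturation I"
  shows "g \<in> saturation I"
proof -
  interpret h: ring_hom_cring ZP QP to_Q by (rule to_Q_hom)
  have pow: "to_Q g [^]\<^bsub>QP\<^esub> k \<in> base_change_Q n I"
    using g h.hom_pow[OF g(1), of k] saturation_iff[OF I, of "g [^]\<^bsub>ZP\<^esub> k"] by simp
  have sqQ: "squarefree_monos (lead_monos rat_ring (base_change_Q n I))"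
    unfolding lead_monos_base_change_Q[OF I] by (rule sq)
  have "to_Q g \<in> base_change_Q n I"
    by (rule Q.squarefree_imp_radical[OF base_change_Q_ideal[OF I] sqQ h.hom_closed[OF g(1)] pow])
  then show ?thesis using saturation_iff[OF I g(1)] by simp
qed

text \<open>
  Away from the primes dividing \<open>N\<close>, the leading coefficients that are needed to reach the
  monomials in \<open>A\<close> are invertible, and \<open>I\<close> behaves like an ideal over a field.
\<close>

definition lead_bound :: "int \<Rightarrow> (nat multiset \<Rightarrow> int) set \<Rightarrow> nat multiset set \<Rightarrow> bool" where
  "lead_bound N I A \<longleftrightarrow> N \<noteq> 0 \<and> (\<forall>m\<in>A. \<exists>g\<in>I. lead_at \<Z> g m \<and> g m dvd N)"

text \<open>
  By Dickson's lemma finitely many leading monomials divide all others; \<open>N\<close> is the product of the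
  coefficients with which they occur.
\<close>

lemma finite_basis:
  assumes I: "ideal I ZP"
  obtains G N where "finite G" "G \<subseteq> I" "lead_bound N (Idl\<^bsub>ZP\<^esub> G) (lead_monos \<Z> I)"
proof -
  have mon: "lead_monos \<Z> I \<subseteq> monomials n" using Z.lead_monos_monomials[OF I] by blast
  obtain B where B: "finite B" "B \<subseteq> lead_monos \<Z> I" "\<forall>m\<in>lead_monos \<Z> I. \<exists>b\<in>B. b \<subseteq># m"
    using dickson[OF mon] .
  have "\<forall>b\<in>B. \<exists>g\<in>I. lead_at \<Z> g b" using B(2) by (auto simp: lead_monos_def)
  then obtain g where g: "\<And>b. b \<in> B \<Longrightarrow> g b \<in> I \<and> lead_at \<Z> (g b) b" by metis
  let ?N = "\<Prod>b\<in>B. g b b" and ?J = "Idl\<^bsub>ZP\<^esub> (g ` B)"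
  have sub: "g ` B \<subseteq> carrier ZP" using g Z.ideal_carrier[OF I] by blast
  have J: "ideal ?J ZP" by (rule Z.P.genideal_ideal[OF sub])
  have "lead_bound ?N ?J (lead_monos \<Z> I)"
    unfolding lead_bound_def
  proof (intro conjI ballI)
    show "?N \<noteq> 0" using g B(1) by (auto simp: lead_at_def)
    fix m assume m: "m \<in> lead_monos \<Z> I"
    then obtain b where b: "b \<in> B" "b \<subseteq># m" using B(3) by blast
    let ?x = "mono_poly \<Z> 1 (m - b)"
    have mb: "m - b \<in> monomials n"
      using Z.lead_monos_monomials[OF I m] monomials_subset[OF diff_subset_eq_self] by blast
    have gb: "g b \<in> carrier ZP" using sub b(1) by blast
    have "?x \<otimes>\<^bsub>ZP\<^esub> g b \<in> ?J"
      using Z.P.genideal_self[OF sub] b(1) mb Z.mono_poly_closed[of 1 "m - b" n]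
      by (intro ideal.I_l_closed[OF J]) auto
    moreover have "lead_at \<Z> (?x \<otimes>\<^bsub>ZP\<^esub> g b) (m - b + b)" "(?x \<otimes>\<^bsub>ZP\<^esub> g b) (m - b + b) = 1 * g b b"
      using Z.lead_at_mono_mult[OF gb, of b 1 "m - b"] g[OF b(1)] mb by auto
    moreover have "g b b dvd ?N" using B(1) b(1) by (intro dvd_prodI)
    ultimately show "\<exists>h\<in>?J. lead_at \<Z> h m \<and> h m dvd ?N" using b(2) by auto
  qed
  then show ?thesis using that B(1) g by blast
qed

lemma lead_bound_exists:
  assumes I: "ideal I ZP"
  obtains N where "lead_bound N I (lead_monos \<Z> I)"
proof -
  obtain G N where G: "finite G" "G \<subseteq> I" "lead_bound N (Idl\<^bsub>ZP\<^esub> G) (lead_monos \<Z> I)"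
    using finite_basis[OF I] .
  then have "Idl\<^bsub>ZP\<^esub> G \<subseteq> I" by (intro Z.P.genideal_minimal[OF I])
  then show ?thesis using that G(3) unfolding lead_bound_def by blast
qed

text \<open>
  All multipliers that occur in the reduction divide powers of \<open>N\<close>.
\<close>

lemma lead_reduction:
  assumes I: "ideal I ZP" and J: "ideal J ZP" "J \<subseteq> I" and N: "lead_bound N J (lead_monos \<Z> I)" and g: "g \<in> I"
  shows "\<exists>s. (\<lambda>m. N ^ s * g m) \<in> J"
proof -
  \<comment> \<open>As \<open>N \<noteq> 0\<close>, these multipliers are nonzero; a further multiple is a power of \<open>N\<close>.\<close>
  let ?U = "{u::int. \<exists>s. u dvd N ^ s}"
  have "\<exists>u\<in>?U. (\<lambda>m. u \<otimes>\<^bsub>\<Z>\<^esub> g m) \<in> J"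
  proof (rule Z.reduction[OF Z.ideal_submodule[OF I] Z.ideal_submodule[OF J(1)] J(2) _ _ _ _ g])
    show "u \<otimes>\<^bsub>\<Z>\<^esub> v \<in> ?U" if uv: "u \<in> ?U" "v \<in> ?U" for u v
    proof -
      obtain s t where "u dvd N ^ s" "v dvd N ^ t" using uv by blast
      then have "u * v dvd N ^ (s + t)" by (simp add: power_add mult_dvd_mono)
      then show ?thesis by auto
    qed
    show "\<exists>g\<in>J. lead_at \<Z> g m \<and> g m \<in> ?U" if m: "m \<in> lead_monos \<Z> I" for m
    proof -
      obtain h where h: "h \<in> J" "lead_at \<Z> h m" "h m dvd N"
        using N m unfolding lead_bound_def by blast
      then have "h m dvd N ^ 1" by simp
      then show ?thesis using h by blast
    qed
  qed auto
  then obtain u s where u: "u dvd N ^ s" "(\<lambda>m. u * g m) \<in> J" by auto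
  then obtain v where v: "N ^ s = u * v" by blast
  have "(\<lambda>m. v * (u * g m)) \<in> J" by (rule Z_scale[OF J(1) u(2)])
  moreover have "v * (u * g m) = N ^ s * g m" for m by (simp add: v)
  ultimately show ?thesis by auto
qed

lemma saturation_power:
  assumes I: "ideal I ZP" and N: "lead_bound N I (lead_monos \<Z> I)" and g: "g \<in> saturation I"
  shows "\<exists>s. (\<lambda>m. N ^ s * g m) \<in> I"
proof (rule lead_reduction[OF saturation_ideal[OF I] I saturation_superset[OF I] _ g])
  show "lead_bound N I (lead_monos \<Z> (saturation I))"
    using N lead_monos_saturation[of I] unfolding lead_bound_def by blast
qed

text \<open>
  An integer multiple of \<open>g\<close> lies in \<open>I\<close>, hence so does \<open>N\<^sup>s g\<close> for some \<open>s\<close>; and \<open>p\<close> is prime to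
  \<open>N\<^sup>s\<close>.
\<close>

lemma torsion_free:
  assumes I: "ideal I ZP" and N: "lead_bound N I (lead_monos \<Z> I)"
    and p: "Factorial_Ring.prime (p::nat)" "\<not> int p dvd N" and g: "g \<in> carrier ZP" "(\<lambda>m. int p * g m) \<in> I"
  shows "g \<in> I"
proof -
  have "int p \<noteq> 0" using p(1) prime_gt_0_nat by auto
  then have "g \<in> saturation I" using g unfolding saturation_def by blast
  then obtain s where s: "(\<lambda>m. N ^ s * g m) \<in> I" using saturation_power[OF I N] by blast
  have "coprime (int p) N" using p by (intro prime_imp_coprime) auto
  then have "coprime (int p) (N ^ s)" by simp
  then obtain u v where uv: "u * int p + v * N ^ s = 1"
    using bezout_int[of "int p" "N ^ s"] unfolding coprime_iff_gcd_eq_1 by auto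
  have "(\<lambda>m. u * (int p * g m) + v * (N ^ s * g m)) \<in> I" by (rule Z_comb[OF I g(2) s])
  moreover have "u * (int p * g m) + v * (N ^ s * g m) = g m" for m
    using arg_cong[OF uv, of "\<lambda>x. x * g m"] by (simp add: algebra_simps)
  ultimately show ?thesis by simp
qed

end

section \<open>Reduction modulo a prime\<close>

locale reduction_mod = zpoly n + frobenius p n for p n :: nat
begin

abbreviation FP where "FP \<equiv> mpoly_ring (Fp p) n"

lemma mod_hom: "ring_hom_cring ZP FP (mod_poly p)"
proof -
  have "ring_hom_cring \<Z> (Fp p) (\<lambda>a. a mod int p)"
    using mod_closed prime_gt_1_nat[OF prime]
    by (intro ring_hom_cring.intro ring_hom_cring_axioms.intro int_is_cring is_cring ring_hom_memI)
      (auto simp: Fp_simps mod_simps zmod_trivial_iff)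
  from ring_hom_cring.mpoly_map_hom[OF this, of n] show ?thesis
    unfolding mod_poly_def
    by (intro ring_hom_cring.intro ring_hom_cring_axioms.intro Z.P.is_cring P.is_cring)
qed

lemma mod_lift:
  assumes "h \<in> carrier FP"
  shows "h \<in> carrier ZP" "mod_poly p h = h"
proof -
  show "h \<in> carrier ZP"
    using assms by (simp add: mpoly_carrier Z.mpoly_carrier Fp_simps)
  show "mod_poly p h = h"
    using mod_carrier[OF mpoly_coeff_closed[OF assms]] by (simp add: mod_poly_def)
qed

lemma mod_poly_closed: "g \<in> carrier ZP \<Longrightarrow> mod_poly p g \<in> carrier FP"
  using ring_hom_closed[OF ring_hom_cring.homh[OF mod_hom]] .

lemma mod_surj: "mod_poly p ` carrier ZP = carrier FP"
proof
  show "mod_poly p ` carrier ZP \<subseteq> carrier FP"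
    by (intro image_subsetI mod_poly_closed)
  show "carrier FP \<subseteq> mod_poly p ` carrier ZP"
  proof
    fix h assume "h \<in> carrier FP"
    then show "h \<in> mod_poly p ` carrier ZP"
      using mod_lift[of h] by (intro image_eqI[of _ _ h]) auto
  qed
qed

lemma base_change_Fp_eq:
  assumes I: "ideal I ZP"
  shows "base_change_Fp p n I = mod_poly p ` I" "ideal (mod_poly p ` I) FP"
proof -
  show "ideal (mod_poly p ` I) FP" by (rule ring_hom_cring.surj_image_ideal[OF mod_hom mod_surj I])
  then show "base_change_Fp p n I = mod_poly p ` I"
    unfolding base_change_Fp_def by (rule P.genideal_of_ideal)
qed

lemma mod_poly_eqE:
  assumes "mod_poly p g = mod_poly p h" "g \<in> carrier ZP" "h \<in> carrier ZP"
  obtains r where "r \<in> carrier ZP" "\<forall>m. g m = h m + int p * r m"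
proof
  have "int p dvd g m - h m" for m
    using fun_cong[OF assms(1), of m] by (simp add: mod_poly_def mod_eq_dvd_iff)
  then show "\<forall>m. g m = h m + int p * ((g m - h m) div int p)" by simp
  have "(\<lambda>m. (g m - h m) div int p) m \<noteq> 0 \<Longrightarrow> g m \<noteq> 0 \<or> h m \<noteq> 0" for m by auto
  then have "{m. (g m - h m) div int p \<noteq> 0} \<subseteq> {m. g m \<noteq> 0} \<union> {m. h m \<noteq> 0}" by auto
  then show "(\<lambda>m. (g m - h m) div int p) \<in> carrier ZP"
    using assms(2,3) unfolding Z.mpoly_carrier by (auto intro: finite_subset)
qed

text \<open>
  When \<open>p\<close> divides the leading coefficient of \<open>g\<close>, cancel the leading term against an element of \<open>I\<close>
  whose leading coefficient divides \<open>N\<close> and is thus invertible modulo \<open>p\<close>.  This multiplies \<open>g\<close>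
  modulo \<open>p\<close> by a unit and lowers the leading monomial of \<open>g\<close> over the integers.
\<close>

lemma lead_monos_mod:
  assumes I: "ideal I ZP" and N: "lead_bound N I (lead_monos \<Z> I)" and p: "\<not> int p dvd N"
  shows "lead_monos (Fp p) (mod_poly p ` I) = lead_monos \<Z> I"
proof
  have pr: "Factorial_Ring.prime (int p)" using prime by simp
  have unit: "\<not> int p dvd a" if "a dvd N" for a using that p dvd_trans by blast
  show "lead_monos \<Z> I \<subseteq> lead_monos (Fp p) (mod_poly p ` I)"
  proof
    fix m assume "m \<in> lead_monos \<Z> I"
    then obtain g where g: "g \<in> I" "lead_at \<Z> g m" "g m dvd N" using N unfolding lead_bound_def by blast
    then have "lead_at (Fp p) (mod_poly p g) m"
      using unit[OF g(3)] by (auto simp: lead_at_def mod_poly_def Fp_simps dvd_eq_mod_eq_0)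
    then show "m \<in> lead_monos (Fp p) (mod_poly p ` I)" using g(1) by (auto simp: lead_monos_def)
  qed
  show "lead_monos (Fp p) (mod_poly p ` I) \<subseteq> lead_monos \<Z> I"
  proof
    fix m assume "m \<in> lead_monos (Fp p) (mod_poly p ` I)"
    then obtain g where g: "g \<in> I" "lead_at (Fp p) (mod_poly p g) m" by (auto simp: lead_monos_def)
    have nz: "h \<noteq> (\<lambda>m. 0)" if "lead_at (Fp p) (mod_poly p h) m" for h
      using that by (auto simp: lead_at_def mod_poly_def Fp_simps)
    obtain a where a: "lead_at \<Z> g a"
      using Z.lead_at_exists[OF Z.ideal_carrier[OF I g(1)]] nz[OF g(2)] by auto
    then have "a \<in> monomials n" using Z.lead_at_monomials[OF Z.ideal_carrier[OF I g(1)]] by blast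
    then have "\<forall>g\<in>I. lead_at \<Z> g a \<longrightarrow> lead_at (Fp p) (mod_poly p g) m \<longrightarrow> m \<in> lead_monos \<Z> I"
    proof (induction a rule: lex_induct)
      case (1 a)
      show ?case
      proof (intro ballI impI)
        fix g assume g: "g \<in> I" "lead_at \<Z> g a" "lead_at (Fp p) (mod_poly p g) m"
        have aI: "a \<in> lead_monos \<Z> I" using g by (auto simp: lead_monos_def)
        show "m \<in> lead_monos \<Z> I"
        proof (cases "int p dvd g a")
          case False
          then have "lead_at (Fp p) (mod_poly p g) a"
            using g(2) by (auto simp: lead_at_def mod_poly_def Fp_simps dvd_eq_mod_eq_0)
          then show ?thesis using lead_at_unique[OF g(3)] aI by metis
        next
          case True
          obtain h where h: "h \<in> I" "lead_at \<Z> h a" "h a dvd N"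
            using N aI unfolding lead_bound_def by blast
          define g' where "g' = (\<lambda>k. h a * g k + (- g a) * h k)"
          have g': "g' \<in> I" unfolding g'_def by (rule Z_comb[OF I g(1) h(1)])
          have "int p dvd g' k \<longleftrightarrow> int p dvd g k" for k
          proof -
            have "int p dvd (- g a) * h k" using True by simp
            then have "int p dvd g' k \<longleftrightarrow> int p dvd h a * g k"
              unfolding g'_def by (rule dvd_add_left_iff)
            then show ?thesis using unit[OF h(3)] prime_dvd_mult_iff[OF pr] by blast
          qed
          then have l: "lead_at (Fp p) (mod_poly p g') m"
            using g(3) by (simp add: lead_at_def mod_poly_def Fp_simps dvd_eq_mod_eq_0)
          obtain b where b: "lead_at \<Z> g' b"
            using Z.lead_at_exists[OF Z.ideal_carrier[OF I g']] nz[OF l] by auto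
          have "g' a = 0" "\<And>k. a \<lless> k \<Longrightarrow> g' k = 0"
            using g(2) h(2) by (auto simp: g'_def lead_at_def)
          then have "b \<lless> a" using b lex_total[of a b] unfolding lead_at_def by auto
          then show ?thesis
            using 1(2)[OF Z.lead_at_monomials[OF Z.ideal_carrier[OF I g'] b]] b g' l by blast
        qed
      qed
    qed
    then show "m \<in> lead_monos \<Z> I" using g a by blast
  qed
qed

lemma split_mod_base_change:
  assumes I: "ideal I ZP"
  shows "split_mod p n f (base_change_Fp p n I) \<longleftrightarrow>
    (\<forall>g\<in>I. twisted_trace (mod_poly p f) (mod_poly p g) \<in> mod_poly p ` I)"
  unfolding split_mod_iff base_change_Fp_eq(1)[OF I] using base_change_Fp_eq(2)[OF I] by simp

lemma mod_add: "mod_poly p (\<lambda>m. g m + h m) = mod_poly p g \<oplus>\<^bsub>FP\<^esub> mod_poly p h"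
  by (simp add: mpoly_add mod_poly_def Fp_simps mod_simps)

lemma mod_shift: "mod_poly p (\<lambda>m. 1 * g m + (- int p) * h m) = mod_poly p g"
proof -
  have "1 * g m + (- int p) * h m = g m + int p * (- h m)" for m by simp
  then show ?thesis by (simp only: mod_poly_def mod_mult_self2)
qed

lemma mod_mult:
  "g \<in> carrier ZP \<Longrightarrow> h \<in> carrier ZP \<Longrightarrow> mod_poly p (g \<otimes>\<^bsub>ZP\<^esub> h) = mod_poly p g \<otimes>\<^bsub>FP\<^esub> mod_poly p h"
  using ring_hom_mult[OF ring_hom_cring.homh[OF mod_hom]] .

lemma Z_add: "g \<oplus>\<^bsub>ZP\<^esub> h = (\<lambda>m. g m + h m)"
  by (simp add: Z.mpoly_add)

lemma sum_memI: "a \<in> I \<Longrightarrow> b \<in> J \<Longrightarrow> (\<lambda>m. a m + b m) \<in> I <+>\<^bsub>ZP\<^esub> J"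
  unfolding set_add_def' Z_add[symmetric] by blast

lemma sum_memE:
  assumes "h \<in> I <+>\<^bsub>ZP\<^esub> J"
  obtains a b where "a \<in> I" "b \<in> J" "h = (\<lambda>m. a m + b m)"
  using assms unfolding set_add_def' Z_add by blast

lemma unit_cancel:
  assumes I: "ideal I ZP" and g: "g \<in> carrier ZP" and c: "\<not> int p dvd c" and cg: "(\<lambda>m. c * g m) \<in> I"
  shows "mod_poly p g \<in> mod_poly p ` I"
proof -
  note J = base_change_Fp_eq(2)[OF I]
  let ?c = "c mod int p"
  have cK: "?c \<in> carrier K" "?c \<noteq> \<zero>\<^bsub>K\<^esub>" using c mod_closed by (auto simp: Fp_simps dvd_eq_mod_eq_0)
  then have inv: "inv\<^bsub>K\<^esub> ?c \<in> carrier K" "inv\<^bsub>K\<^esub> ?c \<otimes>\<^bsub>K\<^esub> ?c = \<one>\<^bsub>K\<^esub>" using field_Units by auto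
  have gK: "mod_poly p g m \<in> carrier K" for m using mpoly_coeff_closed[OF mod_poly_closed[OF g]] .
  have "mod_poly p (\<lambda>m. c * g m) = (\<lambda>m. ?c \<otimes>\<^bsub>K\<^esub> mod_poly p g m)"
    by (simp add: mod_poly_def Fp_simps mod_simps)
  then have "(\<lambda>m. ?c \<otimes>\<^bsub>K\<^esub> mod_poly p g m) \<in> mod_poly p ` I" using cg by (metis image_eqI)
  then have "(\<lambda>m. inv\<^bsub>K\<^esub> ?c \<otimes>\<^bsub>K\<^esub> (?c \<otimes>\<^bsub>K\<^esub> mod_poly p g m)) \<in> mod_poly p ` I"
    by (rule ideal_scalar[OF J _ inv(1)])
  moreover have "inv\<^bsub>K\<^esub> ?c \<otimes>\<^bsub>K\<^esub> (?c \<otimes>\<^bsub>K\<^esub> mod_poly p g m) = mod_poly p g m" for m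
    using m_assoc[OF inv(1) cK(1) gK, symmetric] inv(2) l_one[OF gK] by simp
  ultimately show ?thesis by simp
qed

text \<open>
  Writing \<open>F\<close> for \<open>f\<close> modulo \<open>p\<close>, one has \<open>Tr (F\<^sup>p\<^sup>-\<^sup>1 h F) = Tr (F\<^sup>p h) = F Tr h\<close>.
\<close>

lemma split_principal:
  assumes f: "f \<in> carrier ZP"
  shows "split_mod p n f (base_change_Fp p n (PIdl\<^bsub>ZP\<^esub> f))"
  unfolding split_mod_base_change[OF Z.P.cgenideal_ideal[OF f]]
proof
  note F = mod_poly_closed[OF f]
  fix g assume "g \<in> PIdl\<^bsub>ZP\<^esub> f"
  then obtain h where h: "h \<in> carrier ZP" "g = h \<otimes>\<^bsub>ZP\<^esub> f" unfolding cgenideal_def by blast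
  have hF: "mod_poly p h \<in> carrier FP" using mod_poly_closed[OF h(1)] .
  obtain t where t: "t \<in> carrier ZP" "mod_poly p t = trace (mod_poly p h)"
    using mod_lift[OF trace_closed[OF hF]] by blast
  have "twisted_trace (mod_poly p f) (mod_poly p g) = mod_poly p f \<otimes>\<^bsub>FP\<^esub> mod_poly p t"
    unfolding h(2) mod_mult[OF h(1) f] t(2) by (rule twisted_trace_principal[OF F hF])
  also have "\<dots> = mod_poly p (t \<otimes>\<^bsub>ZP\<^esub> f)"
    unfolding mod_mult[OF t(1) f] by (rule P.m_comm[OF F mod_poly_closed[OF t(1)]])
  finally show "twisted_trace (mod_poly p f) (mod_poly p g) \<in> mod_poly p ` (PIdl\<^bsub>ZP\<^esub> f)"
    using t(1) unfolding cgenideal_def by blast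
qed

lemma split_sum:
  assumes f: "f \<in> carrier ZP" and I: "ideal I ZP" and J: "ideal J ZP"
    and sI: "split_mod p n f (base_change_Fp p n I)" and sJ: "split_mod p n f (base_change_Fp p n J)"
  shows "split_mod p n f (base_change_Fp p n (I <+>\<^bsub>ZP\<^esub> J))"
  unfolding split_mod_base_change[OF Z.P.add_ideals[OF I J]]
proof
  fix g assume "g \<in> I <+>\<^bsub>ZP\<^esub> J"
  then obtain a b where a: "a \<in> I" and b: "b \<in> J" and g: "g = (\<lambda>m. a m + b m)"
    by (rule sum_memE)
  obtain s where s: "s \<in> I" "twisted_trace (mod_poly p f) (mod_poly p a) = mod_poly p s"
    using sI a unfolding split_mod_base_change[OF I] by blast
  obtain t where t: "t \<in> J" "twisted_trace (mod_poly p f) (mod_poly p b) = mod_poly p t"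
    using sJ b unfolding split_mod_base_change[OF J] by blast
  have "twisted_trace (mod_poly p f) (mod_poly p g) = mod_poly p s \<oplus>\<^bsub>FP\<^esub> mod_poly p t"
    unfolding g mod_add s(2)[symmetric] t(2)[symmetric]
    by (intro twisted_trace_add mod_poly_closed f Z.ideal_carrier[OF I a] Z.ideal_carrier[OF J b])
  then have "twisted_trace (mod_poly p f) (mod_poly p g) = mod_poly p (\<lambda>m. s m + t m)"
    by (simp only: mod_add)
  then show "twisted_trace (mod_poly p f) (mod_poly p g) \<in> mod_poly p ` (I <+>\<^bsub>ZP\<^esub> J)"
    using sum_memI[OF s(1) t(1)] by (rule image_eqI)
qed

text \<open>
  The image of \<open>g\<close> has a lift in \<open>I\<close> and one in \<open>J\<close>.  They differ by \<open>p r\<close>, and \<open>r \<in> I + J\<close> by the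
  assumption on torsion; splitting \<open>r\<close> accordingly corrects them to a common lift.
\<close>

lemma split_inter:
  assumes f: "f \<in> carrier ZP" and I: "ideal I ZP" and J: "ideal J ZP"
    and sI: "split_mod p n f (base_change_Fp p n I)" and sJ: "split_mod p n f (base_change_Fp p n J)"
    and tf: "\<And>r. r \<in> carrier ZP \<Longrightarrow> (\<lambda>m. int p * r m) \<in> I <+>\<^bsub>ZP\<^esub> J \<Longrightarrow> r \<in> I <+>\<^bsub>ZP\<^esub> J"
  shows "split_mod p n f (base_change_Fp p n (I \<inter> J))"
  unfolding split_mod_base_change[OF Z.P.i_intersect[OF I J]]
proof
  fix g assume g: "g \<in> I \<inter> J"
  obtain s where s: "s \<in> I" "twisted_trace (mod_poly p f) (mod_poly p g) = mod_poly p s"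
    using sI g unfolding split_mod_base_change[OF I] by blast
  obtain t where t: "t \<in> J" "twisted_trace (mod_poly p f) (mod_poly p g) = mod_poly p t"
    using sJ g unfolding split_mod_base_change[OF J] by blast
  have "mod_poly p s = mod_poly p t" using s(2) t(2) by simp
  then obtain r where r: "r \<in> carrier ZP" "\<forall>m. s m = t m + int p * r m"
    using Z.ideal_carrier[OF I s(1)] Z.ideal_carrier[OF J t(1)] by (rule mod_poly_eqE)
  have "(\<lambda>m. s m + - 1 * t m) \<in> I <+>\<^bsub>ZP\<^esub> J" by (rule sum_memI[OF s(1) Z_scale[OF J t(1)]])
  moreover have "(\<lambda>m. s m + - 1 * t m) = (\<lambda>m. int p * r m)" using r(2) by (intro ext) simp
  ultimately have "r \<in> I <+>\<^bsub>ZP\<^esub> J" using tf[OF r(1)] by simp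
  then obtain a b where a: "a \<in> I" and b: "b \<in> J" and rab: "r = (\<lambda>m. a m + b m)"
    by (rule sum_memE)
  \<comment> \<open>The two lifts are \<open>s = t + p (a + b)\<close> and \<open>t\<close>, so \<open>s - p a = t + p b\<close>.\<close>
  define w where "w = (\<lambda>m. 1 * s m + (- int p) * a m)"
  have "w = (\<lambda>m. 1 * t m + int p * b m)"
    using r(2) by (intro ext) (simp add: w_def rab algebra_simps)
  then have "w \<in> I \<inter> J"
    using Z_comb[OF I s(1) a, of 1 "- int p"] Z_comb[OF J t(1) b, of 1 "int p"] unfolding w_def by simp
  moreover have "mod_poly p w = mod_poly p s"
    unfolding w_def by (rule mod_shift)
  ultimately show "twisted_trace (mod_poly p f) (mod_poly p g) \<in> mod_poly p ` (I \<inter> J)"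
    unfolding s(2) by (metis image_eqI)
qed

text \<open>
  Let \<open>\<phi>\<close> be the twisted trace and \<open>h\<close> a lift of \<open>\<phi>(g)\<close>.  Modulo \<open>p\<close>, \<open>a \<phi>(g) = \<phi>(a\<^sup>p g)\<close> lies in \<open>I\<close>,
  so \<open>a h \<in> I + p R\<close>.  Absence of torsion modulo \<open>I + (a)\<close> turns this into \<open>a (h - p t) \<in> I\<close>, and
  \<open>h - p t\<close> is a lift of \<open>\<phi>(g)\<close> in the prime ideal \<open>Q\<close>.
\<close>

lemma split_annihilator:
  assumes f: "f \<in> carrier ZP" and I: "ideal I ZP" and Q: "primeideal Q ZP" and IQ: "I \<subseteq> Q"
    and sI: "split_mod p n f (base_change_Fp p n I)"
    and a: "a \<in> carrier ZP" "a \<notin> Q" and N: "\<not> int p dvd N"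
    and ann: "\<And>g. g \<in> Q \<Longrightarrow> \<exists>s. (\<lambda>m. N ^ s * (a \<otimes>\<^bsub>ZP\<^esub> g) m) \<in> I"
    and tf: "\<And>r. r \<in> carrier ZP \<Longrightarrow> (\<lambda>m. int p * r m) \<in> I <+>\<^bsub>ZP\<^esub> PIdl\<^bsub>ZP\<^esub> a \<Longrightarrow> r \<in> I <+>\<^bsub>ZP\<^esub> PIdl\<^bsub>ZP\<^esub> a"
  shows "split_mod p n f (base_change_Fp p n Q)"
proof -
  interpret Q: primeideal Q ZP by (rule Q)
  note Qi = Q.is_ideal and J = base_change_Fp_eq(2)[OF I] and F = mod_poly_closed[OF f]
  note A = mod_poly_closed[OF a(1)]
  show ?thesis
    unfolding split_mod_base_change[OF Qi]
  proof
    fix g assume g: "g \<in> Q"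
    have gc: "g \<in> carrier ZP" using Z.ideal_carrier[OF Qi g] .
    note G = mod_poly_closed[OF gc]
    let ?t = "twisted_trace (mod_poly p f) (mod_poly p g)"
    obtain s where s: "(\<lambda>m. N ^ s * (a \<otimes>\<^bsub>ZP\<^esub> g) m) \<in> I" using ann[OF g] by blast
    have "\<not> int p dvd N ^ s" using N prime prime_dvd_power[of "int p" N s] by auto
    then have "mod_poly p a \<otimes>\<^bsub>FP\<^esub> mod_poly p g \<in> mod_poly p ` I"
      using unit_cancel[OF I Z.P.m_closed[OF a(1) gc] _ s] mod_mult[OF a(1) gc] by simp
    then have "mod_poly p a [^]\<^bsub>FP\<^esub> (p - 1) \<otimes>\<^bsub>FP\<^esub> (mod_poly p a \<otimes>\<^bsub>FP\<^esub> mod_poly p g) \<in> mod_poly p ` I"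
      by (rule ideal.I_l_closed[OF J _ P.nat_pow_closed[OF A]])
    moreover have "mod_poly p a [^]\<^bsub>FP\<^esub> (p - 1) \<otimes>\<^bsub>FP\<^esub> (mod_poly p a \<otimes>\<^bsub>FP\<^esub> mod_poly p g) =
        mod_poly p a [^]\<^bsub>FP\<^esub> p \<otimes>\<^bsub>FP\<^esub> mod_poly p g"
      using P.m_assoc[OF P.nat_pow_closed[OF A] A G, symmetric] p_pos P.nat_pow_Suc[of "mod_poly p a" "p - 1"]
      by simp
    ultimately obtain i' where i': "i' \<in> I" "mod_poly p a [^]\<^bsub>FP\<^esub> p \<otimes>\<^bsub>FP\<^esub> mod_poly p g = mod_poly p i'"
      by auto
    have "mod_poly p a \<otimes>\<^bsub>FP\<^esub> ?t = twisted_trace (mod_poly p f) (mod_poly p i')"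
      unfolding i'(2)[symmetric] by (rule twisted_trace_linear[OF F A G, symmetric])
    then obtain i where i: "i \<in> I" "mod_poly p a \<otimes>\<^bsub>FP\<^esub> ?t = mod_poly p i"
      using sI i'(1) unfolding split_mod_base_change[OF I] by auto
    obtain h where h: "h \<in> carrier ZP" "mod_poly p h = ?t"
      using mod_lift[OF twisted_trace_closed[OF F G]] by blast
    have ic: "i \<in> carrier ZP" using Z.ideal_carrier[OF I i(1)] .
    have ahc: "a \<otimes>\<^bsub>ZP\<^esub> h \<in> carrier ZP" using a(1) h(1) by (rule Z.P.m_closed)
    have "mod_poly p (a \<otimes>\<^bsub>ZP\<^esub> h) = mod_poly p i"
      unfolding mod_mult[OF a(1) h(1)] h(2) by (rule i(2))
    then obtain r where r: "r \<in> carrier ZP" "\<forall>m. (a \<otimes>\<^bsub>ZP\<^esub> h) m = i m + int p * r m"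
      using ahc ic by (rule mod_poly_eqE)
    have "a \<otimes>\<^bsub>ZP\<^esub> h \<in> PIdl\<^bsub>ZP\<^esub> a"
      unfolding Z.P.m_comm[OF a(1) h(1)] using h(1) unfolding cgenideal_def by blast
    then have "(\<lambda>m. - 1 * i m + (a \<otimes>\<^bsub>ZP\<^esub> h) m) \<in> I <+>\<^bsub>ZP\<^esub> PIdl\<^bsub>ZP\<^esub> a"
      by (rule sum_memI[OF Z_scale[OF I i(1)]])
    moreover have "(\<lambda>m. - 1 * i m + (a \<otimes>\<^bsub>ZP\<^esub> h) m) = (\<lambda>m. int p * r m)" using r(2) by (intro ext) simp
    ultimately have "r \<in> I <+>\<^bsub>ZP\<^esub> PIdl\<^bsub>ZP\<^esub> a" using tf[OF r(1)] by simp
    then obtain j b where j: "j \<in> I" and b: "b \<in> PIdl\<^bsub>ZP\<^esub> a" and rjb: "r = (\<lambda>m. j m + b m)"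
      by (rule sum_memE)
    obtain t where t: "t \<in> carrier ZP" "b = t \<otimes>\<^bsub>ZP\<^esub> a" using b unfolding cgenideal_def by blast
    \<comment> \<open>Split \<open>r = j + t a\<close> with \<open>j \<in> I\<close>; subtracting \<open>p t\<close> from \<open>h\<close> removes the part \<open>p t a\<close> of \<open>a h = i + p r\<close>.\<close>
    define h' where "h' = (\<lambda>m. 1 * h m + (- int p) * t m)"
    have h'c: "h' \<in> carrier ZP" unfolding h'_def by (rule Z_comb_carrier[OF h(1) t(1)])
    let ?p = "mono_poly \<Z> (- int p) {#}"
    have pc: "?p \<in> carrier ZP" by (rule Z.mono_poly_closed) auto
    have "(\<lambda>m. (- int p) * t m) = ?p \<otimes>\<^bsub>ZP\<^esub> t" using Z.scalar_mult[of "- int p" t] t(1) by simp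
    then have "h' = h \<oplus>\<^bsub>ZP\<^esub> ?p \<otimes>\<^bsub>ZP\<^esub> t"
      unfolding Z_add h'_def by (intro ext) (metis mult_1)
    then have "a \<otimes>\<^bsub>ZP\<^esub> h' = a \<otimes>\<^bsub>ZP\<^esub> h \<oplus>\<^bsub>ZP\<^esub> ?p \<otimes>\<^bsub>ZP\<^esub> (t \<otimes>\<^bsub>ZP\<^esub> a)"
      using a(1) h(1) t(1) pc by (simp add: Z.P.r_distr Z.P.m_ac)
    also have "?p \<otimes>\<^bsub>ZP\<^esub> (t \<otimes>\<^bsub>ZP\<^esub> a) = (\<lambda>m. (- int p) * b m)"
      using Z.scalar_mult[of "- int p" "t \<otimes>\<^bsub>ZP\<^esub> a"] Z.P.m_closed[OF t(1) a(1)] t(2) by simp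
    finally have "a \<otimes>\<^bsub>ZP\<^esub> h' = (\<lambda>m. 1 * i m + int p * j m)"
      unfolding Z_add by (simp add: r(2) rjb fun_eq_iff algebra_simps)
    then have "a \<otimes>\<^bsub>ZP\<^esub> h' \<in> Q" using Z_comb[OF I i(1) j, of 1 "int p"] IQ by auto
    then have "h' \<in> Q" using Q.I_prime[OF a(1) h'c] a(2) by blast
    moreover have "mod_poly p h' = ?t"
      unfolding h(2)[symmetric] h'_def by (rule mod_shift)
    ultimately show "?t \<in> mod_poly p ` Q" by (metis image_eqI)
  qed
qed

text \<open>
  A constant that is invertible modulo \<open>p\<close> makes the base change the whole ring.
\<close>

lemma split_vertical:
  assumes f: "f \<in> carrier ZP" and Q: "ideal Q ZP" and c: "mono_poly \<Z> c {#} \<in> Q" "\<not> int p dvd c"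
  shows "split_mod p n f (base_change_Fp p n Q)"
  unfolding split_mod_base_change[OF Q]
proof
  fix g assume "g \<in> Q"
  then have gc: "g \<in> carrier ZP" using Z.ideal_carrier[OF Q] by blast
  obtain h where h: "h \<in> carrier ZP" "mod_poly p h = twisted_trace (mod_poly p f) (mod_poly p g)"
    using mod_lift[OF twisted_trace_closed[OF mod_poly_closed[OF f] mod_poly_closed[OF gc]]] by blast
  have "h \<otimes>\<^bsub>ZP\<^esub> mono_poly \<Z> c {#} \<in> Q" by (rule ideal.I_l_closed[OF Q c(1) h(1)])
  then have "mono_poly \<Z> c {#} \<otimes>\<^bsub>ZP\<^esub> h \<in> Q"
    using Z.P.m_comm[OF h(1) Z.ideal_carrier[OF Q c(1)]] by simp
  then have "(\<lambda>m. c * h m) \<in> Q" using Z.scalar_mult[of c h] h(1) by simp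
  then show "twisted_trace (mod_poly p f) (mod_poly p g) \<in> mod_poly p ` Q"
    using unit_cancel[OF Q h(1) c(2)] h(2) by simp
qed

end

section \<open>Ideals that are compatibly split for almost all primes\<close>

definition almost_all_primes :: "(nat \<Rightarrow> bool) \<Rightarrow> bool" where
  "almost_all_primes Q \<longleftrightarrow> (\<exists>E. finite E \<and> (\<forall>p. Factorial_Ring.prime p \<and> p \<notin> E \<longrightarrow> Q p))"

lemma almost_all_primes_mono:
  "almost_all_primes Q \<Longrightarrow> (\<And>p. Factorial_Ring.prime p \<Longrightarrow> Q p \<Longrightarrow> Q' p) \<Longrightarrow> almost_all_primes Q'"
  unfolding almost_all_primes_def by blast

lemma almost_all_primes_conj:
  assumes "almost_all_primes Q" "almost_all_primes Q'"
  shows "almost_all_primes (\<lambda>p. Q p \<and> Q' p)"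
proof -
  obtain E E' where "finite E" "\<forall>p. Factorial_Ring.prime p \<and> p \<notin> E \<longrightarrow> Q p"
    and "finite E'" "\<forall>p. Factorial_Ring.prime p \<and> p \<notin> E' \<longrightarrow> Q' p"
    using assms unfolding almost_all_primes_def by blast
  then show ?thesis unfolding almost_all_primes_def by (intro exI[of _ "E \<union> E'"]) simp
qed

lemma almost_all_primes_ball:
  assumes "finite M" "\<And>I. I \<in> M \<Longrightarrow> almost_all_primes (Q I)"
  shows "almost_all_primes (\<lambda>p. \<forall>I\<in>M. Q I p)"
  using assms
proof (induction M rule: finite_induct)
  case empty
  show ?case unfolding almost_all_primes_def by (intro exI[of _ "{}"]) simp
next
  case (insert I M)
  then have "almost_all_primes (\<lambda>p. Q I p \<and> (\<forall>I\<in>M. Q I p))" by (intro almost_all_primes_conj) auto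
  then show ?case by simp
qed

lemma almost_all_primes_all: "(\<And>p. Factorial_Ring.prime p \<Longrightarrow> Q p) \<Longrightarrow> almost_all_primes Q"
  unfolding almost_all_primes_def by (intro exI[of _ "{}"]) simp

lemma almost_all_primes_not_dvd: "N \<noteq> 0 \<Longrightarrow> almost_all_primes (\<lambda>p. \<not> int p dvd N)"
proof -
  assume "N \<noteq> 0"
  then have "finite {d. d dvd nat \<bar>N\<bar>}" by (intro finite_divisors_nat) simp
  then show ?thesis
    unfolding almost_all_primes_def by (intro exI[of _ "{d. d dvd nat \<bar>N\<bar>}"]) (simp add: dvd_nat_abs_iff)
qed

lemma almost_all_primes_ex: "almost_all_primes Q \<Longrightarrow> \<exists>p. Factorial_Ring.prime p \<and> Q p"
proof -
  assume "almost_all_primes Q"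
  then obtain E where E: "finite E" "\<forall>p. Factorial_Ring.prime p \<and> p \<notin> E \<longrightarrow> Q p"
    unfolding almost_all_primes_def by blast
  have "infinite {p::nat. Factorial_Ring.prime p}" by (rule primes_infinite)
  then have "infinite ({p::nat. Factorial_Ring.prime p} - E)" using E(1) by (rule Diff_infinite_finite[rotated])
  then obtain p where "p \<in> {p::nat. Factorial_Ring.prime p} - E" by (metis finite.emptyI ex_in_conv)
  then show ?thesis using E(2) by blast
qed

lemma (in cring) colon_ideal:
  assumes J: "ideal J R" and a: "a \<in> carrier R"
  shows "ideal {y \<in> carrier R. a \<otimes> y \<in> J} R"
proof (rule idealI[OF ring_axioms])
  interpret J: ideal J R by (rule J)
  show "subgroup {y \<in> carrier R. a \<otimes> y \<in> J} (add_monoid R)"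
    using a by (intro add.subgroupI) (auto simp: r_distr r_minus J.a_closed J.a_inv_closed)
  fix y x assume y: "y \<in> {y \<in> carrier R. a \<otimes> y \<in> J}" and x: "x \<in> carrier R"
  have "a \<otimes> (x \<otimes> y) = x \<otimes> (a \<otimes> y)" using a x y by (intro m_lcomm) auto
  then show "x \<otimes> y \<in> {y \<in> carrier R. a \<otimes> y \<in> J}" using x y J.I_l_closed by simp
  then show "y \<otimes> x \<in> {y \<in> carrier R. a \<otimes> y \<in> J}" using x y m_comm by simp
qed

context zpoly
begin

lemma const_mult: "g \<in> carrier ZP \<Longrightarrow> mono_poly \<Z> c {#} \<otimes>\<^bsub>ZP\<^esub> g = (\<lambda>m. c * g m)"
  using Z.scalar_mult[of c g] by simp

lemma const_closed: "mono_poly \<Z> c {#} \<in> carrier ZP"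
  by (rule Z.mono_poly_closed) auto

lemma almost_all_torsion_free:
  assumes I: "ideal I ZP"
  shows "almost_all_primes (\<lambda>p. \<forall>g\<in>carrier ZP. (\<lambda>m. int p * g m) \<in> I \<longrightarrow> g \<in> I)"
proof -
  obtain N where N: "lead_bound N I (lead_monos \<Z> I)" using lead_bound_exists[OF I] .
  then have "N \<noteq> 0" by (simp add: lead_bound_def)
  from almost_all_primes_not_dvd[OF this] show ?thesis
    by (rule almost_all_primes_mono) (use torsion_free[OF I N] in blast)
qed

lemma saturation_scale:
  assumes g: "g \<in> carrier ZP" and c: "c \<noteq> 0" and cg: "(\<lambda>m. c * g m) \<in> saturation I"
  shows "g \<in> saturation I"
proof -
  obtain d where d: "d \<noteq> 0" "(\<lambda>m. d * (c * g m)) \<in> I" using cg unfolding saturation_def by blast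
  have "(\<lambda>m. d * (c * g m)) = (\<lambda>m. (d * c) * g m)" by (simp add: mult.assoc)
  then show ?thesis using d c g unfolding saturation_def by (auto intro!: exI[of _ "d * c"])
qed

text \<open>
  As the saturation of \<open>I\<close> is radical, \<open>minimal_prime_nilpotent\<close> provides for each element of \<open>Q\<close>
  some \<open>a \<notin> Q\<close> that multiplies it into the saturation.  Finitely many elements generate \<open>Q\<close> up to
  denominators; take the product of their multipliers.
\<close>

lemma minimal_prime_annihilator:
  assumes I: "ideal I ZP" and sq: "squarefree_monos (lead_monos \<Z> I)"
    and Q: "minimal_prime_over ZP I Q" and hor: "\<And>c. c \<noteq> 0 \<Longrightarrow> mono_poly \<Z> c {#} \<notin> Q"
  shows "\<exists>a\<in>carrier ZP. a \<notin> Q \<and> (\<forall>g\<in>Q. a \<otimes>\<^bsub>ZP\<^esub> g \<in> saturation I)"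
proof -
  have prime: "primeideal Q ZP" and IQ: "I \<subseteq> Q" using Q by (auto simp: minimal_prime_over_def)
  interpret Q: primeideal Q ZP by (rule prime)
  note Qi = Q.is_ideal and S = saturation_ideal[OF I]
  have one: "\<exists>a\<in>carrier ZP. a \<notin> Q \<and> a \<otimes>\<^bsub>ZP\<^esub> x \<in> saturation I" if x: "x \<in> Q" for x
  proof -
    have xc: "x \<in> carrier ZP" using Q.Icarr[OF x] .
    obtain a k where a: "a \<in> carrier ZP" "a \<notin> Q" "a \<otimes>\<^bsub>ZP\<^esub> x [^]\<^bsub>ZP\<^esub> (k::nat) \<in> I"
      using Z.P.minimal_prime_nilpotent[OF I Q x] by blast
    have "k \<noteq> 0"
    proof
      assume "k = 0"
      then have "a \<in> I" using a(1,3) by simp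
      then show False using a(2) IQ by blast
    qed
    then obtain l where l: "k = Suc l" using not0_implies_Suc by blast
    have "(a \<otimes>\<^bsub>ZP\<^esub> x) [^]\<^bsub>ZP\<^esub> k = a [^]\<^bsub>ZP\<^esub> l \<otimes>\<^bsub>ZP\<^esub> (a \<otimes>\<^bsub>ZP\<^esub> x [^]\<^bsub>ZP\<^esub> k)"
      using a(1) xc by (simp add: l Z.P.nat_pow_distrib Z.P.m_ac)
    moreover have "a [^]\<^bsub>ZP\<^esub> l \<otimes>\<^bsub>ZP\<^esub> (a \<otimes>\<^bsub>ZP\<^esub> x [^]\<^bsub>ZP\<^esub> k) \<in> I"
      by (rule ideal.I_l_closed[OF I a(3) Z.P.nat_pow_closed[OF a(1)]])
    ultimately have "(a \<otimes>\<^bsub>ZP\<^esub> x) [^]\<^bsub>ZP\<^esub> k \<in> saturation I" using saturation_superset[OF I] by auto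
    then have "a \<otimes>\<^bsub>ZP\<^esub> x \<in> saturation I"
      by (rule saturation_radical[OF I sq Z.P.m_closed[OF a(1) xc]])
    then show ?thesis using a by blast
  qed
  obtain G N where G: "finite G" "G \<subseteq> Q" "lead_bound N (Idl\<^bsub>ZP\<^esub> G) (lead_monos \<Z> Q)"
    using finite_basis[OF Qi] .
  have "\<exists>a\<in>carrier ZP. a \<notin> Q \<and> (\<forall>x\<in>G. a \<otimes>\<^bsub>ZP\<^esub> x \<in> saturation I)"
    using G(1,2)
  proof (induction G rule: finite_induct)
    case empty
    have "\<one>\<^bsub>ZP\<^esub> \<notin> Q" using Q.one_imp_carrier Q.I_notcarr by blast
    then show ?case using Z.P.one_closed by blast
  next
    case (insert x G)
    then obtain a where a: "a \<in> carrier ZP" "a \<notin> Q" "\<And>y. y \<in> G \<Longrightarrow> a \<otimes>\<^bsub>ZP\<^esub> y \<in> saturation I" by blast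
    obtain b where b: "b \<in> carrier ZP" "b \<notin> Q" "b \<otimes>\<^bsub>ZP\<^esub> x \<in> saturation I" using one[of x] insert.prems by blast
    have "(a \<otimes>\<^bsub>ZP\<^esub> b) \<otimes>\<^bsub>ZP\<^esub> y \<in> saturation I" if y: "y \<in> insert x G" for y
    proof (cases "y = x")
      case True
      have "(a \<otimes>\<^bsub>ZP\<^esub> b) \<otimes>\<^bsub>ZP\<^esub> y = a \<otimes>\<^bsub>ZP\<^esub> (b \<otimes>\<^bsub>ZP\<^esub> x)"
        using a b True insert.prems Q.Icarr by (simp add: Z.P.m_assoc)
      then show ?thesis using ideal.I_l_closed[OF S b(3) a(1)] by simp
    next
      case False
      then have yG: "y \<in> G" using y by simp
      then have "y \<in> carrier ZP" using insert.prems Q.Icarr by blast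
      then have "(a \<otimes>\<^bsub>ZP\<^esub> b) \<otimes>\<^bsub>ZP\<^esub> y = b \<otimes>\<^bsub>ZP\<^esub> (a \<otimes>\<^bsub>ZP\<^esub> y)"
        using a(1) b(1) by (simp add: Z.P.m_ac)
      then show ?thesis using ideal.I_l_closed[OF S a(3)[OF yG] b(1)] by simp
    qed
    moreover have "a \<otimes>\<^bsub>ZP\<^esub> b \<notin> Q" using Q.I_prime[OF a(1) b(1)] a(2) b(2) by blast
    ultimately show ?case using a(1) b(1) by (intro bexI[of _ "a \<otimes>\<^bsub>ZP\<^esub> b"]) auto
  qed
  then obtain a where a: "a \<in> carrier ZP" "a \<notin> Q" "\<forall>x\<in>G. a \<otimes>\<^bsub>ZP\<^esub> x \<in> saturation I" by blast
  have Gc: "G \<subseteq> carrier ZP" using G(2) Q.Icarr by blast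
  have "Idl\<^bsub>ZP\<^esub> G \<subseteq> {y \<in> carrier ZP. a \<otimes>\<^bsub>ZP\<^esub> y \<in> saturation I}"
    using a(3) Gc by (intro Z.P.genideal_minimal Z.P.colon_ideal[OF S a(1)]) auto
  then have ann: "a \<otimes>\<^bsub>ZP\<^esub> y \<in> saturation I" if "y \<in> Idl\<^bsub>ZP\<^esub> G" for y using that by blast
  have "a \<otimes>\<^bsub>ZP\<^esub> g \<in> saturation I" if g: "g \<in> Q" for g
  proof -
    have gc: "g \<in> carrier ZP" using Q.Icarr[OF g] .
    obtain s where s: "(\<lambda>m. N ^ s * g m) \<in> Idl\<^bsub>ZP\<^esub> G"
      using lead_reduction[OF Qi Z.P.genideal_ideal[OF Gc] Z.P.genideal_minimal[OF Qi G(2)] G(3) g] by blast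
    have "a \<otimes>\<^bsub>ZP\<^esub> (mono_poly \<Z> (N ^ s) {#} \<otimes>\<^bsub>ZP\<^esub> g) \<in> saturation I"
      using ann[OF s] const_mult[OF gc] by simp
    moreover have "a \<otimes>\<^bsub>ZP\<^esub> (mono_poly \<Z> (N ^ s) {#} \<otimes>\<^bsub>ZP\<^esub> g) = (\<lambda>m. N ^ s * (a \<otimes>\<^bsub>ZP\<^esub> g) m)"
      using a(1) gc const_closed const_mult[of "a \<otimes>\<^bsub>ZP\<^esub> g" "N ^ s"] by (simp add: Z.P.m_lcomm)
    ultimately have "(\<lambda>m. N ^ s * (a \<otimes>\<^bsub>ZP\<^esub> g) m) \<in> saturation I" by simp
    moreover have "N ^ s \<noteq> 0" using G(3) by (simp add: lead_bound_def)
    ultimately show ?thesis by (intro saturation_scale[OF Z.P.m_closed[OF a(1) gc]])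
  qed
  then show ?thesis using a by blast
qed

end

locale split_setup = zpoly n for n +
  fixes f :: "nat multiset \<Rightarrow> int" and S :: "nat set"
  assumes f: "f \<in> carrier ZP" and S: "S \<subseteq> {1..n}" and lead_f: "lead_at \<Z> f (mset_set S)"
begin

definition gen_split :: "(nat multiset \<Rightarrow> int) set set" where
  "gen_split = {I. ideal I ZP \<and> almost_all_primes (\<lambda>p. split_mod p n f (base_change_Fp p n I))}"

lemma reduction_mod: "Factorial_Ring.prime p \<Longrightarrow> reduction_mod p"
  by (simp add: reduction_mod_def frobenius_def)

lemma split_mod_squarefree:
  assumes p: "Factorial_Ring.prime p" "\<not> int p dvd f (mset_set S)" and sp: "split_mod p n f I"
  shows "ideal I (mpoly_ring (Fp p) n)" "squarefree_monos (lead_monos (Fp p) I)"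
proof -
  interpret p: reduction_mod p n by (rule reduction_mod[OF p(1)])
  show I: "ideal I (mpoly_ring (Fp p) n)" using sp p.split_mod_iff by blast
  have "lead_at (Fp p) (mod_poly p f) (mset_set S)"
    using lead_f p(2) by (auto simp: lead_at_def mod_poly_def p.Fp_simps dvd_eq_mod_eq_0)
  then show "squarefree_monos (lead_monos (Fp p) I)"
    using p.trace_stable_squarefree[OF p.mod_poly_closed[OF f] S _ I] sp p.split_mod_iff by blast
qed

lemma gen_split_ideal: "I \<in> gen_split \<Longrightarrow> ideal I ZP"
  by (simp add: gen_split_def)

text \<open>
  One prime at which \<open>I\<close> is split and has the leading monomials of characteristic zero suffices.
\<close>

lemma gen_split_squarefree:
  assumes I: "I \<in> gen_split"
  shows "squarefree_monos (lead_monos \<Z> I)"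
proof -
  note Ii = gen_split_ideal[OF I]
  obtain N where N: "lead_bound N I (lead_monos \<Z> I)" using lead_bound_exists[OF Ii] .
  have "N \<noteq> 0" "f (mset_set S) \<noteq> 0" using N lead_f by (auto simp: lead_bound_def lead_at_def)
  then have "almost_all_primes (\<lambda>p. split_mod p n f (base_change_Fp p n I) \<and>
      \<not> int p dvd N \<and> \<not> int p dvd f (mset_set S))"
    using I by (intro almost_all_primes_conj almost_all_primes_not_dvd) (auto simp: gen_split_def)
  then obtain p where p: "Factorial_Ring.prime p" "split_mod p n f (base_change_Fp p n I)"
      "\<not> int p dvd N" "\<not> int p dvd f (mset_set S)"
    using almost_all_primes_ex by blast
  interpret p: reduction_mod p n by (rule reduction_mod[OF p(1)])
  show ?thesis
    using split_mod_squarefree(2)[OF p(1,4,2)]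
    unfolding p.base_change_Fp_eq(1)[OF Ii] p.lead_monos_mod[OF Ii N p(3)] .
qed

lemma gen_split_principal: "PIdl\<^bsub>ZP\<^esub> f \<in> gen_split"
  unfolding gen_split_def
  using Z.P.cgenideal_ideal[OF f] almost_all_primes_all reduction_mod.split_principal[OF reduction_mod f] by simp

lemma gen_split_sum:
  assumes I: "I \<in> gen_split" and J: "J \<in> gen_split"
  shows "I <+>\<^bsub>ZP\<^esub> J \<in> gen_split"
proof -
  note Ii = gen_split_ideal[OF I] and Ji = gen_split_ideal[OF J]
  have "almost_all_primes (\<lambda>p. split_mod p n f (base_change_Fp p n I) \<and> split_mod p n f (base_change_Fp p n J))"
    using I J by (intro almost_all_primes_conj) (auto simp: gen_split_def)
  then have "almost_all_primes (\<lambda>p. split_mod p n f (base_change_Fp p n (I <+>\<^bsub>ZP\<^esub> J)))"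
    by (rule almost_all_primes_mono) (use reduction_mod.split_sum[OF reduction_mod f Ii Ji] in blast)
  then show ?thesis using Z.P.add_ideals[OF Ii Ji] by (simp add: gen_split_def)
qed

lemma gen_split_inter:
  assumes I: "I \<in> gen_split" and J: "J \<in> gen_split"
  shows "I \<inter> J \<in> gen_split"
proof -
  note Ii = gen_split_ideal[OF I] and Ji = gen_split_ideal[OF J]
  have "almost_all_primes (\<lambda>p. (split_mod p n f (base_change_Fp p n I) \<and> split_mod p n f (base_change_Fp p n J)) \<and>
      (\<forall>g\<in>carrier ZP. (\<lambda>m. int p * g m) \<in> I <+>\<^bsub>ZP\<^esub> J \<longrightarrow> g \<in> I <+>\<^bsub>ZP\<^esub> J))"
    using I J by (intro almost_all_primes_conj almost_all_torsion_free Z.P.add_ideals) (auto simp: gen_split_def)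
  then have "almost_all_primes (\<lambda>p. split_mod p n f (base_change_Fp p n (I \<inter> J)))"
    by (rule almost_all_primes_mono) (use reduction_mod.split_inter[OF reduction_mod f Ii Ji] in blast)
  then show ?thesis using Z.P.i_intersect[OF Ii Ji] by (simp add: gen_split_def)
qed

text \<open>
  A minimal prime that contains a nonzero integer becomes the unit ideal at almost all primes;
  the others are annihilators modulo \<open>I\<close> up to denominators.
\<close>

lemma gen_split_component:
  assumes I: "I \<in> gen_split" and Q: "minimal_prime_over ZP I Q"
  shows "Q \<in> gen_split"
proof -
  note Ii = gen_split_ideal[OF I]
  have prime: "primeideal Q ZP" and IQ: "I \<subseteq> Q" using Q by (auto simp: minimal_prime_over_def)
  have Qi: "ideal Q ZP" by (rule primeideal.axioms(1)[OF prime])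
  have "almost_all_primes (\<lambda>p. split_mod p n f (base_change_Fp p n Q))"
  proof (cases "\<exists>c. c \<noteq> 0 \<and> mono_poly \<Z> c {#} \<in> Q")
    case True
    then obtain c where c: "c \<noteq> 0" "mono_poly \<Z> c {#} \<in> Q" by blast
    from almost_all_primes_not_dvd[OF c(1)] show ?thesis
      by (rule almost_all_primes_mono) (rule reduction_mod.split_vertical[OF reduction_mod f Qi c(2)])
  next
    case False
    then obtain a where a: "a \<in> carrier ZP" "a \<notin> Q" "\<forall>g\<in>Q. a \<otimes>\<^bsub>ZP\<^esub> g \<in> saturation I"
      using minimal_prime_annihilator[OF Ii gen_split_squarefree[OF I] Q] by blast
    obtain N where N: "lead_bound N I (lead_monos \<Z> I)" using lead_bound_exists[OF Ii] .
    have N0: "N \<noteq> 0" using N by (simp add: lead_bound_def)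
    have ann: "\<exists>s. (\<lambda>m. N ^ s * (a \<otimes>\<^bsub>ZP\<^esub> g) m) \<in> I" if "g \<in> Q" for g
      using saturation_power[OF Ii N] a(3) that by blast
    let ?J = "I <+>\<^bsub>ZP\<^esub> PIdl\<^bsub>ZP\<^esub> a"
    have J: "ideal ?J ZP" by (rule Z.P.add_ideals[OF Ii Z.P.cgenideal_ideal[OF a(1)]])
    have "almost_all_primes (\<lambda>p. (split_mod p n f (base_change_Fp p n I) \<and> \<not> int p dvd N) \<and>
        (\<forall>g\<in>carrier ZP. (\<lambda>m. int p * g m) \<in> ?J \<longrightarrow> g \<in> ?J))"
      using I N0 by (intro almost_all_primes_conj almost_all_torsion_free[OF J] almost_all_primes_not_dvd)
        (auto simp: gen_split_def)
    then show ?thesis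
      by (rule almost_all_primes_mono)
        (use reduction_mod.split_annihilator[OF reduction_mod f Ii prime IQ _ a(1,2) _ ann] in blast)
  qed
  then show ?thesis using Qi by (simp add: gen_split_def)
qed

abbreviation strata where "strata \<equiv> constructed ZP (PIdl\<^bsub>ZP\<^esub> f)"

lemma constructed_gen_split: "I \<in> strata \<Longrightarrow> I \<in> gen_split"
  by (induction rule: constructed.induct)
    (auto intro: gen_split_principal gen_split_component gen_split_sum gen_split_inter)

lemma constructed_ideal: "I \<in> strata \<Longrightarrow> ideal I ZP"
  using constructed_gen_split gen_split_ideal by blast

lemma lex_family_Q:
  assumes sub: "Is \<subseteq> gen_split" and int: "\<And>I J. I \<in> Is \<Longrightarrow> J \<in> Is \<Longrightarrow> I \<inter> J \<in> Is"
  shows "lex_family rat_ring n (base_change_Q n ` Is)"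
proof (intro lex_family.intro lex_family_axioms.intro Q.mpoly_points_axioms)
  fix A assume "A \<in> base_change_Q n ` Is"
  then obtain I where I: "I \<in> Is" "A = base_change_Q n I" by blast
  then have Ig: "I \<in> gen_split" using sub by blast
  show "ideal A QP" unfolding I(2) by (rule base_change_Q_ideal[OF gen_split_ideal[OF Ig]])
  show "squarefree_monos (lead_monos rat_ring A)"
    unfolding I(2) lead_monos_base_change_Q[OF gen_split_ideal[OF Ig]] by (rule gen_split_squarefree[OF Ig])
  fix B assume "B \<in> base_change_Q n ` Is"
  then obtain J where J: "J \<in> Is" "B = base_change_Q n J" by blast
  then have Jg: "J \<in> gen_split" using sub by blast
  have "A \<inter> B = base_change_Q n (I \<inter> J)"
    unfolding I(2) J(2) base_change_Q_inter[OF gen_split_ideal[OF Ig] gen_split_ideal[OF Jg]] ..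
  then show "A \<inter> B \<in> base_change_Q n ` Is" using int[OF I(1) J(1)] by blast
qed

text \<open>
  Over the rationals, the constructed ideals form a squarefree family closed under intersection.
\<close>

lemma finite_saturations: "finite (saturation ` strata)"
proof -
  have "finite (base_change_Q n ` strata)"
    using constructed_gen_split constructed.union
    by (intro lex_family.family_finite[OF lex_family_Q]) auto
  then have "finite ((\<lambda>A. {g \<in> carrier ZP. to_Q g \<in> A}) ` base_change_Q n ` strata)" by (rule finite_imageI)
  moreover have "saturation I = {g \<in> carrier ZP. to_Q g \<in> base_change_Q n I}" if "I \<in> strata" for I
    using saturation_iff[OF constructed_ideal[OF that]] by (auto simp: saturation_def)
  ultimately show ?thesis by (simp add: image_image cong: image_cong)
qed

definition saturates :: "int \<Rightarrow> (nat multiset \<Rightarrow> int) set \<Rightarrow> bool" where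
  "saturates N I \<longleftrightarrow> (\<forall>g\<in>saturation I. \<exists>s. (\<lambda>m. N ^ s * g m) \<in> I)"

lemma saturates_dvd:
  assumes I: "ideal I ZP" and sat: "saturates N I" and dvd: "N dvd N'"
  shows "saturates N' I"
  unfolding saturates_def
proof
  fix g assume "g \<in> saturation I"
  then obtain s where s: "(\<lambda>m. N ^ s * g m) \<in> I" using sat unfolding saturates_def by blast
  obtain k where k: "N' = N * k" using dvd by blast
  have "(\<lambda>m. k ^ s * (N ^ s * g m)) \<in> I" by (rule Z_scale[OF I s])
  moreover have "k ^ s * (N ^ s * g m) = N' ^ s * g m" for m by (simp add: k power_mult_distrib)
  ultimately show "\<exists>s. (\<lambda>m. N' ^ s * g m) \<in> I" by auto
qed

lemma power_shift:
  assumes "ideal I ZP" "(\<lambda>m. N ^ s * g m) \<in> I" "s \<le> t"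
  shows "(\<lambda>m. N ^ t * g m) \<in> I"
proof -
  have "(\<lambda>m. N ^ (t - s) * (N ^ s * g m)) \<in> I" by (rule Z_scale[OF assms(1,2)])
  moreover have "N ^ (t - s) * (N ^ s * g m) = N ^ t * g m" for m
    using assms(3) by (simp add: power_add[symmetric] mult.assoc[symmetric])
  ultimately show ?thesis by simp
qed

lemma saturates_inter:
  assumes I: "ideal I ZP" "saturates N I" and J: "ideal J ZP" "saturates N J"
  shows "saturates N (I \<inter> J)"
  unfolding saturates_def
proof
  fix g assume "g \<in> saturation (I \<inter> J)"
  then have "g \<in> saturation I" "g \<in> saturation J" unfolding saturation_def by blast+
  then obtain s t where "(\<lambda>m. N ^ s * g m) \<in> I" "(\<lambda>m. N ^ t * g m) \<in> J"
    using I(2) J(2) unfolding saturates_def by blast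
  then have "(\<lambda>m. N ^ max s t * g m) \<in> I \<inter> J"
    using power_shift[OF I(1), of N s g "max s t"] power_shift[OF J(1), of N t g "max s t"] by simp
  then show "\<exists>s. (\<lambda>m. N ^ s * g m) \<in> I \<inter> J" by blast
qed

text \<open>
  Only the sum of the two saturations has to be controlled; there are finitely many such sums.
\<close>

lemma saturates_sum:
  assumes I: "ideal I ZP" "saturates N I" and J: "ideal J ZP" "saturates N J"
    and M: "saturates N (saturation I <+>\<^bsub>ZP\<^esub> saturation J)"
  shows "saturates N (I <+>\<^bsub>ZP\<^esub> J)"
  unfolding saturates_def
proof
  fix g assume g: "g \<in> saturation (I <+>\<^bsub>ZP\<^esub> J)"
  have "I <+>\<^bsub>ZP\<^esub> J \<subseteq> saturation I <+>\<^bsub>ZP\<^esub> saturation J"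
    using saturation_superset[OF I(1)] saturation_superset[OF J(1)] unfolding set_add_def' by blast
  then have "g \<in> saturation (saturation I <+>\<^bsub>ZP\<^esub> saturation J)" using g unfolding saturation_def by blast
  then obtain s where "(\<lambda>m. N ^ s * g m) \<in> saturation I <+>\<^bsub>ZP\<^esub> saturation J"
    using M unfolding saturates_def by blast
  then obtain a b where a: "a \<in> saturation I" and b: "b \<in> saturation J" and ab: "(\<lambda>m. N ^ s * g m) = a \<oplus>\<^bsub>ZP\<^esub> b"
    unfolding set_add_def' by blast
  obtain t u where t: "(\<lambda>m. N ^ t * a m) \<in> I" and u: "(\<lambda>m. N ^ u * b m) \<in> J"
    using a b I(2) J(2) unfolding saturates_def by blast
  have tu: "(\<lambda>m. N ^ (t + u) * a m) \<in> I" "(\<lambda>m. N ^ (t + u) * b m) \<in> J"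
    using power_shift[OF I(1) t, of "t + u"] power_shift[OF J(1) u, of "t + u"] by auto
  have "N ^ (t + u + s) * g m = N ^ (t + u) * a m + N ^ (t + u) * b m" for m
  proof -
    have "N ^ s * g m = a m + b m" using fun_cong[OF ab, of m] by (simp add: Z.mpoly_add)
    then show ?thesis by (simp add: power_add distrib_left[symmetric] mult.assoc)
  qed
  then have "(\<lambda>m. N ^ (t + u + s) * g m) = (\<lambda>m. N ^ (t + u) * a m) \<oplus>\<^bsub>ZP\<^esub> (\<lambda>m. N ^ (t + u) * b m)"
    by (simp add: Z.mpoly_add)
  then have "(\<lambda>m. N ^ (t + u + s) * g m) \<in> I <+>\<^bsub>ZP\<^esub> J" using tu unfolding set_add_def' by blast
  then show "\<exists>s. (\<lambda>m. N ^ s * g m) \<in> I <+>\<^bsub>ZP\<^esub> J" by blast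
qed

text \<open>
  If no power of \<open>N\<close> lies in \<open>Q\<close>, then \<open>Q\<close> contains the saturation of \<open>I\<close> and is minimal over it.
  A nonzero integer in \<open>Q\<close> would be nilpotent modulo the saturation after localisation at \<open>Q\<close>,
  which is impossible because integers cancel there.
\<close>

lemma saturates_component:
  assumes I: "ideal I ZP" "saturates N I" and Q: "minimal_prime_over ZP I Q"
  shows "saturates N Q"
proof -
  have prime: "primeideal Q ZP" and IQ: "I \<subseteq> Q"
    and min: "\<And>Q'. primeideal Q' ZP \<Longrightarrow> I \<subseteq> Q' \<Longrightarrow> Q' \<subseteq> Q \<Longrightarrow> Q' = Q"
    using Q by (auto simp: minimal_prime_over_def)
  interpret Q: primeideal Q ZP by (rule prime)
  have cancel: "g \<in> Q" if "(\<lambda>m. c * g m) \<in> Q" "g \<in> carrier ZP" "mono_poly \<Z> c {#} \<notin> Q" for c g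
    using Q.I_prime[OF const_closed[of c] that(2)] that(1,3) unfolding const_mult[OF that(2)] by blast
  show ?thesis
  proof (cases "\<exists>s. mono_poly \<Z> (N ^ s) {#} \<in> Q")
    case True
    then obtain s where s: "mono_poly \<Z> (N ^ s) {#} \<in> Q" by blast
    have "(\<lambda>m. N ^ s * g m) \<in> Q" if "g \<in> saturation Q" for g
      using Q.I_r_closed[OF s, of g] const_mult[of g] that by (simp add: saturation_def)
    then show ?thesis unfolding saturates_def by blast
  next
    case False
    have SQ: "saturation I \<subseteq> Q"
    proof
      fix g assume g: "g \<in> saturation I"
      then obtain s where "(\<lambda>m. N ^ s * g m) \<in> I" using I(2) unfolding saturates_def by blast
      then show "g \<in> Q" using cancel[of "N ^ s" g] False IQ g by (auto simp: saturation_def)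
    qed
    have min': "minimal_prime_over ZP (saturation I) Q"
      unfolding minimal_prime_over_def
      using prime SQ min saturation_superset[OF I(1)] by blast
    have "g \<in> Q" if g: "g \<in> saturation Q" for g
    proof -
      obtain c where c: "c \<noteq> 0" "(\<lambda>m. c * g m) \<in> Q" and gc: "g \<in> carrier ZP"
        using g unfolding saturation_def by blast
      have "mono_poly \<Z> c {#} \<notin> Q"
      proof
        assume "mono_poly \<Z> c {#} \<in> Q"
        then obtain a k where a: "a \<in> carrier ZP" "a \<notin> Q"
            "a \<otimes>\<^bsub>ZP\<^esub> mono_poly \<Z> c {#} [^]\<^bsub>ZP\<^esub> (k::nat) \<in> saturation I"
          using Z.P.minimal_prime_nilpotent[OF saturation_ideal[OF I(1)] min'] by blast
        have "mono_poly \<Z> c {#} [^]\<^bsub>ZP\<^esub> k = mono_poly \<Z> (c ^ k) {#}"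
        proof (induction k)
          case 0
          then show ?case by (simp add: Z.mpoly_one)
        next
          case (Suc k)
          then show ?case using Z.mono_poly_mono_mult[of "c ^ k" c "{#}" n "{#}"] by (simp add: mult.commute)
        qed
        then have "(\<lambda>m. c ^ k * a m) \<in> saturation I"
          using a(1,3) const_mult[OF a(1), of "c ^ k"] Z.P.m_comm[OF a(1) const_closed[of "c ^ k"]] by simp
        then have "a \<in> saturation I" using c(1) by (intro saturation_scale[OF a(1), of "c ^ k"]) auto
        then show False using SQ a(2) by blast
      qed
      then show ?thesis using cancel[OF c(2) gc] by blast
    qed
    then show ?thesis unfolding saturates_def by (intro ballI exI[of _ 0]) simp
  qed
qed

text \<open>
  Take a common multiple of moduli for the ideal of \<open>f\<close> and for the finitely many sums of two
  saturations; it remains valid along the construction.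
\<close>

lemma uniform_saturation:
  obtains N where "N \<noteq> 0" "\<forall>I\<in>strata. saturates N I"
proof -
  have ex: "\<exists>N. N \<noteq> 0 \<and> saturates N I" if I: "ideal I ZP" for I
  proof -
    obtain N where N: "lead_bound N I (lead_monos \<Z> I)" using lead_bound_exists[OF I] .
    then have "N \<noteq> 0" by (simp add: lead_bound_def)
    moreover have "saturates N I" unfolding saturates_def using saturation_power[OF I N] by blast
    ultimately show ?thesis by blast
  qed
  let ?M = "saturation ` strata"
  define T where "T = insert (PIdl\<^bsub>ZP\<^esub> f) ((\<lambda>(A, B). A <+>\<^bsub>ZP\<^esub> B) ` (?M \<times> ?M))"
  have Tfin: "finite T" unfolding T_def using finite_saturations by simp
  have Tid: "ideal A ZP" if AT: "A \<in> T" for A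
  proof -
    consider "A = PIdl\<^bsub>ZP\<^esub> f" | I J where "I \<in> strata" "J \<in> strata" "A = saturation I <+>\<^bsub>ZP\<^esub> saturation J"
      using AT unfolding T_def by blast
    then show ?thesis
      by cases (simp_all add: Z.P.cgenideal_ideal[OF f] Z.P.add_ideals saturation_ideal constructed_ideal)
  qed
  have "\<forall>A\<in>T. \<exists>N. N \<noteq> 0 \<and> saturates N A" using ex Tid by blast
  from bchoice[OF this] obtain b where b: "\<forall>A\<in>T. b A \<noteq> 0 \<and> saturates (b A) A" ..
  let ?N = "\<Prod>A\<in>T. b A"
  have satT: "saturates ?N A" if "A \<in> T" for A
  proof (rule saturates_dvd[OF Tid[OF that]])
    show "saturates (b A) A" using b that by blast
    show "b A dvd ?N" by (rule dvd_prodI[OF Tfin that])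
  qed
  have "saturates ?N I" if "I \<in> strata" for I
    using that
  proof (induction rule: constructed.induct)
    case start
    then show ?case by (intro satT) (simp add: T_def)
  next
    case (component I Q)
    show ?case
      by (rule saturates_component[OF constructed_ideal[OF component.hyps(1)] component.IH component.hyps(2)])
  next
    case (intersection I J)
    have "saturates ?N (saturation I <+>\<^bsub>ZP\<^esub> saturation J)"
      using intersection.hyps by (intro satT) (auto simp: T_def)
    show ?case
      by (rule saturates_sum[OF constructed_ideal[OF intersection.hyps(1)] intersection.IH(1)
            constructed_ideal[OF intersection.hyps(2)] intersection.IH(2)]) fact
  next
    case (union I J)
    show ?case
      by (rule saturates_inter[OF constructed_ideal[OF union.hyps(1)] union.IH(1)
            constructed_ideal[OF union.hyps(2)] union.IH(2)])
  qed
  then have sat: "\<forall>I\<in>strata. saturates ?N I" by (intro ballI)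
  have "b A \<noteq> 0" if "A \<in> T" for A using b that by blast
  then have "?N \<noteq> 0" using Tfin by (simp add: prod_zero_iff)
  then show ?thesis using sat by (rule that)
qed

text \<open>
  Modulo a prime that does not divide \<open>N\<close>, an ideal and its saturation agree, and there are
  only finitely many saturations.
\<close>

lemma uniform_split: "almost_all_primes (\<lambda>p. \<forall>I\<in>strata. split_mod p n f (base_change_Fp p n I))"
proof -
  obtain N where N: "N \<noteq> 0" "\<forall>I\<in>strata. saturates N I" by (rule uniform_saturation)
  have "\<forall>A\<in>saturation ` strata. \<exists>I. I \<in> strata \<and> A = saturation I" by blast
  from bchoice[OF this] obtain r where r: "\<forall>A\<in>saturation ` strata. r A \<in> strata \<and> A = saturation (r A)" ..
  have "almost_all_primes (\<lambda>p. split_mod p n f (base_change_Fp p n (r A)))" if "A \<in> saturation ` strata" for A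
    using r that constructed_gen_split unfolding gen_split_def by blast
  then have "almost_all_primes (\<lambda>p. (\<forall>A\<in>saturation ` strata. split_mod p n f (base_change_Fp p n (r A))) \<and> \<not> int p dvd N)"
    by (intro almost_all_primes_conj almost_all_primes_ball[OF finite_saturations] almost_all_primes_not_dvd N(1))
  then show ?thesis
  proof (rule almost_all_primes_mono)
    fix p assume p: "Factorial_Ring.prime p"
      and *: "(\<forall>A\<in>saturation ` strata. split_mod p n f (base_change_Fp p n (r A))) \<and> \<not> int p dvd N"
    interpret p: reduction_mod p n by (rule reduction_mod[OF p])
    have img: "mod_poly p ` I = mod_poly p ` saturation I" if I: "I \<in> strata" for I
    proof
      note Ii = constructed_ideal[OF I]
      show "mod_poly p ` I \<subseteq> mod_poly p ` saturation I" using saturation_superset[OF Ii] by blast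
      have "mod_poly p g \<in> mod_poly p ` I" if g: "g \<in> saturation I" for g
      proof -
        obtain s where s: "(\<lambda>m. N ^ s * g m) \<in> I" using N(2) I g unfolding saturates_def by blast
        have "\<not> int p dvd N ^ s" using * p prime_dvd_power[of "int p" N s] by auto
        then show ?thesis using p.unit_cancel[OF Ii _ _ s] g by (simp add: saturation_def)
      qed
      then show "mod_poly p ` saturation I \<subseteq> mod_poly p ` I" by blast
    qed
    show "\<forall>I\<in>strata. split_mod p n f (base_change_Fp p n I)"
    proof
      fix I assume I: "I \<in> strata"
      let ?I = "r (saturation I)"
      have rI: "?I \<in> strata" "saturation I = saturation ?I" using r I by blast+
      have "base_change_Fp p n I = base_change_Fp p n ?I"
        unfolding p.base_change_Fp_eq(1)[OF constructed_ideal[OF I]]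
          p.base_change_Fp_eq(1)[OF constructed_ideal[OF rI(1)]] img[OF I] img[OF rI(1)]
        using rI(2) by simp
      then show "split_mod p n f (base_change_Fp p n I)" using * I by simp
    qed
  qed
qed

end

section \<open>Simultaneous degeneration\<close>

lemma lead_at_of_init_form:
  fixes f :: "nat multiset \<Rightarrow> int"
  assumes f: "f \<in> carrier (mpoly_ring \<Z> n)" and c: "c \<noteq> 0"
    and init: "init_form \<Z> lex_weighting f = mono_poly \<Z> c m"
  shows "lead_at \<Z> f m"
proof -
  interpret zpoly n .
  have "f \<noteq> (\<lambda>m. 0)"
  proof
    assume "f = (\<lambda>m. 0)"
    then have "init_form \<Z> lex_weighting f m = 0" by (simp add: init_form_def)
    then show False using init c by (simp add: mono_poly_def)
  qed
  then obtain a where a: "lead_at \<Z> f a" using Z.lead_at_exists[OF f] by auto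
  then have "mono_poly \<Z> (f a) a = mono_poly \<Z> c m" using init_form_lead[OF a] init by simp
  then have "mono_poly \<Z> (f a) a m = c" by (simp add: mono_poly_def)
  then have "a = m" using c by (simp add: mono_poly_def split: if_splits)
  then show ?thesis using a by simp
qed

theorem (in lex_family) family_degeneration:
  shows "(\<forall>I\<in>Is. reduced_ring (mpoly_ring K n Quot I) \<and>
      stanley_reisner K n (init_ideal K n lex_weighting I)) \<and>
    (\<exists>\<Phi>. constructible_map K n \<Phi> \<and> bij_betw \<Phi> (affine_space K n) (affine_space K n) \<and>
      (\<forall>I\<in>Is. \<Phi> ` zeros K n I \<subseteq> zeros K n (init_ideal K n lex_weighting I)))"
  by (intro conjI ballI simultaneous_degeneration squarefree_imp_reduced stanley_reisner_init ideals squarefree)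

lemma (in split_setup) lex_family_Fp:
  assumes p: "Factorial_Ring.prime p" "\<not> int p dvd f (mset_set S)"
  shows "lex_family (Fp p) n {I. split_mod p n f I}"
proof -
  interpret p: frobenius p n using p(1) by (rule frobenius.intro)
  show ?thesis
  proof (intro lex_family.intro lex_family_axioms.intro p.mpoly_points_axioms)
    fix I J assume I: "I \<in> {I. split_mod p n f I}" and J: "J \<in> {I. split_mod p n f I}"
    then show "I \<inter> J \<in> {I. split_mod p n f I}"
      unfolding mem_Collect_eq p.split_mod_iff using p.P.i_intersect by blast
  qed (use split_mod_squarefree[OF p] in auto)
qed

theorem theorem4:
  fixes n k :: nat and f :: "nat multiset \<Rightarrow> int" and c :: int and S :: "nat set"
  assumes "f \<in> carrier (mpoly_ring \<Z> n)"
    and "total_degree \<Z> f = k"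
    and "S \<subseteq> {1..n}" and "card S = k" and "c \<noteq> 0"
    and "init_form \<Z> lex_weighting f = mono_poly \<Z> c (mset_set S)"
  shows "\<exists>E. finite E \<and>
    (\<forall>p. Factorial_Ring.prime p \<and> p \<notin> E \<longrightarrow>
      (let Ys = base_change_Fp p n ` constructed (mpoly_ring \<Z> n) (PIdl\<^bsub>mpoly_ring \<Z> n\<^esub> f) \<union>
               {I. split_mod p n f I}
       in (\<forall>I\<in>Ys. reduced_ring (mpoly_ring (Fp p) n Quot I) \<and>
                 stanley_reisner (Fp p) n (init_ideal (Fp p) n lex_weighting I)) \<and>
          (\<exists>\<Phi>. constructible_map (Fp p) n \<Phi> \<and>
               bij_betw \<Phi> (affine_space (Fp p) n) (affine_space (Fp p) n) \<and>
               (\<forall>I\<in>Ys. \<Phi> ` zeros (Fp p) n I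
                        \<subseteq> zeros (Fp p) n (init_ideal (Fp p) n lex_weighting I))))) \<and>
    (let Ys = base_change_Q n `
               (constructed (mpoly_ring \<Z> n) (PIdl\<^bsub>mpoly_ring \<Z> n\<^esub> f) \<union>
                {I. ideal I (mpoly_ring \<Z> n) \<and>
                    (\<exists>E'. finite E' \<and>
                       (\<forall>p. Factorial_Ring.prime p \<and> p \<notin> E' \<longrightarrow> split_mod p n f (base_change_Fp p n I)))})
     in (\<forall>I\<in>Ys. reduced_ring (mpoly_ring rat_ring n Quot I) \<and>
               stanley_reisner rat_ring n (init_ideal rat_ring n lex_weighting I)) \<and>
        (\<exists>\<Phi>. constructible_map rat_ring n \<Phi> \<and>
             bij_betw \<Phi> (affine_space rat_ring n) (affine_space rat_ring n) \<and>
             (\<forall>I\<in>Ys. \<Phi> ` zeros rat_ring n I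
                      \<subseteq> zeros rat_ring n (init_ideal rat_ring n lex_weighting I))))"
proof -
  interpret split_setup n f S
    by (intro split_setup.intro assms(1,3) lead_at_of_init_form[OF assms(1,5,6)])
  let ?good = "\<lambda>p. (\<forall>I\<in>strata. split_mod p n f (base_change_Fp p n I)) \<and> \<not> int p dvd f (mset_set S)"
  have "f (mset_set S) \<noteq> 0" using lead_f by (simp add: lead_at_def)
  then have "almost_all_primes ?good"
    by (intro almost_all_primes_conj uniform_split almost_all_primes_not_dvd)
  then obtain E where E: "finite E" "\<And>p. Factorial_Ring.prime p \<Longrightarrow> p \<notin> E \<Longrightarrow> ?good p"
    unfolding almost_all_primes_def by blast
  have Fp_family: "base_change_Fp p n ` strata \<union> {I. split_mod p n f I} = {I. split_mod p n f I}"
    if "Factorial_Ring.prime p" "p \<notin> E" for p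
    using E(2)[OF that] by blast
  have Q_family: "strata \<union> {I. ideal I ZP \<and> (\<exists>E'. finite E' \<and>
      (\<forall>p. Factorial_Ring.prime p \<and> p \<notin> E' \<longrightarrow> split_mod p n f (base_change_Fp p n I)))} = gen_split"
    using constructed_gen_split unfolding gen_split_def almost_all_primes_def by blast
  show ?thesis
  proof (intro exI[of _ E] conjI allI impI E(1), goal_cases)
    case (1 p)
    then have p: "Factorial_Ring.prime p" "p \<notin> E" by auto
    show ?case
      unfolding Let_def Fp_family[OF p]
      by (rule lex_family.family_degeneration[OF lex_family_Fp]) (use E(2)[OF p] p(1) in auto)
  next
    case 2
    show ?case
      unfolding Let_def Q_family
      by (rule lex_family.family_degeneration[OF lex_family_Q]) (auto intro: gen_split_inter)
  qed
qed

end
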